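(* The single-facility Minmax Regret Maximal Covering Location Problem with Edge Demand with unknown linear demand realisations, i.e. the problem of finding $x^*\in G$ attaining $$\min_{x\in G}\ \max_{lb\le w\le ub}\left(\max_{y\in G}g(y,w)-g(x,w)\right),$$ where $w$ ranges over demand realisations that are linear on each edge, can be solved to optimality in polynomial time.
   Context: Network. $G=(V,E)$ is a finite connected undirected graph with node set $V=\{1,\dots,n\}$ and edge set $E$, $|E|=m$. Every edge $e=[k,l]$ has length $\ell_e>0$. $G$ also denotes the continuum of all points of the network. A point on the edge $e=[k,l]$ is written $x=(e,t)$, $0\le t\le 1$, where the distance from $x$ to $k$ is $t\ell_e$ and to $l$ is $(1-t)\ell_e$ (in particular $d(k,l)=\ell_e$). For nodes, $d$ is the shortest path length; for $x=(e_x,t_x)$ with $e_x=[k,l]$ and $i\in V$, $d(x,i)=\min\{t_x\ell_{e_x}+d(k,i),(1-t_x)\ell_{e_x}+d(l,i)\}$; $d(x,y)$ for two points $x,y\in G$ is the analogous shortest path distance in the network. $R>0$ is a fixed coverage radius, and $C_e(x)=\{z\in e: d(x,z)\le R\}$. Demand. For each edge $e$ linear functions $lb_e(t)=a_e^{lb}+b_e^{lb}t$ and $ub_e(t)=a_e^{ub}+b_e^{ub}t$ with $0\le lb_e(t)\le ub_e(t)$ for $t\in[0,1]$ are given. A demand realisation is $w=(w_e)_{e\in E}$ with $w_e(t)=a_e^w+b_e^wt$ and $lb_e(t)\le w_e(t)\le ub_e(t)$ for all $t\in[0,1]$, $e\in E$ (written $lb\le w\le ub$). $g_e(x,w_e)=\int_{\{t\in[0,1]:(e,t)\in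 C_e(x)\}}w_e(t)\,dt$ and $g(x,w)=\sum_{e\in E}g_e(x,w_e)$. Time is measured as a function of the size $m$ of the network, where operations on real numbers and on a bounded number of algebraic arcs of bounded degree (e.g. computing intersections of two arcs) count as constant time. *)

theory Defs
  imports "HOL-Analysis.Analysis" "Graph_Theory.Graph_Theory"
    "HOL-Computational_Algebra.Polynomial"
begin

section \<open>Networks\<close>

text \<open>
  An edge \<open>e = [k, l]\<close> carries its two end nodes, its length, and the coefficients of the linear
  bounds \<open>lb\<^sub>e(t) = lb_a + lb_b * t\<close> and \<open>ub\<^sub>e(t) = ub_a + ub_b * t\<close>. The order of the end nodes
  fixes only the direction of the parameter \<open>t\<close>. Edges are referred to by their list position.
\<close>

record edge =
  node_k :: nat
  node_l :: nat
  edge_length :: real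
  lb_a :: real
  lb_b :: real
  ub_a :: real
  ub_b :: real

record network =
  num_nodes :: nat
  edges :: "edge list"
  radius :: real

abbreviation num_edges :: "network \<Rightarrow> nat" where
  "num_edges N \<equiv> length (edges N)"

text \<open>
  As usual in \<open>Graph_Theory\<close>, an undirected graph is a symmetric digraph: every edge \<open>e = [k, l]\<close>
  yields the two arcs \<open>(e, True)\<close> from \<open>k\<close> to \<open>l\<close> and \<open>(e, False)\<close> from \<open>l\<close> to \<open>k\<close>.
\<close>

definition graph_of :: "network \<Rightarrow> (nat, nat \<times> bool) pre_digraph" where
  "graph_of N =
    \<lparr> verts = {1..num_nodes N},
      arcs = {..<num_edges N} \<times> UNIV,
      tail = (\<lambda>(e, dir). if dir then node_k (edges N ! e) else node_l (edges N ! e)),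
      head = (\<lambda>(e, dir). if dir then node_l (edges N ! e) else node_k (edges N ! e)) \<rparr>"

definition node_dist :: "network \<Rightarrow> nat \<Rightarrow> nat \<Rightarrow> real" where
  "node_dist N u v =
    real_of_ereal (wf_digraph.\<mu> (graph_of N) (\<lambda>(e, dir). edge_length (edges N ! e)) u v)"

definition lb :: "network \<Rightarrow> nat \<Rightarrow> real \<Rightarrow> real" where
  "lb N e t = lb_a (edges N ! e) + lb_b (edges N ! e) * t"

definition ub :: "network \<Rightarrow> nat \<Rightarrow> real \<Rightarrow> real" where
  "ub N e t = ub_a (edges N ! e) + ub_b (edges N ! e) * t"

text \<open>
  The locale predicate \<open>graph\<close> says that the graph is finite and simple. The condition on
  \<open>node_dist\<close> expresses that a point \<open>(e, t)\<close> on \<open>e = [k, l]\<close> has distance \<open>t * edge_length\<close> to \<open>k\<close>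
  and \<open>(1 - t) * edge_length\<close> to \<open>l\<close>.
\<close>

definition is_network :: "network \<Rightarrow> bool" where
  "is_network N \<longleftrightarrow>
    graph (graph_of N) \<and> Digraph_Component.connected (graph_of N) \<and>
    (\<forall>e < num_edges N.
       edge_length (edges N ! e) > 0 \<and>
       node_dist N (node_k (edges N ! e)) (node_l (edges N ! e)) = edge_length (edges N ! e) \<and>
       (\<forall>t\<in>{0..1}. 0 \<le> lb N e t \<and> lb N e t \<le> ub N e t)) \<and>
    radius N > 0"


section \<open>Points and distances\<close>

text \<open>
  Nodes are listed separately so that the network with one node and no edge has its point as well.
  A node of an edge \<open>e = [k, l]\<close> is thus represented also by \<open>On_Edge e 0\<close> or \<open>On_Edge e 1\<close>; these
  representations have the same distances to all points.
\<close>

datatype point = At_Node nat | On_Edge nat real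

definition points :: "network \<Rightarrow> point set" where
  "points N = At_Node ` {1..num_nodes N} \<union> {On_Edge e t |e t. e < num_edges N \<and> t \<in> {0..1}}"

fun dist_node :: "network \<Rightarrow> point \<Rightarrow> nat \<Rightarrow> real" where
  "dist_node N (At_Node v) i = node_dist N v i"
| "dist_node N (On_Edge e t) i =
     min (t * edge_length (edges N ! e) + node_dist N (node_k (edges N ! e)) i)
         ((1 - t) * edge_length (edges N ! e) + node_dist N (node_l (edges N ! e)) i)"

text \<open>
  A shortest path to a point \<open>(f, s)\<close> enters \<open>f\<close> through one of its end nodes, unless it starts on
  \<open>f\<close> and stays there.
\<close>

fun dist_edge_point :: "network \<Rightarrow> point \<Rightarrow> nat \<Rightarrow> real \<Rightarrow> real" where
  "dist_edge_point N x f s =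
    (let via_nodes =
           min (dist_node N x (node_k (edges N ! f)) + s * edge_length (edges N ! f))
               (dist_node N x (node_l (edges N ! f)) + (1 - s) * edge_length (edges N ! f))
     in case x of
          At_Node v \<Rightarrow> via_nodes
        | On_Edge e t \<Rightarrow>
            if e = f then min via_nodes (\<bar>t - s\<bar> * edge_length (edges N ! f)) else via_nodes)"

fun point_dist :: "network \<Rightarrow> point \<Rightarrow> point \<Rightarrow> real" where
  "point_dist N x (At_Node v) = dist_node N x v"
| "point_dist N x (On_Edge f s) = dist_edge_point N x f s"


section \<open>Coverage and regret\<close>

text \<open>
  \<open>w e = (a, b)\<close> stands for the linear demand \<open>a + b * t\<close> on edge \<open>e\<close>; only the values of \<open>w\<close> at
  edges of the network matter.
\<close>

type_synonym demand = "nat \<Rightarrow> real \<times> real"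

definition demand_at :: "demand \<Rightarrow> nat \<Rightarrow> real \<Rightarrow> real" where
  "demand_at w e t = fst (w e) + snd (w e) * t"

definition realisations :: "network \<Rightarrow> demand set" where
  "realisations N =
    {w. \<forall>e < num_edges N. \<forall>t\<in>{0..1}. lb N e t \<le> demand_at w e t \<and> demand_at w e t \<le> ub N e t}"

definition covered :: "network \<Rightarrow> nat \<Rightarrow> point \<Rightarrow> real set" where
  "covered N e x = {t\<in>{0..1}. point_dist N x (On_Edge e t) \<le> radius N}"

definition edge_coverage :: "network \<Rightarrow> nat \<Rightarrow> point \<Rightarrow> demand \<Rightarrow> real" where
  "edge_coverage N e x w = (LBINT t:covered N e x. demand_at w e t)"

definition coverage :: "network \<Rightarrow> point \<Rightarrow> demand \<Rightarrow> real" where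
  "coverage N x w = (\<Sum>e<num_edges N. edge_coverage N e x w)"

text \<open>
  The suprema below range over nonempty sets that are bounded above, as proved further down, so
  each of them is the maximum whenever the maximum exists.
\<close>

definition max_coverage :: "network \<Rightarrow> demand \<Rightarrow> real" where
  "max_coverage N w = (SUP y\<in>points N. coverage N y w)"

definition max_regret :: "network \<Rightarrow> point \<Rightarrow> real" where
  "max_regret N x = (SUP w\<in>realisations N. max_coverage N w - coverage N x w)"

definition minmax_regret_solution :: "network \<Rightarrow> point \<Rightarrow> bool" where
  "minmax_regret_solution N x \<longleftrightarrow> is_arg_min (max_regret N) (\<lambda>x. x \<in> points N) x"

lemma points_nonempty:
  assumes "is_network N"
  shows "points N \<noteq> {}"
proof -
  have "verts (graph_of N) \<noteq> {}"
    using assms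
    by (auto simp: is_network_def Digraph_Component.connected_def strongly_connected_def)
  then show ?thesis
    by (simp add: graph_of_def points_def)
qed

lemma realisations_nonempty:
  assumes "is_network N"
  shows "realisations N \<noteq> {}"
proof -
  have "(\<lambda>e. (lb_a (edges N ! e), lb_b (edges N ! e))) \<in> realisations N"
    using assms by (auto simp: is_network_def realisations_def demand_at_def lb_def)
  then show ?thesis
    by blast
qed

lemma edge_coverage_bounds:
  assumes "is_network N" "w \<in> realisations N" "e < num_edges N"
  shows "0 \<le> edge_coverage N e x w"
    and "edge_coverage N e x w \<le> \<bar>ub_a (edges N ! e)\<bar> + \<bar>ub_b (edges N ! e)\<bar>"
proof -
  let ?B = "\<bar>ub_a (edges N ! e)\<bar> + \<bar>ub_b (edges N ! e)\<bar>"
  have lb_nonneg: "0 \<le> lb N e t" if "t \<in> {0..1}" for t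
    using assms(1,3) that unfolding is_network_def by blast
  have between: "lb N e t \<le> demand_at w e t" "demand_at w e t \<le> ub N e t" if "t \<in> {0..1}" for t
    using assms(2,3) that unfolding realisations_def by blast+
  have nonneg: "0 \<le> demand_at w e t" if "t \<in> {0..1}" for t
    using lb_nonneg[OF that] between(1)[OF that] by linarith
  have le: "demand_at w e t \<le> ?B" if "t \<in> {0..1}" for t
  proof -
    have "demand_at w e t \<le> ub N e t"
      using that by (rule between(2))
    also have "\<dots> \<le> \<bar>ub_a (edges N ! e)\<bar> + \<bar>ub_b (edges N ! e)\<bar> * t"
      unfolding ub_def using that by (intro add_mono mult_right_mono) auto
    also have "\<dots> \<le> ?B"
      using that by (simp add: mult_left_le)
    finally show ?thesis .
  qed
  show "0 \<le> edge_coverage N e x w"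
    unfolding edge_coverage_def set_lebesgue_integral_def
    by (rule Bochner_Integration.integral_nonneg)
       (use nonneg in \<open>auto simp: covered_def indicator_def\<close>)
  have "edge_coverage N e x w \<le> (\<integral>t. indicator {0..1::real} t * ?B \<partial>lborel)"
    unfolding edge_coverage_def set_lebesgue_integral_def
  proof (rule Bochner_Integration.integral_mono')
    show "integrable lborel (\<lambda>t::real. indicator {0..1} t * ?B)"
      by simp
  qed (use le nonneg in \<open>auto simp: covered_def indicator_def\<close>)
  then show "edge_coverage N e x w \<le> ?B"
    by simp
qed

lemma coverage_bounds:
  assumes "is_network N" "w \<in> realisations N"
  shows "0 \<le> coverage N x w"
    and "coverage N x w \<le> (\<Sum>e<num_edges N. \<bar>ub_a (edges N ! e)\<bar> + \<bar>ub_b (edges N ! e)\<bar>)"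
  unfolding coverage_def
  using edge_coverage_bounds[OF assms] by (auto intro!: sum_nonneg sum_mono)

lemma bdd_above_coverage:
  assumes "is_network N" "w \<in> realisations N"
  shows "bdd_above ((\<lambda>y. coverage N y w) ` points N)"
  using coverage_bounds(2)[OF assms] by (rule bdd_aboveI2)

lemma bdd_above_regret:
  assumes "is_network N"
  shows "bdd_above ((\<lambda>w. max_coverage N w - coverage N x w) ` realisations N)"
proof (rule bdd_aboveI2)
  fix w assume w: "w \<in> realisations N"
  have "max_coverage N w \<le> (\<Sum>e<num_edges N. \<bar>ub_a (edges N ! e)\<bar> + \<bar>ub_b (edges N ! e)\<bar>)"
    unfolding max_coverage_def
    using points_nonempty[OF assms] coverage_bounds(2)[OF assms w] by (rule cSUP_least)
  with coverage_bounds(1)[OF assms w, of x]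
  show "max_coverage N w - coverage N x w
      \<le> (\<Sum>e<num_edges N. \<bar>ub_a (edges N ! e)\<bar> + \<bar>ub_b (edges N ! e)\<bar>)"
    by linarith
qed


section \<open>The model of computation\<close>

text \<open>
  A real random access machine, programmed in a while language. Memory consists of arrays of
  natural numbers and arrays of reals, addressed by a name and a list of indices (the empty list
  for a scalar). Natural numbers serve as indices and counters and can only be added, subtracted
  (truncated at 0) and compared. Reals can be compared and combined by exact field operations
  (with \<open>x / 0 = 0\<close>) and by \<open>Root k [c0, ..., cd]\<close>, the real root number \<open>k\<close> (counting distinct
  roots in increasing order from 0) of the polynomial with coefficients \<open>c0, ..., cd\<close>, or 0 if this
  polynomial is zero or has no such root. The degree \<open>d\<close> is fixed by the program text, hence
  bounded independently of the input. By elimination of variables, bounded numbers of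
  computations with algebraic arcs of bounded degree, such as intersecting two of them, reduce to
  bounded numbers of these operations. There is no conversion of reals to natural numbers (no
  rounding), and the constants of a program are integers.
\<close>

datatype nexp =
    NConst nat
  | NCell string "nexp list"
  | NAdd nexp nexp
  | NSub nexp nexp

datatype rexp =
    RConst int
  | RCell string "nexp list"
  | RAdd rexp rexp
  | RSub rexp rexp
  | RMul rexp rexp
  | RDiv rexp rexp
  | Root nat "rexp list"

datatype bexp =
    NLe nexp nexp
  | RLe rexp rexp
  | BNot bexp
  | BAnd bexp bexp

datatype com =
    Skip
  | NAssign string "nexp list" nexp
  | RAssign string "nexp list" rexp
  | Seq com com
  | Cond bexp com com
  | While bexp com

record store =
  nat_cells :: "string \<Rightarrow> nat list \<Rightarrow> nat"
  real_cells :: "string \<Rightarrow> nat list \<Rightarrow> real"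

definition kth_root :: "nat \<Rightarrow> real poly \<Rightarrow> real" where
  "kth_root k p =
    (if p \<noteq> 0 \<and> k < card {x. poly p x = 0} then sorted_list_of_set {x. poly p x = 0} ! k else 0)"

fun nval :: "nexp \<Rightarrow> store \<Rightarrow> nat" where
  "nval (NConst n) s = n"
| "nval (NCell a is) s = nat_cells s a (map (\<lambda>i. nval i s) is)"
| "nval (NAdd i j) s = nval i s + nval j s"
| "nval (NSub i j) s = nval i s - nval j s"

fun rval :: "rexp \<Rightarrow> store \<Rightarrow> real" where
  "rval (RConst c) s = of_int c"
| "rval (RCell a is) s = real_cells s a (map (\<lambda>i. nval i s) is)"
| "rval (RAdd x y) s = rval x s + rval y s"
| "rval (RSub x y) s = rval x s - rval y s"
| "rval (RMul x y) s = rval x s * rval y s"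
| "rval (RDiv x y) s = rval x s / rval y s"
| "rval (Root k cs) s = kth_root k (Poly (map (\<lambda>c. rval c s) cs))"

fun bval :: "bexp \<Rightarrow> store \<Rightarrow> bool" where
  "bval (NLe i j) s \<longleftrightarrow> nval i s \<le> nval j s"
| "bval (RLe x y) s \<longleftrightarrow> rval x s \<le> rval y s"
| "bval (BNot b) s \<longleftrightarrow> \<not> bval b s"
| "bval (BAnd b c) s \<longleftrightarrow> bval b s \<and> bval c s"

definition write_nat :: "string \<Rightarrow> nat list \<Rightarrow> nat \<Rightarrow> store \<Rightarrow> store" where
  "write_nat a is v s = s\<lparr>nat_cells := (nat_cells s)(a := (nat_cells s a)(is := v))\<rparr>"

definition write_real :: "string \<Rightarrow> nat list \<Rightarrow> real \<Rightarrow> store \<Rightarrow> store" where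
  "write_real a is v s = s\<lparr>real_cells := (real_cells s)(a := (real_cells s a)(is := v))\<rparr>"

text \<open>
  \<open>exec c s t s'\<close>: started in \<open>s\<close>, program \<open>c\<close> halts in \<open>s'\<close> after time \<open>t\<close>. Each assignment and
  each test takes one unit of time: the expressions occurring in a program have a size that does
  not depend on the input, so that this is the number of elementary operations up to a constant
  factor.
\<close>

inductive exec :: "com \<Rightarrow> store \<Rightarrow> nat \<Rightarrow> store \<Rightarrow> bool" where
  exec_Skip: "exec Skip s 1 s"
| exec_NAssign: "exec (NAssign a is i) s 1 (write_nat a (map (\<lambda>j. nval j s) is) (nval i s) s)"
| exec_RAssign: "exec (RAssign a is x) s 1 (write_real a (map (\<lambda>j. nval j s) is) (rval x s) s)"
| exec_Seq: "exec c s t s' \<Longrightarrow> exec d s' t' s'' \<Longrightarrow> exec (Seq c d) s (t + t') s''"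
| exec_IfTrue: "bval b s \<Longrightarrow> exec c s t s' \<Longrightarrow> exec (Cond b c d) s (1 + t) s'"
| exec_IfFalse: "\<not> bval b s \<Longrightarrow> exec d s t s' \<Longrightarrow> exec (Cond b c d) s (1 + t) s'"
| exec_WhileFalse: "\<not> bval b s \<Longrightarrow> exec (While b c) s 1 s"
| exec_WhileTrue: "bval b s \<Longrightarrow> exec c s t s' \<Longrightarrow> exec (While b c) s' t' s'' \<Longrightarrow>
    exec (While b c) s (1 + t + t') s''"

inductive_cases exec_elims:
  "exec Skip s t s'"
  "exec (NAssign a is i) s t s'"
  "exec (RAssign a is x) s t s'"
  "exec (Seq c d) s t s'"
  "exec (Cond b c d) s t s'"

inductive_cases exec_WhileE: "exec (While b c) s t s'"

lemma exec_deterministic: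
  "exec c s t s' \<Longrightarrow> exec c s u s'' \<Longrightarrow> u = t \<and> s'' = s'"
proof (induction arbitrary: u s'' rule: exec.induct)
  case (exec_Seq c s t s' d t' r)
  from exec_Seq.prems obtain v v' q
    where u: "u = v + v'" and "exec c s v q" "exec d q v' s''"
    by (rule exec_elims(4))
  then have "v = t" "q = s'"
    using exec_Seq.IH(1) by simp_all
  with \<open>exec d q v' s''\<close> have "v' = t'" "s'' = r"
    using exec_Seq.IH(2) by simp_all
  with u \<open>v = t\<close> show ?case
    by simp
next
  case (exec_IfTrue b s c t s' d)
  from exec_IfTrue.prems have "\<exists>v. u = Suc v \<and> exec c s v s''"
    by (rule exec_elims(5)) (use exec_IfTrue.hyps(1) in simp_all)
  then obtain v where u: "u = Suc v" and "exec c s v s''"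
    by (elim exE conjE)
  then have "v = t \<and> s'' = s'"
    using exec_IfTrue.IH by simp
  with u show ?case
    by simp
next
  case (exec_IfFalse b s d t s' c)
  from exec_IfFalse.prems have "\<exists>v. u = Suc v \<and> exec d s v s''"
    by (rule exec_elims(5)) (use exec_IfFalse.hyps(1) in simp_all)
  then obtain v where u: "u = Suc v" and "exec d s v s''"
    by (elim exE conjE)
  then have "v = t \<and> s'' = s'"
    using exec_IfFalse.IH by simp
  with u show ?case
    by simp
next
  case (exec_WhileTrue b s c t s' t' r)
  from exec_WhileTrue.prems
  have "\<exists>v v' q. u = Suc (v + v') \<and> exec c s v q \<and> exec (While b c) q v' s''"
    by (rule exec_WhileE) (use exec_WhileTrue.hyps(1) in \<open>simp, metis\<close>)
  then obtain v v' q
    where u: "u = Suc (v + v')" and "exec c s v q" "exec (While b c) q v' s''"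
    by (elim exE conjE)
  then have "v = t" "q = s'"
    using exec_WhileTrue.IH(1) by simp_all
  with \<open>exec (While b c) q v' s''\<close> have "v' = t'" "s'' = r"
    using exec_WhileTrue.IH(2) by simp_all
  with u \<open>v = t\<close> show ?case
    by simp
next
  case (exec_WhileFalse b s c)
  from exec_WhileFalse.prems show ?case
    by (rule exec_WhileE) (use exec_WhileFalse.hyps in simp_all)
qed (auto elim: exec_elims)


section \<open>Input and output\<close>

definition scalar :: "'a \<Rightarrow> nat list \<Rightarrow> 'a::zero" where
  "scalar v is = (if is = [] then v else 0)"

definition edge_array :: "network \<Rightarrow> (edge \<Rightarrow> 'a) \<Rightarrow> nat list \<Rightarrow> 'a::zero" where
  "edge_array N f is =
    (if \<exists>e < num_edges N. is = [e] then f (edges N ! hd is) else 0)"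

definition input_store :: "network \<Rightarrow> store" where
  "input_store N =
    \<lparr> nat_cells = (\<lambda>_ _. 0)
        (''num_nodes'' := scalar (num_nodes N),
         ''num_edges'' := scalar (num_edges N),
         ''node_k'' := edge_array N node_k,
         ''node_l'' := edge_array N node_l),
      real_cells = (\<lambda>_ _. 0)
        (''radius'' := scalar (radius N),
         ''edge_length'' := edge_array N edge_length,
         ''lb_a'' := edge_array N lb_a,
         ''lb_b'' := edge_array N lb_b,
         ''ub_a'' := edge_array N ub_a,
         ''ub_b'' := edge_array N ub_b) \<rparr>"

text \<open>Nodes are numbered from 1, so the scalar \<open>at_node\<close> is 0 just when the output lies on an edge.\<close>

definition output_point :: "store \<Rightarrow> point" where
  "output_point s =
    (if nat_cells s ''at_node'' [] = 0
     then On_Edge (nat_cells s ''edge'' []) (real_cells s ''t'' [])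
     else At_Node (nat_cells s ''at_node'' []))"

end

theory Submission
  imports Defs
begin

text \<open>
  For fixed points \<open>x\<close> and \<open>y\<close> the worst demand is chosen independently at the two ends of every
  edge, so that the regret of \<open>x\<close> against \<open>y\<close> is a sum of hinge functions
  \<open>z \<mapsto> max (l * z) (r * z)\<close> of the differences of two moments of the covered sets. Between
  finitely many breakpoints these moments are quadratic in the position of the point. Hinges are
  convex, so in \<open>y\<close> the regret is maximal at a breakpoint or at the vertex of a quadratic that belongs
  to a cell of the arrangement of the curves on which a moment of \<open>x\<close> equals that of \<open>y\<close>; the vertex
  depends on the cell only. Cells are found above the midpoints between critical positions of \<open>x\<close>,
  at which the order of the curves may change. This leaves polynomially many rivals \<open>y\<close>, and the
  upper envelope of their regrets, which is piecewise quadratic in \<open>x\<close>, is minimal at a breakpoint,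
  a vertex or an intersection. All quadratics are recovered by interpolation, so that the algorithm
  only evaluates regrets and solves polynomial equations of degree at most 4.

  The program is obtained from closure properties: the functions and finite sets computed by nested
  loops over the edges form a class closed under the operations of this algorithm.
\<close>


section \<open>Computable functions on environments\<close>

text \<open>The obstacle is that the hinges have exponentially many sign patterns a priori, and that
  the best rival moves with \<open>x\<close>. Two facts remove it. In a difference q(t) - p(s) the
  position s enters the constant coefficient only, so while the signs stay fixed the vertex in t
  does not move with s. And no cell has to be constructed: without a critical position in between, a
  connectedness argument carries every sign pattern from s to the midpoint of its gap. Degree 4
  arises when the common height of two curves, a quadratic in s, is substituted into a curve that is
  quadratic in t. Nothing is sorted: all pairs of breakpoints are tried. Spurious candidates are
  harmless, since each is clipped to a genuine point of an edge and its regret is evaluated exactly.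
  Candidate sets are never stored. A set is represented by the ability to maximise over it, and its
  elements are recomputed in nested loops; the nesting depth depends on the program only, which
  keeps the time polynomial.\<close>

type_synonym env = "network \<times> (nat list \<Rightarrow> real) \<times> (nat \<Rightarrow> nat) \<times> (nat \<Rightarrow> real)"

definition net :: "env \<Rightarrow> network" where
  "net z = fst z"

text \<open>The content of the array \<open>dd\<close>, indexed by round, source and target. It is
  part of the environment so that expressions can read distances left by an earlier phase of the
  program.\<close>

definition table :: "env \<Rightarrow> nat list \<Rightarrow> real" where
  "table z = fst (snd z)"

definition nat_vars :: "env \<Rightarrow> nat \<Rightarrow> nat" where
  "nat_vars z = fst (snd (snd z))"

definition real_vars :: "env \<Rightarrow> nat \<Rightarrow> real" where
  "real_vars z = snd (snd (snd z))"

definition ntop :: "env \<Rightarrow> nat" where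
  "ntop z = nat_vars z 0"

definition rtop :: "env \<Rightarrow> real" where
  "rtop z = real_vars z 0"

text \<open>Variables are de Bruijn indices: entry 0 belongs to the innermost enclosing loop or
  maximum, and popping restores the environment outside that binder.\<close>

definition npop :: "env \<Rightarrow> env" where
  "npop z = (net z, table z, \<lambda>j. nat_vars z (Suc j), real_vars z)"

definition rpop :: "env \<Rightarrow> env" where
  "rpop z = (net z, table z, nat_vars z, \<lambda>j. real_vars z (Suc j))"

definition rpush :: "real \<Rightarrow> env \<Rightarrow> env" where
  "rpush a z = (net z, table z, nat_vars z, case_nat a (real_vars z))"

definition npush :: "nat \<Rightarrow> env \<Rightarrow> env" where
  "npush a z = (net z, table z, case_nat a (nat_vars z), real_vars z)"

lemma net_simps [simp]:
  "net (npop z) = net z" "net (rpop z) = net z" "net (rpush a z) = net z" "net (npush i z) = net z"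
  by (simp_all add: net_def npop_def rpop_def rpush_def npush_def)

lemma table_simps [simp]:
  "table (npop z) = table z" "table (rpop z) = table z" "table (rpush a z) = table z"
  "table (npush i z) = table z"
  by (simp_all add: table_def npop_def rpop_def rpush_def npush_def)

lemma push_simps [simp]:
  "rtop (rpush a z) = a" "rpop (rpush a z) = z" "ntop (npush i z) = i" "npop (npush i z) = z"
  "npop (rpush a z) = rpush a (npop z)" "ntop (rpush a z) = ntop z"
  "rpop (npush i z) = npush i (rpop z)" "rtop (npush i z) = rtop z"
  by (auto simp: net_def table_def nat_vars_def real_vars_def ntop_def rtop_def npop_def rpop_def
      rpush_def npush_def)

section \<open>Memory layout and frame conditions of compiled code\<close>

definition input_nat_arrays :: "string set" where
  "input_nat_arrays = {''num_nodes'', ''num_edges'', ''node_k'', ''node_l''}"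

definition input_real_arrays :: "string set" where
  "input_real_arrays = {''radius'', ''edge_length'', ''lb_a'', ''lb_b'', ''ub_a'', ''ub_b''}"

definition holds_input :: "network \<Rightarrow> store \<Rightarrow> bool" where
  "holds_input N s \<longleftrightarrow>
    (\<forall>a \<in> input_nat_arrays. nat_cells s a = nat_cells (input_store N) a) \<and>
    (\<forall>a \<in> input_real_arrays. real_cells s a = real_cells (input_store N) a)"

text \<open>
  Compiled expressions keep intermediate results in the cells \<open>r[k], r[k + 1], \<dots>\<close> and loop
  counters in \<open>i[d], i[d + 1], \<dots>\<close>.
\<close>

definition frame :: "nat \<Rightarrow> nat \<Rightarrow> store \<Rightarrow> store \<Rightarrow> bool" where
  "frame d k s s' \<longleftrightarrow>
    (\<forall>a js. (a \<noteq> ''i'' \<or> (\<exists>j<d. js = [j])) \<longrightarrow> nat_cells s' a js = nat_cells s a js) \<and>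
    (\<forall>a js. (a \<noteq> ''r'' \<or> (\<exists>j<k. js = [j])) \<longrightarrow> real_cells s' a js = real_cells s a js)"

lemma frame_refl [simp]: "frame d k s s"
  by (simp add: frame_def)

lemma frame_trans: "frame d k s s' \<Longrightarrow> frame d k s' s'' \<Longrightarrow> frame d k s s''"
  by (simp add: frame_def)

lemma frame_mono: "frame d' k' s s' \<Longrightarrow> d \<le> d' \<Longrightarrow> k \<le> k' \<Longrightarrow> frame d k s s'"
  unfolding frame_def by (auto elim: order_less_le_trans)

lemma frame_real: "frame d k s s' \<Longrightarrow> j < k \<Longrightarrow> real_cells s' ''r'' [j] = real_cells s ''r'' [j]"
  by (auto simp: frame_def)

lemma frame_nat: "frame d k s s' \<Longrightarrow> j < d \<Longrightarrow> nat_cells s' ''i'' [j] = nat_cells s ''i'' [j]"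
  by (auto simp: frame_def)

lemma frame_write_real: "k \<le> j \<Longrightarrow> frame d k s (write_real ''r'' [j] x s)"
  by (auto simp: frame_def write_real_def)

lemma frame_write_nat: "d \<le> j \<Longrightarrow> frame d k s (write_nat ''i'' [j] x s)"
  by (auto simp: frame_def write_nat_def)

lemma frame_holds_input:
  assumes "frame d k s s'" "holds_input N s"
  shows "holds_input N s'"
proof -
  have "nat_cells s' a = nat_cells s a" if "a \<in> input_nat_arrays" for a
    using assms(1) that by (auto simp: frame_def input_nat_arrays_def)
  moreover have "real_cells s' a = real_cells s a" if "a \<in> input_real_arrays" for a
    using assms(1) that by (auto simp: frame_def input_real_arrays_def)
  ultimately show ?thesis
    using assms(2) by (auto simp: holds_input_def)
qed

text \<open>\<open>nl\<close> and \<open>rl\<close> act as symbol tables: variable \<open>j\<close>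
  is stored in the cell \<open>i[nl j]\<close> or \<open>r[rl j]\<close>.\<close>

definition env_of :: "network \<Rightarrow> (nat \<Rightarrow> nat) \<Rightarrow> (nat \<Rightarrow> nat) \<Rightarrow> store \<Rightarrow> env" where
  "env_of N nl rl s =
    (N, real_cells s ''dd'', \<lambda>j. nat_cells s ''i'' [nl j], \<lambda>j. real_cells s ''r'' [rl j])"

lemma frame_env_of:
  assumes "frame d k s s'" "\<And>j. nl j < d" "\<And>j. rl j < k"
  shows "env_of N nl rl s' = env_of N nl rl s"
proof -
  have "real_cells s' ''dd'' = real_cells s ''dd''"
    using assms(1) by (auto simp: frame_def)
  then show ?thesis
    using assms by (simp add: env_of_def frame_real frame_nat)
qed

lemma net_env_of [simp]: "net (env_of N nl rl s) = N"
  by (simp add: env_of_def net_def)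

lemma env_of_pushed:
  "npop (env_of N (case_nat d nl) rl s) = env_of N nl rl s"
  "ntop (env_of N (case_nat d nl) rl s) = nat_cells s ''i'' [d]"
  "rpop (env_of N nl (case_nat k rl) s) = env_of N nl rl s"
  "rtop (env_of N nl (case_nat k rl) s) = real_cells s ''r'' [k]"
  by (simp_all add: env_of_def npop_def ntop_def rpop_def rtop_def net_def table_def nat_vars_def
      real_vars_def)

text \<open>Calling convention: the value is left in \<open>r[k]\<close>, and only \<open>i\<close>
  from \<open>d\<close> on and \<open>r\<close> from \<open>k\<close> on may change, so variables
  stored below survive. A single polynomial serves all networks.\<close>

definition computes ::
  "nat \<Rightarrow> nat \<Rightarrow> (nat \<Rightarrow> nat) \<Rightarrow> (nat \<Rightarrow> nat) \<Rightarrow> com \<Rightarrow> nat poly \<Rightarrow> (env \<Rightarrow> real) \<Rightarrow> bool" where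
  "computes d k nl rl c p f \<longleftrightarrow>
    (\<forall>N s. holds_input N s \<longrightarrow> (\<exists>t s'. exec c s t s' \<and> t \<le> poly p (num_edges N) \<and>
      real_cells s' ''r'' [k] = f (env_of N nl rl s) \<and> frame d k s s'))"

text \<open>Code is demanded for every placement of the variables and every scratch offset, because
  subexpressions are compiled with shifted offsets and under further binders.\<close>

definition real_comp :: "(env \<Rightarrow> real) \<Rightarrow> bool" where
  "real_comp f \<longleftrightarrow>
    (\<forall>d k nl rl. (\<forall>j. nl j < d) \<longrightarrow> (\<forall>j. rl j < k) \<longrightarrow> (\<exists>c p. computes d k nl rl c p f))"

text \<open>Natural-valued functions must be expressions of the machine, without code of their own,
  so that they can be used directly as array indices.\<close>

definition nat_comp :: "(env \<Rightarrow> nat) \<Rightarrow> bool" where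
  "nat_comp a \<longleftrightarrow>
    (\<forall>nl. \<exists>i. \<forall>N s rl. holds_input N s \<longrightarrow> nval i s = a (env_of N nl rl s))"

text \<open>A view is a change of variables: it selects entries of the two stacks of variables.\<close>

definition view :: "(env \<Rightarrow> env) \<Rightarrow> bool" where
  "view X \<longleftrightarrow> (\<exists>u v. \<forall>N D ns rs. X (N, D, ns, rs) = (N, D, \<lambda>j. ns (u j), \<lambda>j. rs (v j)))"

lemma view_id: "view (\<lambda>z. z)"
  unfolding view_def by (intro exI[of _ "\<lambda>j. j"]) simp

lemma viewE:
  assumes "view X"
  obtains u v where "\<And>N D ns rs. X (N, D, ns, rs) = (N, D, \<lambda>j. ns (u j), \<lambda>j. rs (v j))"
  using assms unfolding view_def by blast

lemmas env_defs = npop_def rpop_def rpush_def npush_def ntop_def rtop_def net_def table_def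
  nat_vars_def real_vars_def

lemma view_npop:
  assumes "view X"
  shows "view (\<lambda>z. npop (X z))"
proof -
  obtain u v where "\<And>N D ns rs. X (N, D, ns, rs) = (N, D, \<lambda>j. ns (u j), \<lambda>j. rs (v j))"
    using assms by (rule viewE) blast
  then show ?thesis
    unfolding view_def by (intro exI[of _ "\<lambda>j. u (Suc j)"] exI[of _ v]) (simp add: env_defs)
qed

lemma view_rpop:
  assumes "view X"
  shows "view (\<lambda>z. rpop (X z))"
proof -
  obtain u v where "\<And>N D ns rs. X (N, D, ns, rs) = (N, D, \<lambda>j. ns (u j), \<lambda>j. rs (v j))"
    using assms by (rule viewE) blast
  then show ?thesis
    unfolding view_def by (intro exI[of _ u] exI[of _ "\<lambda>j. v (Suc j)"]) (simp add: env_defs)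
qed

lemma view_rpush:
  assumes "view X" "view Y"
  shows "view (\<lambda>z. rpush (rtop (Y z)) (X z))"
proof -
  obtain u v where X: "\<And>N D ns rs. X (N, D, ns, rs) = (N, D, \<lambda>j. ns (u j), \<lambda>j. rs (v j))"
    using assms(1) by (rule viewE) blast
  obtain u' v' where Y: "\<And>N D ns rs. Y (N, D, ns, rs) = (N, D, \<lambda>j. ns (u' j), \<lambda>j. rs (v' j))"
    using assms(2) by (rule viewE) blast
  show ?thesis
    unfolding view_def
    by (intro exI[of _ "u"] exI[of _ "case_nat (v' 0) v"])
      (auto simp: X Y env_defs split: nat.split)
qed

lemmas view_intros = view_id view_npop view_rpop view_rpush

lemma view_env_of:
  assumes "view X"
  obtains u v where "\<And>N nl rl s. X (env_of N nl rl s) = env_of N (\<lambda>j. nl (u j)) (\<lambda>j. rl (v j)) s"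
proof -
  obtain u v where "\<And>N D ns rs. X (N, D, ns, rs) = (N, D, \<lambda>j. ns (u j), \<lambda>j. rs (v j))"
    using assms by (rule viewE) blast
  then show thesis
    by (intro that[of u v]) (simp add: env_of_def)
qed

text \<open>A change of variables costs no instruction: \<open>f\<close> is compiled for the symbol
  tables composed with the selection.\<close>

lemma real_comp_view: "real_comp f \<Longrightarrow> view X \<Longrightarrow> real_comp (\<lambda>z. f (X z))"
  by (erule view_env_of) (simp add: real_comp_def computes_def)

lemma nat_comp_view:
  assumes "nat_comp a" "view X"
  shows "nat_comp (\<lambda>z. a (X z))"
proof -
  obtain u v where X: "\<And>N nl rl s. X (env_of N nl rl s) = env_of N (\<lambda>j. nl (u j)) (\<lambda>j. rl (v j)) s"
    using assms(2) by (rule view_env_of) blast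
  show ?thesis
    unfolding nat_comp_def X
  proof
    fix nl
    obtain i where "\<forall>N s rl. holds_input N s \<longrightarrow> nval i s = a (env_of N (\<lambda>j. nl (u j)) rl s)"
      using assms(1) unfolding nat_comp_def by blast
    then show "\<exists>i. \<forall>N s rl. holds_input N s \<longrightarrow>
        nval i s = a (env_of N (\<lambda>j. nl (u j)) (\<lambda>j. rl (v j)) s)"
      by blast
  qed
qed

section \<open>Atomic expressions and arithmetic\<close>

lemma nat_comp_ntop: "view X \<Longrightarrow> nat_comp (\<lambda>z. ntop (X z))"
proof (rule nat_comp_view)
  show "nat_comp ntop"
    unfolding nat_comp_def
    by (intro allI, rule_tac x = "NCell ''i'' [NConst (nl 0)]" in exI)
      (simp add: env_of_def ntop_def nat_vars_def)
qed

lemma nat_comp_const: "nat_comp (\<lambda>z. n)"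
  unfolding nat_comp_def by (intro allI exI[of _ "NConst n"]) simp

lemma nat_comp_num_nodes: "nat_comp (\<lambda>z. num_nodes (net z))"
  unfolding nat_comp_def
  by (intro allI exI[of _ "NCell ''num_nodes'' []"])
    (simp add: holds_input_def input_nat_arrays_def input_store_def scalar_def)

lemma nat_comp_array:
  assumes "A \<in> {''node_k'', ''node_l''}" "nat_comp a"
  shows "nat_comp (\<lambda>z. nat_cells (input_store (net z)) A [a z])"
  unfolding nat_comp_def
proof
  fix nl
  obtain i where "\<forall>N s rl. holds_input N s \<longrightarrow> nval i s = a (env_of N nl rl s)"
    using assms(2) unfolding nat_comp_def by metis
  with assms(1) show "\<exists>i. \<forall>N s rl. holds_input N s \<longrightarrow>
      nval i s = nat_cells (input_store (net (env_of N nl rl s))) A [a (env_of N nl rl s)]"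
    by (intro exI[of _ "NCell A [i]"]) (auto simp: holds_input_def input_nat_arrays_def)
qed

lemma computesE:
  assumes "computes d k nl rl c p f" "holds_input N s"
  obtains t s' where "exec c s t s'" "t \<le> poly p (num_edges N)"
    "real_cells s' ''r'' [k] = f (env_of N nl rl s)" "frame d k s s'" "holds_input N s'"
  using assms unfolding computes_def by (meson frame_holds_input)

lemma real_compD:
  "real_comp f \<Longrightarrow> \<forall>j. nl j < d \<Longrightarrow> \<forall>j. rl j < k \<Longrightarrow> \<exists>c p. computes d k nl rl c p f"
  unfolding real_comp_def by blast

lemma real_comp_atom:
  assumes "\<And>nl rl. \<exists>x. \<forall>N s. holds_input N s \<longrightarrow> rval x s = f (env_of N nl rl s)"
  shows "real_comp f"
  unfolding real_comp_def
proof (intro allI impI)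
  fix d k nl rl
  obtain x where x: "\<And>N s. holds_input N s \<Longrightarrow> rval x s = f (env_of N nl rl s)"
    using assms by metis
  have "computes d k nl rl (RAssign ''r'' [NConst k] x) 1 f"
    unfolding computes_def
  proof (intro allI impI)
    fix N s
    assume s: "holds_input N s"
    show "\<exists>t s'. exec (RAssign ''r'' [NConst k] x) s t s' \<and> t \<le> poly 1 (num_edges N) \<and>
        real_cells s' ''r'' [k] = f (env_of N nl rl s) \<and> frame d k s s'"
      using exec_RAssign[of "''r''" "[NConst k]" x s] x[OF s]
      by (intro exI[of _ 1] exI[of _ "write_real ''r'' [k] (rval x s) s"])
        (simp add: frame_write_real, simp add: write_real_def)
  qed
  then show "\<exists>c p. computes d k nl rl c p f"
    by blast
qed

lemma real_comp_const: "real_comp (\<lambda>z. of_int n)"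
  by (rule real_comp_atom, rule exI[of _ "RConst n"]) simp

lemma real_comp_numeral: "real_comp (\<lambda>z. numeral w)" "real_comp (\<lambda>z. 0)" "real_comp (\<lambda>z. 1)"
  using real_comp_const[of "numeral w"] real_comp_const[of 0] real_comp_const[of 1] by simp_all

lemma real_comp_rtop: "view X \<Longrightarrow> real_comp (\<lambda>z. rtop (X z))"
proof (rule real_comp_view)
  show "real_comp rtop"
    by (rule real_comp_atom, rule_tac x = "RCell ''r'' [NConst (rl 0)]" in exI)
      (simp add: env_of_def rtop_def real_vars_def)
qed

lemma real_comp_radius: "real_comp (\<lambda>z. radius (net z))"
  by (rule real_comp_atom, rule exI[of _ "RCell ''radius'' []"])
    (simp add: holds_input_def input_real_arrays_def input_store_def scalar_def)

lemma real_comp_array: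
  assumes "A \<in> {''edge_length'', ''lb_a'', ''lb_b'', ''ub_a'', ''ub_b''}" "nat_comp a"
  shows "real_comp (\<lambda>z. real_cells (input_store (net z)) A [a z])"
proof (rule real_comp_atom)
  fix nl rl
  obtain i where "\<forall>N s rl. holds_input N s \<longrightarrow> nval i s = a (env_of N nl rl s)"
    using assms(2) unfolding nat_comp_def by metis
  with assms(1) show "\<exists>x. \<forall>N s. holds_input N s \<longrightarrow>
      rval x s = real_cells (input_store (net (env_of N nl rl s))) A [a (env_of N nl rl s)]"
    by (intro exI[of _ "RCell A [i]"]) (auto simp: holds_input_def input_real_arrays_def)
qed

lemma real_comp_table:
  assumes "nat_comp a" "nat_comp b" "nat_comp c"
  shows "real_comp (\<lambda>z. table z [a z, b z, c z])"
proof (rule real_comp_atom)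
  fix nl rl
  obtain i j l where
    "\<forall>N s rl. holds_input N s \<longrightarrow> nval i s = a (env_of N nl rl s)"
    "\<forall>N s rl. holds_input N s \<longrightarrow> nval j s = b (env_of N nl rl s)"
    "\<forall>N s rl. holds_input N s \<longrightarrow> nval l s = c (env_of N nl rl s)"
    using assms unfolding nat_comp_def by metis
  then show "\<exists>x. \<forall>N s. holds_input N s \<longrightarrow> rval x s =
      table (env_of N nl rl s) [a (env_of N nl rl s), b (env_of N nl rl s), c (env_of N nl rl s)]"
    by (intro exI[of _ "RCell ''dd'' [i, j, l]"]) (simp add: env_of_def table_def)
qed

text \<open>Operand number \<open>j\<close> is evaluated with scratch cells starting at
  \<open>k + j\<close>, so the operands already computed are preserved.\<close>

lemma comp_list:
  assumes "\<And>f. f \<in> set fs \<Longrightarrow> real_comp f" "\<forall>j. nl j < d" "\<forall>j. rl j < k"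
  shows "\<exists>c p. \<forall>N s. holds_input N s \<longrightarrow> (\<exists>t s'. exec c s t s' \<and> t \<le> poly p (num_edges N) \<and>
    (\<forall>j < length fs. real_cells s' ''r'' [k + j] = (fs ! j) (env_of N nl rl s)) \<and> frame d k s s')"
  using assms
proof (induction fs arbitrary: k)
  case Nil
  show ?case
    by (intro exI[of _ Skip] exI[of _ 1]) (use exec_Skip in fastforce)
next
  case (Cons f fs)
  obtain c p where c: "computes d k nl rl c p f"
    using real_compD[of f nl d rl k] Cons.prems by auto
  have "\<forall>j. rl j < Suc k"
    using Cons.prems(3) by (simp add: less_SucI)
  then obtain c' p' where c': "\<And>N s. holds_input N s \<Longrightarrow> \<exists>t s'. exec c' s t s' \<and>
      t \<le> poly p' (num_edges N) \<and>
      (\<forall>j < length fs. real_cells s' ''r'' [Suc k + j] = (fs ! j) (env_of N nl rl s)) \<and>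
      frame d (Suc k) s s'"
    using Cons.IH[of "Suc k"] Cons.prems by auto
  show ?case
  proof (intro exI[of _ "Seq c c'"] exI[of _ "p + p'"] allI impI)
    fix N s
    assume s: "holds_input N s"
    obtain t1 s1 where 1: "exec c s t1 s1" "t1 \<le> poly p (num_edges N)"
      "real_cells s1 ''r'' [k] = f (env_of N nl rl s)" "frame d k s s1" "holds_input N s1"
      using computesE[OF c s] .
    obtain t2 s2 where 2: "exec c' s1 t2 s2" "t2 \<le> poly p' (num_edges N)"
      "\<And>j. j < length fs \<Longrightarrow> real_cells s2 ''r'' [Suc k + j] = (fs ! j) (env_of N nl rl s1)"
      "frame d (Suc k) s1 s2"
      using c'[OF 1(5)] by blast
    have env: "env_of N nl rl s1 = env_of N nl rl s"
      using frame_env_of[OF 1(4)] Cons.prems by blast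
    have "real_cells s2 ''r'' [k] = real_cells s1 ''r'' [k]"
      using 2(4) by (rule frame_real) simp
    then have "real_cells s2 ''r'' [k + j] = ((f # fs) ! j) (env_of N nl rl s)"
      if "j < length (f # fs)" for j
      using that 1(3) 2(3)[of "j - 1"] env by (cases j) auto
    moreover have "frame d k s s2"
      using 1(4) frame_mono[OF 2(4)] by (auto intro: frame_trans)
    ultimately show "\<exists>t s'. exec (Seq c c') s t s' \<and> t \<le> poly (p + p') (num_edges N) \<and>
        (\<forall>j < length (f # fs). real_cells s' ''r'' [k + j] = ((f # fs) ! j) (env_of N nl rl s)) \<and>
        frame d k s s'"
      using exec_Seq[OF 1(1) 2(1)] 1(2) 2(2)
      by (intro exI[of _ "t1 + t2"] exI[of _ s2]) auto
  qed
qed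

lemma real_comp_op:
  assumes "\<And>f. f \<in> set fs \<Longrightarrow> real_comp f"
    and "\<And>k s. rval (x k) s = h (map (\<lambda>j. real_cells s ''r'' [k + j]) [0..<length fs])"
  shows "real_comp (\<lambda>z. h (map (\<lambda>f. f z) fs))"
  unfolding real_comp_def
proof (intro allI impI)
  fix d k nl rl
  assume bounds: "\<forall>j::nat. nl j < (d::nat)" "\<forall>j::nat. rl j < (k::nat)"
  then obtain c p where c: "\<And>N s. holds_input N s \<Longrightarrow> \<exists>t s'. exec c s t s' \<and>
      t \<le> poly p (num_edges N) \<and>
      (\<forall>j < length fs. real_cells s' ''r'' [k + j] = (fs ! j) (env_of N nl rl s)) \<and> frame d k s s'"
    using comp_list[OF assms(1), of fs nl d rl k] by blast
  let ?c = "Seq c (RAssign ''r'' [NConst k] (x k))"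
  have "computes d k nl rl ?c (p + 1) (\<lambda>z. h (map (\<lambda>f. f z) fs))"
    unfolding computes_def
  proof (intro allI impI)
    fix N s
    assume "holds_input N s"
    then obtain t s' where 1: "exec c s t s'" "t \<le> poly p (num_edges N)"
      "\<And>j. j < length fs \<Longrightarrow> real_cells s' ''r'' [k + j] = (fs ! j) (env_of N nl rl s)"
      "frame d k s s'"
      using c by blast
    let ?s = "write_real ''r'' [k] (rval (x k) s') s'"
    have "map (\<lambda>j. real_cells s' ''r'' [k + j]) [0..<length fs] = map (\<lambda>f. f (env_of N nl rl s)) fs"
      using 1(3) by (intro nth_equalityI) auto
    then have "real_cells ?s ''r'' [k] = h (map (\<lambda>f. f (env_of N nl rl s)) fs)"
      by (simp add: write_real_def assms(2))
    moreover have "frame d k s ?s"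
      using 1(4) frame_write_real by (rule frame_trans) simp
    moreover have "exec ?c s (t + 1) ?s"
      using exec_Seq[OF 1(1) exec_RAssign[of "''r''" "[NConst k]" "x k"]] by simp
    ultimately show "\<exists>t s'. exec ?c s t s' \<and> t \<le> poly (p + 1) (num_edges N) \<and>
        real_cells s' ''r'' [k] = h (map (\<lambda>f. f (env_of N nl rl s)) fs) \<and> frame d k s s'"
      using 1(2) by (intro exI[of _ "t + 1"] exI[of _ ?s]) simp
  qed
  then show "\<exists>c p. computes d k nl rl c p (\<lambda>z. h (map (\<lambda>f. f z) fs))"
    by blast
qed

lemma real_comp_arith:
  assumes "real_comp f" "real_comp g"
  shows "real_comp (\<lambda>z. f z + g z)" "real_comp (\<lambda>z. f z - g z)" "real_comp (\<lambda>z. f z * g z)"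
    "real_comp (\<lambda>z. f z / g z)"
proof -
  have fs: "h \<in> set [f, g] \<Longrightarrow> real_comp h" for h
    using assms by auto
  let ?x = "\<lambda>k::nat. RCell ''r'' [NConst k]"
  show "real_comp (\<lambda>z. f z + g z)"
    using real_comp_op[where fs = "[f, g]", OF fs, where x = "\<lambda>k. RAdd (?x k) (?x (k + 1))"
        and h = "\<lambda>xs. xs ! 0 + xs ! 1"] by simp
  show "real_comp (\<lambda>z. f z - g z)"
    using real_comp_op[where fs = "[f, g]", OF fs, where x = "\<lambda>k. RSub (?x k) (?x (k + 1))"
        and h = "\<lambda>xs. xs ! 0 - xs ! 1"] by simp
  show "real_comp (\<lambda>z. f z * g z)"
    using real_comp_op[where fs = "[f, g]", OF fs, where x = "\<lambda>k. RMul (?x k) (?x (k + 1))"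
        and h = "\<lambda>xs. xs ! 0 * xs ! 1"] by simp
  show "real_comp (\<lambda>z. f z / g z)"
    using real_comp_op[where fs = "[f, g]", OF fs, where x = "\<lambda>k. RDiv (?x k) (?x (k + 1))"
        and h = "\<lambda>xs. xs ! 0 / xs ! 1"] by simp
qed

lemma real_comp_uminus: "real_comp f \<Longrightarrow> real_comp (\<lambda>z. - f z)"
  using real_comp_arith(2)[OF real_comp_numeral(2), of f] by simp

lemma real_comp_root:
  assumes "real_comp c0" "real_comp c1" "real_comp c2" "real_comp c3" "real_comp c4"
  shows "real_comp (\<lambda>z. kth_root n (Poly [c0 z, c1 z, c2 z, c3 z, c4 z]))"
proof -
  have fs: "h \<in> set [c0, c1, c2, c3, c4] \<Longrightarrow> real_comp h" for h
    using assms by auto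
  let ?x = "\<lambda>k::nat. RCell ''r'' [NConst k]"
  have 5: "[0..<5] = [0, 1, 2, 3, 4::nat]"
    by (simp add: upt_rec)
  show ?thesis
    using real_comp_op[where fs = "[c0, c1, c2, c3, c4]", OF fs,
        where x = "\<lambda>k. Root n [?x k, ?x (k + 1), ?x (k + 2), ?x (k + 3), ?x (k + 4)]"
        and h = "\<lambda>xs. kth_root n (Poly xs)"] 5
    by (simp add: eval_nat_numeral)
qed

text \<open>\<open>c\<close> prepares the operands of the test. The bound adds the times of both
  branches, as the maximum of two polynomials need not be a polynomial.\<close>

lemma computes_cond:
  assumes c: "\<And>N s. holds_input N s \<Longrightarrow> \<exists>t s'. exec c s t s' \<and> t \<le> poly p (num_edges N) \<and>
      (bval b s' \<longleftrightarrow> P (env_of N nl rl s)) \<and> frame d k s s'"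
    and c1: "computes d k nl rl c1 p1 f1" and c2: "computes d k nl rl c2 p2 f2"
    and bounds: "\<And>j. nl j < d" "\<And>j. rl j < k"
  shows "computes d k nl rl (Seq c (Cond b c1 c2)) (p + 1 + p1 + p2)
    (\<lambda>z. if P z then f1 z else f2 z)"
  unfolding computes_def
proof (intro allI impI)
  fix N s
  assume s: "holds_input N s"
  then obtain t s' where 1: "exec c s t s'" "t \<le> poly p (num_edges N)"
    "bval b s' \<longleftrightarrow> P (env_of N nl rl s)" "frame d k s s'"
    using c by blast
  have s': "holds_input N s'"
    using 1(4) s by (rule frame_holds_input)
  have env: "env_of N nl rl s' = env_of N nl rl s"
    using frame_env_of[OF 1(4)] bounds by blast
  let ?P = "P (env_of N nl rl s)"
  obtain u s'' where 2: "exec (if ?P then c1 else c2) s' u s''"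
    "u \<le> poly (p1 + p2) (num_edges N)" "frame d k s' s''"
    "real_cells s'' ''r'' [k] = (if ?P then f1 else f2) (env_of N nl rl s)"
  proof (cases ?P)
    case True
    show thesis
      by (rule computesE[OF c1 s'], rule that) (use True env in auto)
  next
    case False
    show thesis
      by (rule computesE[OF c2 s'], rule that) (use False env in auto)
  qed
  have "exec (Cond b c1 c2) s' (1 + u) s''"
    using 2(1) 1(3) exec_IfTrue exec_IfFalse by (cases ?P) auto
  then have "exec (Seq c (Cond b c1 c2)) s (t + (1 + u)) s''"
    by (rule exec_Seq[OF 1(1)])
  moreover have "frame d k s s''"
    using 1(4) 2(3) by (rule frame_trans)
  ultimately show "\<exists>t s'. exec (Seq c (Cond b c1 c2)) s t s' \<and>
      t \<le> poly (p + 1 + p1 + p2) (num_edges N) \<and>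
      real_cells s' ''r'' [k] = (if ?P then f1 (env_of N nl rl s) else f2 (env_of N nl rl s)) \<and>
      frame d k s s'"
    using 1(2) 2(2,4)
    by (intro exI[of _ "t + (1 + u)"] exI[of _ s'']) (auto split: if_splits)
qed

lemma real_comp_if_le:
  assumes "real_comp f" "real_comp g" "real_comp h1" "real_comp h2"
  shows "real_comp (\<lambda>z. if f z \<le> g z then h1 z else h2 z)"
  unfolding real_comp_def
proof (intro allI impI)
  fix d k nl rl
  assume bounds: "\<forall>j::nat. nl j < (d::nat)" "\<forall>j::nat. rl j < (k::nat)"
  have "h \<in> set [f, g] \<Longrightarrow> real_comp h" for h
    using assms by auto
  then obtain c p where c: "\<And>N s. holds_input N s \<Longrightarrow> \<exists>t s'. exec c s t s' \<and>
      t \<le> poly p (num_edges N) \<and>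
      (\<forall>j < length [f, g]. real_cells s' ''r'' [k + j] = ([f, g] ! j) (env_of N nl rl s)) \<and>
      frame d k s s'"
    using comp_list[of "[f, g]" nl d rl k] bounds by blast
  let ?b = "RLe (RCell ''r'' [NConst k]) (RCell ''r'' [NConst (k + 1)])"
  have "\<exists>t s'. exec c s t s' \<and> t \<le> poly p (num_edges N) \<and>
      (bval ?b s' \<longleftrightarrow> f (env_of N nl rl s) \<le> g (env_of N nl rl s)) \<and> frame d k s s'"
    if s: "holds_input N s" for N s
  proof -
    obtain t s' where 1: "exec c s t s'" "t \<le> poly p (num_edges N)" "frame d k s s'"
      "\<And>j. j < length [f, g] \<Longrightarrow> real_cells s' ''r'' [k + j] = ([f, g] ! j) (env_of N nl rl s)"
      using c[OF s] by blast
    moreover have "bval ?b s' \<longleftrightarrow> f (env_of N nl rl s) \<le> g (env_of N nl rl s)"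
      using 1(4)[of 0] 1(4)[of 1] by simp
    ultimately show ?thesis
      by blast
  qed
  moreover obtain c1 p1 c2 p2 where "computes d k nl rl c1 p1 h1" "computes d k nl rl c2 p2 h2"
    using real_compD[OF assms(3) bounds] real_compD[OF assms(4) bounds] by blast
  ultimately have "computes d k nl rl (Seq c (Cond ?b c1 c2)) (p + 1 + p1 + p2)
      (\<lambda>z. if f z \<le> g z then h1 z else h2 z)"
    using bounds by (intro computes_cond[where P = "\<lambda>z. f z \<le> g z"]) blast+
  then show "\<exists>c p. computes d k nl rl c p (\<lambda>z. if f z \<le> g z then h1 z else h2 z)"
    by blast
qed

lemma real_comp_if_nat_le:
  assumes "nat_comp a" "nat_comp b" "real_comp h1" "real_comp h2"
  shows "real_comp (\<lambda>z. if a z \<le> b z then h1 z else h2 z)"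
  unfolding real_comp_def
proof (intro allI impI)
  fix d k nl rl
  assume bounds: "\<forall>j::nat. nl j < (d::nat)" "\<forall>j::nat. rl j < (k::nat)"
  obtain i j where "\<forall>N s rl. holds_input N s \<longrightarrow> nval i s = a (env_of N nl rl s)"
    "\<forall>N s rl. holds_input N s \<longrightarrow> nval j s = b (env_of N nl rl s)"
    using assms(1,2) unfolding nat_comp_def by metis
  then have "\<exists>t s'. exec Skip s t s' \<and> t \<le> poly 1 (num_edges N) \<and>
      (bval (NLe i j) s' \<longleftrightarrow> a (env_of N nl rl s) \<le> b (env_of N nl rl s)) \<and> frame d k s s'"
    if "holds_input N s" for N s
    using that exec_Skip[of s] by (intro exI[of _ 1] exI[of _ s]) simp
  moreover obtain c1 p1 c2 p2 where "computes d k nl rl c1 p1 h1" "computes d k nl rl c2 p2 h2"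
    using real_compD[OF assms(3) bounds] real_compD[OF assms(4) bounds] by blast
  ultimately have "computes d k nl rl (Seq Skip (Cond (NLe i j) c1 c2)) (1 + 1 + p1 + p2)
      (\<lambda>z. if a z \<le> b z then h1 z else h2 z)"
    using bounds by (intro computes_cond[where P = "\<lambda>z. a z \<le> b z"]) blast+
  then show "\<exists>c p. computes d k nl rl c p (\<lambda>z. if a z \<le> b z then h1 z else h2 z)"
    by blast
qed

lemma real_comp_if_eq:
  assumes "nat_comp a" "nat_comp b" "real_comp h1" "real_comp h2"
  shows "real_comp (\<lambda>z. if a z = b z then h1 z else h2 z)"
proof -
  have "real_comp (\<lambda>z. if a z \<le> b z then if b z \<le> a z then h1 z else h2 z else h2 z)"
    using assms by (intro real_comp_if_nat_le)
  moreover have "(if a z \<le> b z then if b z \<le> a z then h1 z else h2 z else h2 z) =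
      (if a z = b z then h1 z else h2 z)" for z
    by auto
  ultimately show ?thesis
    by simp
qed

lemma real_comp_max_min:
  assumes "real_comp f" "real_comp g"
  shows "real_comp (\<lambda>z. max (f z) (g z))" "real_comp (\<lambda>z. min (f z) (g z))"
  unfolding max_def min_def using assms by (auto intro: real_comp_if_le)

section \<open>Loops over the edges\<close>

definition For :: "nat \<Rightarrow> nexp \<Rightarrow> com \<Rightarrow> com" where
  "For j b c = Seq (NAssign ''i'' [NConst j] (NConst 0))
    (While (BNot (NLe b (NCell ''i'' [NConst j])))
      (Seq c (NAssign ''i'' [NConst j] (NAdd (NCell ''i'' [NConst j]) (NConst 1)))))"

text \<open>The invariant must tolerate arbitrary changes of the counter cell, which the loop itself
  initialises and increments. In the bound, 2 pays for the initialisation and the final test, and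
  each round adds one test and one increment to \<open>T\<close>.\<close>

lemma exec_For:
  assumes bound: "\<And>q s. Inv q s \<Longrightarrow> nval b s = K"
    and counter: "\<And>q s v. Inv q s \<Longrightarrow> Inv q (write_nat ''i'' [j] v s)"
    and step: "\<And>q s. q < K \<Longrightarrow> Inv q s \<Longrightarrow> nat_cells s ''i'' [j] = q \<Longrightarrow>
      \<exists>t s'. exec c s t s' \<and> t \<le> T \<and> Inv (Suc q) s' \<and> nat_cells s' ''i'' [j] = q"
    and start: "Inv 0 s"
  shows "\<exists>t s'. exec (For j b c) s t s' \<and> t \<le> 2 + K * (T + 2) \<and> Inv K s'"
proof -
  let ?i = "NCell ''i'' [NConst j]"
  let ?b = "BNot (NLe b ?i)"
  let ?c = "Seq c (NAssign ''i'' [NConst j] (NAdd ?i (NConst 1)))"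
  have loop: "\<exists>t s'. exec (While ?b ?c) s t s' \<and> t \<le> 1 + (K - q) * (T + 2) \<and> Inv K s'"
    if "q \<le> K" "Inv q s" "nat_cells s ''i'' [j] = q" for q s
    using that
  proof (induction "K - q" arbitrary: q s)
    case 0
    then have "q = K"
      by simp
    with 0 have "\<not> bval ?b s" "Inv K s"
      using bound by simp_all
    then show ?case
      using exec_WhileFalse by (intro exI[of _ 1] exI[of _ s]) simp
  next
    case (Suc n)
    then have "q < K"
      by simp
    with Suc obtain t s' where 1: "exec c s t s'" "t \<le> T" "Inv (Suc q) s'"
      "nat_cells s' ''i'' [j] = q"
      using step by blast
    let ?s = "write_nat ''i'' [j] (Suc q) s'"
    have "n = K - Suc q" "Suc q \<le> K" "Inv (Suc q) ?s" "nat_cells ?s ''i'' [j] = Suc q"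
      using Suc.hyps(2) \<open>q < K\<close> counter[OF 1(3)] by (simp_all add: write_nat_def)
    from Suc.hyps(1)[OF this] obtain u s'' where 2: "exec (While ?b ?c) ?s u s''"
      "u \<le> 1 + (K - Suc q) * (T + 2)" "Inv K s''"
      by blast
    have "exec ?c s (t + 1) ?s"
      using exec_Seq[OF 1(1) exec_NAssign[of "''i''" "[NConst j]" "NAdd ?i (NConst 1)"]] 1(4)
      by simp
    moreover have "bval ?b s"
      using Suc.prems \<open>q < K\<close> bound[OF Suc.prems(2)] by simp
    ultimately have "exec (While ?b ?c) s (1 + (t + 1) + u) s''"
      using 2(1) exec_WhileTrue by blast
    moreover have "1 + (t + 1) + u \<le> 1 + (K - q) * (T + 2)"
    proof -
      have "(K - q) * (T + 2) = (K - Suc q) * (T + 2) + (T + 2)"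
        using \<open>q < K\<close> by (metis Suc_diff_Suc add.commute mult_Suc)
      with 1(2) 2(2) show ?thesis
        by linarith
    qed
    ultimately show ?case
      using 2(3) by blast
  qed
  let ?s = "write_nat ''i'' [j] 0 s"
  obtain t s' where "exec (While ?b ?c) ?s t s'" "t \<le> 1 + (K - 0) * (T + 2)" "Inv K s'"
    using loop[of 0 ?s] counter[OF start] by (auto simp: write_nat_def)
  moreover have "exec (NAssign ''i'' [NConst j] (NConst 0)) s 1 ?s"
    using exec_NAssign[of "''i''" "[NConst j]" "NConst 0" s] by simp
  ultimately show ?thesis
    unfolding For_def using exec_Seq[of _ s 1 ?s _ t s'] by (intro exI[of _ "1 + t"] exI[of _ s']) auto
qed

lemma holds_input_num_edges: "holds_input N s \<Longrightarrow> nval (NCell ''num_edges'' []) s = num_edges N"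
  by (simp add: holds_input_def input_nat_arrays_def input_store_def scalar_def)

text \<open>Primitive recursion over the edge numbers. The accumulator in \<open>r[k]\<close> and
  the counter in \<open>i[d]\<close> become the innermost variables of the step, which is compiled
  at \<open>Suc d\<close> and \<open>Suc k\<close> and thus cannot overwrite them.\<close>

lemma real_comp_fold:
  assumes g: "real_comp g" and h: "real_comp (\<lambda>z. h (rtop z) (ntop z) (rpop (npop z)))"
  shows "real_comp (\<lambda>z. rec_nat (g z) (\<lambda>i acc. h acc i z) (num_edges (net z)))"
  unfolding real_comp_def
proof (intro allI impI)
  fix d k nl rl
  assume bounds: "\<forall>j::nat. nl j < (d::nat)" "\<forall>j::nat. rl j < (k::nat)"
  obtain c p where c: "computes d k nl rl c p g"
    using real_compD[OF g bounds] by blast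
  have bounds': "\<forall>j. case_nat d nl j < Suc d" "\<forall>j. case_nat k rl j < Suc k"
    using bounds by (auto simp: less_Suc_eq split: nat.split)
  obtain c' p' where c': "computes (Suc d) (Suc k) (case_nat d nl) (case_nat k rl) c' p'
      (\<lambda>z. h (rtop z) (ntop z) (rpop (npop z)))"
    using real_compD[OF h bounds'] by blast
  let ?body = "Seq c' (RAssign ''r'' [NConst k] (RCell ''r'' [NConst (Suc k)]))"
  let ?c = "Seq c (For d (NCell ''num_edges'' []) ?body)"
  \<comment> \<open>Each round costs the step plus 3: copying the result, the loop test and the
    increment.\<close>
  let ?p = "p + 2 + [:0, 1:] * (p' + 3)"
  have "computes d k nl rl ?c ?p (\<lambda>z. rec_nat (g z) (\<lambda>i acc. h acc i z) (num_edges (net z)))"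
    unfolding computes_def
  proof (intro allI impI)
    fix N s
    assume s: "holds_input N s"
    obtain t0 s0 where 0: "exec c s t0 s0" "t0 \<le> poly p (num_edges N)"
      "real_cells s0 ''r'' [k] = g (env_of N nl rl s)" "frame d k s s0" "holds_input N s0"
      using computesE[OF c s] .
    let ?z = "env_of N nl rl s"
    let ?v = "\<lambda>q. rec_nat (g ?z) (\<lambda>i acc. h acc i ?z) q"
    define Inv where "Inv q s' \<longleftrightarrow> frame d k s s' \<and> real_cells s' ''r'' [k] = ?v q" for q s'
    have Inv_input: "holds_input N s'" if "Inv q s'" for q s'
      using that s frame_holds_input by (auto simp: Inv_def)
    have "\<exists>t s'. exec (For d (NCell ''num_edges'' []) ?body) s0 t s' \<and>
        t \<le> 2 + num_edges N * ((poly p' (num_edges N) + 1) + 2) \<and> Inv (num_edges N) s'"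
    proof (rule exec_For)
      show "nval (NCell ''num_edges'' []) s' = num_edges N" if "Inv q s'" for q s'
        using Inv_input[OF that] by (rule holds_input_num_edges)
      show "Inv q (write_nat ''i'' [d] v s')" if "Inv q s'" for q s' v
      proof -
        have "frame d k s (write_nat ''i'' [d] v s')"
          using that frame_write_nat by (auto simp: Inv_def intro: frame_trans)
        then show ?thesis
          using that by (simp add: Inv_def write_nat_def)
      qed
      show "Inv 0 s0"
        using 0(3,4) by (simp add: Inv_def)
    next
      fix q s1
      assume q: "q < num_edges N" "Inv q s1" "nat_cells s1 ''i'' [d] = q"
      obtain t2 s2 where 2: "exec c' s1 t2 s2" "t2 \<le> poly p' (num_edges N)"
        "real_cells s2 ''r'' [Suc k] = h (real_cells s1 ''r'' [k]) q (env_of N nl rl s1)"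
        "frame (Suc d) (Suc k) s1 s2"
        by (rule computesE[OF c' Inv_input[OF q(2)]]) (use q(3) that in \<open>simp add: env_of_pushed\<close>)
      have env: "env_of N nl rl s1 = ?z"
        using frame_env_of[of d k s s1] q(2) bounds by (auto simp: Inv_def)
      let ?s = "write_real ''r'' [k] (real_cells s2 ''r'' [Suc k]) s2"
      have "frame d k s1 s2"
        using 2(4) by (rule frame_mono) simp_all
      then have "frame d k s ?s"
        using q(2) frame_write_real[of k k d s2] by (auto simp: Inv_def intro: frame_trans)
      moreover have "real_cells ?s ''r'' [k] = ?v (Suc q)"
        using q(2) env 2(3) by (simp add: Inv_def write_real_def)
      moreover have "nat_cells ?s ''i'' [d] = q"
        using frame_nat[OF 2(4), of d] q(3) by (simp add: write_real_def)
      moreover have "exec ?body s1 (t2 + 1) ?s"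
        using exec_Seq[OF 2(1) exec_RAssign[of "''r''" "[NConst k]" "RCell ''r'' [NConst (Suc k)]"]]
        by simp
      ultimately show "\<exists>t s'. exec ?body s1 t s' \<and> t \<le> poly p' (num_edges N) + 1 \<and>
          Inv (Suc q) s' \<and> nat_cells s' ''i'' [d] = q"
        using 2(2) by (intro exI[of _ "t2 + 1"] exI[of _ ?s]) (simp add: Inv_def)
    qed
    then obtain t1 s1 where 1: "exec (For d (NCell ''num_edges'' []) ?body) s0 t1 s1"
      "t1 \<le> 2 + num_edges N * ((poly p' (num_edges N) + 1) + 2)" "Inv (num_edges N) s1"
      by blast
    have "exec ?c s (t0 + t1) s1"
      using exec_Seq[OF 0(1) 1(1)] .
    moreover have "poly ?p (num_edges N) =
        poly p (num_edges N) + (2 + num_edges N * ((poly p' (num_edges N) + 1) + 2))"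
      by (simp add: algebra_simps)
    ultimately show "\<exists>t s'. exec ?c s t s' \<and> t \<le> poly ?p (num_edges N) \<and>
        real_cells s' ''r'' [k] = rec_nat (g ?z) (\<lambda>i acc. h acc i ?z) (num_edges (net ?z)) \<and>
        frame d k s s'"
      using 0(2) 1(2,3)
      by (intro exI[of _ "t0 + t1"] exI[of _ s1]) (auto simp: Inv_def)
  qed
  then show "\<exists>c p. computes d k nl rl c p
      (\<lambda>z. rec_nat (g z) (\<lambda>i acc. h acc i z) (num_edges (net z)))"
    by blast
qed

lemma real_comp_sum:
  assumes "real_comp (\<lambda>z. f (ntop z) (npop z))"
  shows "real_comp (\<lambda>z. \<Sum>i<num_edges (net z). f i z)"
proof -
  have eq: "rec_nat 0 (\<lambda>i acc. acc + f i z) n = (\<Sum>i<n. f i z)" for n z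
    by (induction n) simp_all
  have "real_comp (\<lambda>z. f (ntop z) (rpop (npop z)))"
    using real_comp_view[OF assms view_rpop[OF view_id]]
    by (simp add: ntop_def rpop_def npop_def nat_vars_def net_def table_def real_vars_def)
  then have "real_comp (\<lambda>z. rtop z + f (ntop z) (rpop (npop z)))"
    by (intro real_comp_arith real_comp_rtop view_intros)
  from real_comp_fold[OF real_comp_numeral(2), of "\<lambda>acc i z. acc + f i z", OF this]
  show ?thesis
    by (simp add: eq)
qed

text \<open>\<open>g z\<close> is the start value of the loop; it also gives the maximum a meaning
  when there are no edges.\<close>

lemma real_comp_Max:
  assumes "real_comp g" "real_comp (\<lambda>z. f (ntop z) (npop z))"
  shows "real_comp (\<lambda>z. Max (insert (g z) ((\<lambda>i. f i z) ` {..<num_edges (net z)})))"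
proof -
  have eq: "rec_nat (g z) (\<lambda>i acc. max acc (f i z)) n = Max (insert (g z) ((\<lambda>i. f i z) ` {..<n}))"
    for n z
  proof (induction n)
    case (Suc n)
    have "Max (insert (g z) ((\<lambda>i. f i z) ` {..<Suc n})) =
        Max (insert (f n z) (insert (g z) ((\<lambda>i. f i z) ` {..<n})))"
      by (simp add: lessThan_Suc insert_commute)
    also have "\<dots> = max (f n z) (Max (insert (g z) ((\<lambda>i. f i z) ` {..<n})))"
      by (rule Max_insert) simp_all
    finally show ?case
      using Suc by (simp add: max.commute)
  qed simp
  have "real_comp (\<lambda>z. f (ntop z) (rpop (npop z)))"
    using real_comp_view[OF assms(2) view_rpop[OF view_id]]
    by (simp add: ntop_def rpop_def npop_def nat_vars_def net_def table_def real_vars_def)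
  then have "real_comp (\<lambda>z. max (rtop z) (f (ntop z) (rpop (npop z))))"
    by (intro real_comp_max_min real_comp_rtop view_intros)
  from real_comp_fold[OF assms(1), of "\<lambda>acc i z. max acc (f i z)", OF this]
  show ?thesis
    by (simp add: eq)
qed


section \<open>Computable finite sets\<close>

text \<open>
  A finite set counts as computable if maxima of computable functions over it are computable.
  This makes such sets closed under unions indexed by edges or by another computable set.
\<close>

definition set_comp :: "(env \<Rightarrow> real set) \<Rightarrow> bool" where
  "set_comp A \<longleftrightarrow> (\<forall>z. finite (A z)) \<and>
    (\<forall>f g. real_comp g \<longrightarrow> real_comp (\<lambda>z. f (rtop z) (rpop z)) \<longrightarrow>
      real_comp (\<lambda>z. Max (insert (g z) ((\<lambda>a. f a z) ` A z))))"

lemma set_comp_finite: "set_comp A \<Longrightarrow> finite (A z)"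
  unfolding set_comp_def by blast

lemma set_comp_Max:
  assumes "set_comp A" "real_comp g" "real_comp (\<lambda>z. f (rtop z) (rpop z))"
  shows "real_comp (\<lambda>z. Max (insert (g z) ((\<lambda>a. f a z) ` A z)))"
  using assms unfolding set_comp_def by blast

text \<open>A let-binding: the value of \<open>a\<close> stays in \<open>r[k]\<close> and serves as
  the innermost real variable of \<open>f\<close>.\<close>

lemma real_comp_subst:
  assumes "real_comp a" "real_comp f"
  shows "real_comp (\<lambda>z. f (rpush (a z) z))"
  unfolding real_comp_def
proof (intro allI impI)
  fix d k nl rl
  assume bounds: "\<forall>j::nat. nl j < (d::nat)" "\<forall>j::nat. rl j < (k::nat)"
  obtain c p where c: "computes d k nl rl c p a"
    using real_compD[OF assms(1) bounds] by blast
  have bounds': "\<forall>j. case_nat k rl j < Suc k"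
    using bounds by (auto simp: less_Suc_eq split: nat.split)
  obtain c' p' where c': "computes d (Suc k) nl (case_nat k rl) c' p' f"
    using real_compD[OF assms(2) bounds(1) bounds'] by blast
  let ?c = "Seq (Seq c c') (RAssign ''r'' [NConst k] (RCell ''r'' [NConst (Suc k)]))"
  have "computes d k nl rl ?c (p + p' + 1) (\<lambda>z. f (rpush (a z) z))"
    unfolding computes_def
  proof (intro allI impI)
    fix N s
    assume s: "holds_input N s"
    obtain t s1 where 1: "exec c s t s1" "t \<le> poly p (num_edges N)"
      "real_cells s1 ''r'' [k] = a (env_of N nl rl s)" "frame d k s s1" "holds_input N s1"
      using computesE[OF c s] .
    obtain u s2 where 2: "exec c' s1 u s2" "u \<le> poly p' (num_edges N)"
      "real_cells s2 ''r'' [Suc k] = f (env_of N nl (case_nat k rl) s1)" "frame d (Suc k) s1 s2"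
      using computesE[OF c' 1(5)] .
    have env: "env_of N nl rl s1 = env_of N nl rl s"
      using frame_env_of[OF 1(4)] bounds by blast
    have "env_of N nl (case_nat k rl) s1 = rpush (real_cells s1 ''r'' [k]) (env_of N nl rl s1)"
      by (auto simp: env_of_def rpush_def net_def table_def nat_vars_def real_vars_def
          split: nat.split)
    also have "\<dots> = rpush (a (env_of N nl rl s)) (env_of N nl rl s)"
      by (simp add: env 1(3))
    finally have val: "real_cells s2 ''r'' [Suc k] = f (rpush (a (env_of N nl rl s)) (env_of N nl rl s))"
      using 2(3) by simp
    let ?s = "write_real ''r'' [k] (real_cells s2 ''r'' [Suc k]) s2"
    have "frame d k s1 s2"
      using 2(4) by (rule frame_mono) simp_all
    then have "frame d k s ?s"
      using 1(4) frame_write_real[of k k d s2] by (auto intro: frame_trans)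
    moreover have "exec ?c s (t + u + 1) ?s"
      using exec_Seq[OF exec_Seq[OF 1(1) 2(1)]
          exec_RAssign[of "''r''" "[NConst k]" "RCell ''r'' [NConst (Suc k)]"]]
      by simp
    ultimately show "\<exists>t s'. exec ?c s t s' \<and> t \<le> poly (p + p' + 1) (num_edges N) \<and>
        real_cells s' ''r'' [k] = f (rpush (a (env_of N nl rl s)) (env_of N nl rl s)) \<and>
        frame d k s s'"
      using 1(2) 2(2) val
      by (intro exI[of _ "t + u + 1"] exI[of _ ?s]) (simp add: write_real_def)
  qed
  then show "\<exists>c p. computes d k nl rl c p (\<lambda>z. f (rpush (a z) z))"
    by blast
qed

lemma set_comp_empty: "set_comp (\<lambda>z. {})"
  by (simp add: set_comp_def)

lemma set_comp_singleton:
  assumes "real_comp a"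
  shows "set_comp (\<lambda>z. {a z})"
  unfolding set_comp_def
proof (intro conjI allI impI)
  fix f g
  assume *: "real_comp g" "real_comp (\<lambda>z. f (rtop z) (rpop z))"
  have "real_comp (\<lambda>z. f (a z) z)"
    using real_comp_subst[OF assms *(2)] by simp
  with *(1) have "real_comp (\<lambda>z. max (g z) (f (a z) z))"
    by (rule real_comp_max_min)
  then show "real_comp (\<lambda>z. Max (insert (g z) ((\<lambda>a. f a z) ` {a z})))"
    by simp
qed simp

lemma set_comp_Un:
  assumes A: "set_comp A" and B: "set_comp B"
  shows "set_comp (\<lambda>z. A z \<union> B z)"
  unfolding set_comp_def
proof (intro conjI allI impI)
  fix f g
  assume *: "real_comp g" "real_comp (\<lambda>z. f (rtop z) (rpop z))"
  have "real_comp (\<lambda>z. max (Max (insert (g z) ((\<lambda>a. f a z) ` A z)))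
      (Max (insert (g z) ((\<lambda>a. f a z) ` B z))))"
    using assms * by (intro real_comp_max_min set_comp_Max)
  moreover have "max (Max (insert (g z) ((\<lambda>a. f a z) ` A z))) (Max (insert (g z) ((\<lambda>a. f a z) ` B z)))
      = Max (insert (g z) ((\<lambda>a. f a z) ` (A z \<union> B z)))" for z
    using set_comp_finite[OF A] set_comp_finite[OF B] by (subst Max_Un[symmetric]) (auto simp: image_Un)
  ultimately show "real_comp (\<lambda>z. Max (insert (g z) ((\<lambda>a. f a z) ` (A z \<union> B z))))"
    by simp
qed (use assms set_comp_finite in auto)

lemma set_comp_insert:
  "real_comp a \<Longrightarrow> set_comp B \<Longrightarrow> set_comp (\<lambda>z. insert (a z) (B z))"
  using set_comp_Un[OF set_comp_singleton] by simp

text \<open>Turns a maximum over a union into nested maxima. The default \<open>g\<close> is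
  repeated inside so that the inner maximum is defined for empty \<open>B i\<close>.\<close>

lemma Max_insert_UN:
  fixes h :: "'b \<Rightarrow> real"
  assumes "finite I" "\<And>i. i \<in> I \<Longrightarrow> finite (B i)"
  shows "Max (insert g (h ` (\<Union>i\<in>I. B i))) = Max (insert g ((\<lambda>i. Max (insert g (h ` B i))) ` I))"
    (is "?l = ?r")
proof (rule antisym)
  show "?l \<le> ?r"
  proof (rule Max.boundedI)
    fix x
    assume "x \<in> insert g (h ` (\<Union>i\<in>I. B i))"
    then consider "x = g" | i where "i \<in> I" "x \<in> insert g (h ` B i)"
      by auto
    then show "x \<le> ?r"
    proof cases
      case 2
      then have "x \<le> Max (insert g (h ` B i))"
        using assms by (intro Max_ge) auto
      also have "\<dots> \<le> ?r"
        using 2 assms by (intro Max_ge) auto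
      finally show ?thesis .
    qed (use assms in auto)
  qed (use assms in auto)
  show "?r \<le> ?l"
  proof (rule Max.boundedI)
    fix x
    assume "x \<in> insert g ((\<lambda>i. Max (insert g (h ` B i))) ` I)"
    then consider "x = g" | i where "i \<in> I" "x = Max (insert g (h ` B i))"
      by auto
    then show "x \<le> ?l"
      by cases (use assms in \<open>auto intro!: Max_mono Max_ge\<close>)
  qed (use assms in auto)
qed

lemma set_comp_UN_edges:
  assumes "set_comp (\<lambda>z. A (ntop z) (npop z))"
  shows "set_comp (\<lambda>z. \<Union>i<num_edges (net z). A i z)"
  unfolding set_comp_def
proof (intro conjI allI impI)
  have fin: "finite (A i z)" for i z
    using set_comp_finite[OF assms, of "npush i z"] by simp
  fix f g
  assume *: "real_comp g" "real_comp (\<lambda>z. f (rtop z) (rpop z))"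
  \<comment> \<open>\<open>f\<close> and \<open>g\<close> belong to the environment outside the
    loop; a view hides the edge counter from them.\<close>
  have "real_comp (\<lambda>z. f (rtop z) (npop (rpop z)))"
    using real_comp_view[OF *(2), of "\<lambda>z. rpush (rtop z) (npop (rpop z))"]
    by (simp add: view_intros)
  moreover have "real_comp (\<lambda>z. g (npop z))"
    using real_comp_view[OF *(1)] view_intros by blast
  ultimately have "real_comp (\<lambda>z. Max (insert (g (npop z)) ((\<lambda>a. f a (npop z)) ` A (ntop z) (npop z))))"
    using assms by (intro set_comp_Max[where f = "\<lambda>a z. f a (npop z)"])
  then have "real_comp (\<lambda>z. Max (insert (g z)
      ((\<lambda>i. Max (insert (g z) ((\<lambda>a. f a z) ` A i z))) ` {..<num_edges (net z)})))"
    using *(1) by (intro real_comp_Max)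
  then show "real_comp (\<lambda>z. Max (insert (g z) ((\<lambda>a. f a z) ` (\<Union>i<num_edges (net z). A i z))))"
    using fin by (subst Max_insert_UN) auto
next
  fix z
  have "finite (A i z)" for i
    using set_comp_finite[OF assms, of "npush i z"] by simp
  then show "finite (\<Union>i<num_edges (net z). A i z)"
    by simp
qed

lemma set_comp_UN:
  assumes A: "set_comp A" and B: "set_comp (\<lambda>z. B (rtop z) (rpop z))"
  shows "set_comp (\<lambda>z. \<Union>a\<in>A z. B a z)"
  unfolding set_comp_def
proof (intro conjI allI impI)
  have fin: "finite (B a z)" for a z
    using set_comp_finite[OF B, of "rpush a z"] by simp
  fix f g
  assume *: "real_comp g" "real_comp (\<lambda>z. f (rtop z) (rpop z))"
  have "real_comp (\<lambda>z. f (rtop z) (rpop (rpop z)))"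
    using real_comp_view[OF *(2), of "\<lambda>z. rpush (rtop z) (rpop (rpop z))"]
    by (simp add: view_intros)
  moreover have "real_comp (\<lambda>z. g (rpop z))"
    using real_comp_view[OF *(1)] view_intros by blast
  ultimately have "real_comp (\<lambda>z. Max (insert (g (rpop z)) ((\<lambda>a. f a (rpop z)) ` B (rtop z) (rpop z))))"
    using B by (intro set_comp_Max[where f = "\<lambda>a z. f a (rpop z)"])
  then have "real_comp (\<lambda>z. Max (insert (g z)
      ((\<lambda>b. Max (insert (g z) ((\<lambda>a. f a z) ` B b z))) ` A z)))"
    by (intro set_comp_Max[OF A *(1), of "\<lambda>b z. Max (insert (g z) ((\<lambda>a. f a z) ` B b z))"])
  then show "real_comp (\<lambda>z. Max (insert (g z) ((\<lambda>a. f a z) ` (\<Union>b\<in>A z. B b z))))"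
    using fin set_comp_finite[OF A] by (subst Max_insert_UN) auto
next
  fix z
  have "finite (B a z)" for a
    using set_comp_finite[OF B, of "rpush a z"] by simp
  then show "finite (\<Union>a\<in>A z. B a z)"
    using set_comp_finite[OF A] by blast
qed

lemma set_comp_UN_const:
  assumes "finite J" "\<And>j. j \<in> J \<Longrightarrow> set_comp (A j)"
  shows "set_comp (\<lambda>z. \<Union>j\<in>J. A j z)"
  using assms by (induction J rule: finite_induct) (auto intro: set_comp_empty set_comp_Un)

lemma set_comp_UN_pairs:
  fixes J :: "'j set"
  assumes "finite J" "\<And>j. j \<in> J \<Longrightarrow> set_comp (\<lambda>z. A (ntop z, j) (npop z))"
  shows "set_comp (\<lambda>z. \<Union>x\<in>{..<num_edges (net z)} \<times> J. A x z)"
proof -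
  have "set_comp (\<lambda>z. \<Union>j\<in>J. A (ntop z, j) (npop z))"
    using assms by (rule set_comp_UN_const)
  then have "set_comp (\<lambda>z. \<Union>i<num_edges (net z). \<Union>j\<in>J. A (i, j) z)"
    by (rule set_comp_UN_edges)
  moreover have "(\<Union>x\<in>{..<m} \<times> J. A x z) = (\<Union>i<m. \<Union>j\<in>J. A (i, j) z)" for m z
    by auto
  ultimately show ?thesis
    by simp
qed

lemma set_comp_if_le:
  assumes "real_comp a" "real_comp b" "set_comp A" "set_comp B"
  shows "set_comp (\<lambda>z. if a z \<le> b z then A z else B z)"
  unfolding set_comp_def
proof (intro conjI allI impI)
  fix f g
  assume *: "real_comp g" "real_comp (\<lambda>z. f (rtop z) (rpop z))"
  have "real_comp (\<lambda>z. if a z \<le> b z then Max (insert (g z) ((\<lambda>a. f a z) ` A z))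
      else Max (insert (g z) ((\<lambda>a. f a z) ` B z)))"
    using assms * by (intro real_comp_if_le set_comp_Max)
  then show "real_comp (\<lambda>z. Max (insert (g z) ((\<lambda>c. f c z) ` (if a z \<le> b z then A z else B z))))"
    by (rule back_subst[of real_comp]) auto
qed (use assms set_comp_finite in auto)


section \<open>Shortest paths\<close>

abbreviation end_k :: "network \<Rightarrow> nat \<Rightarrow> nat" where
  "end_k N e \<equiv> edge_array N node_k [e]"

abbreviation end_l :: "network \<Rightarrow> nat \<Rightarrow> nat" where
  "end_l N e \<equiv> edge_array N node_l [e]"

abbreviation len :: "network \<Rightarrow> nat \<Rightarrow> real" where
  "len N e \<equiv> edge_array N edge_length [e]"

lemma edge_array_nth [simp]: "e < num_edges N \<Longrightarrow> edge_array N f [e] = f (edges N ! e)"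
  by (simp add: edge_array_def)

text \<open>One Bellman-Ford relaxation of the value \<open>x\<close> at \<open>v\<close>, along
  both directions of \<open>e\<close>. The values \<open>D\<close> of the previous round stay
  fixed.\<close>

definition relax :: "network \<Rightarrow> (nat \<Rightarrow> real) \<Rightarrow> nat \<Rightarrow> real \<Rightarrow> nat \<Rightarrow> real" where
  "relax N D v x e = min x (min (if v = end_l N e then D (end_k N e) + len N e else x)
    (if v = end_k N e then D (end_l N e) + len N e else x))"

definition relax_all :: "network \<Rightarrow> (nat \<Rightarrow> real) \<Rightarrow> nat \<Rightarrow> real" where
  "relax_all N D v = rec_nat (D v) (\<lambda>e x. relax N D v x e) (num_edges N)"

text \<open>\<open>far N\<close> is at least every distance and stands for infinity.\<close>

definition far :: "network \<Rightarrow> real" where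
  "far N = 2 * (\<Sum>e<num_edges N. len N e)"

text \<open>Synchronous Bellman-Ford from \<open>u\<close>: after \<open>r\<close> rounds every walk
  with at most \<open>r\<close> arcs is accounted for (\<open>layer_le\<close>), and no value falls
  below the distance (\<open>layer_ge\<close>).\<close>

primrec layer :: "network \<Rightarrow> nat \<Rightarrow> nat \<Rightarrow> nat \<Rightarrow> real" where
  "layer N 0 u v = (if u = v then 0 else far N)"
| "layer N (Suc r) u v = relax_all N (layer N r u) v"

lemma relax_all_le: "relax_all N D v \<le> D v"
proof -
  have "rec_nat (D v) (\<lambda>e x. relax N D v x e) m \<le> D v" for m
    by (induction m) (auto simp: relax_def min_def)
  then show ?thesis
    by (simp add: relax_all_def)
qed

lemma relax_le:
  "relax N D v x e \<le> x"
  "v = end_l N e \<Longrightarrow> relax N D v x e \<le> D (end_k N e) + len N e"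
  "v = end_k N e \<Longrightarrow> relax N D v x e \<le> D (end_l N e) + len N e"
  unfolding relax_def by (simp_all add: min.coboundedI1 min.coboundedI2)

lemma relax_ge:
  assumes "y \<le> x" "v = end_l N e \<Longrightarrow> y \<le> D (end_k N e) + len N e"
    "v = end_k N e \<Longrightarrow> y \<le> D (end_l N e) + len N e"
  shows "y \<le> relax N D v x e"
  unfolding relax_def using assms by (intro min.boundedI) (simp_all split: if_split)

lemma relax_all_le_arc:
  assumes "e < num_edges N"
  shows "v = end_l N e \<Longrightarrow> relax_all N D v \<le> D (end_k N e) + len N e"
    and "v = end_k N e \<Longrightarrow> relax_all N D v \<le> D (end_l N e) + len N e"
proof -
  have *: "(v = end_l N e \<longrightarrow> rec_nat (D v) (\<lambda>e x. relax N D v x e) m \<le> D (end_k N e) + len N e) \<and>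
      (v = end_k N e \<longrightarrow> rec_nat (D v) (\<lambda>e x. relax N D v x e) m \<le> D (end_l N e) + len N e)"
    if "e < m" for m
    using that
  proof (induction m)
    case (Suc m)
    show ?case
    proof (cases "e = m")
      case True
      then show ?thesis
        by (simp add: relax_le)
    next
      case False
      with Suc have "e < m"
        by simp
      from Suc.IH[OF this] show ?thesis
        using relax_le(1)[of N D v "rec_nat (D v) (\<lambda>e x. relax N D v x e) m" m]
        by (auto intro: order_trans)
    qed
  qed simp
  from *[OF assms] show "v = end_l N e \<Longrightarrow> relax_all N D v \<le> D (end_k N e) + len N e"
    and "v = end_k N e \<Longrightarrow> relax_all N D v \<le> D (end_l N e) + len N e"
    by (simp_all add: relax_all_def)
qed

lemma relax_all_ge:
  assumes "x \<le> D v"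
    and "\<And>e. e < num_edges N \<Longrightarrow> v = end_l N e \<Longrightarrow> x \<le> D (end_k N e) + len N e"
    and "\<And>e. e < num_edges N \<Longrightarrow> v = end_k N e \<Longrightarrow> x \<le> D (end_l N e) + len N e"
  shows "x \<le> relax_all N D v"
proof -
  have "x \<le> rec_nat (D v) (\<lambda>e x. relax N D v x e) m" if "m \<le> num_edges N" for m
    using that
  proof (induction m)
    case (Suc m)
    then have "m < num_edges N" "x \<le> rec_nat (D v) (\<lambda>e x. relax N D v x e) m"
      by simp_all
    then show ?case
      unfolding old.nat.simps(7) by (intro relax_ge assms(2,3))
  qed (simp add: assms(1))
  then show ?thesis
    by (simp add: relax_all_def)
qed

section \<open>Node distances and correctness of the rounds\<close>

locale valid_network =
  fixes N :: network
  assumes is_network: "is_network N"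
begin

abbreviation cost :: "nat \<times> bool \<Rightarrow> real" where
  "cost \<equiv> \<lambda>(e, dir). edge_length (edges N ! e)"

sublocale G: graph "graph_of N"
  using is_network by (simp add: is_network_def)

lemma verts: "verts (graph_of N) = {1..num_nodes N}"
  by (simp add: graph_of_def)

lemma arcs: "arcs (graph_of N) = {..<num_edges N} \<times> UNIV"
  by (simp add: graph_of_def)

lemma arc_ends:
  "tail (graph_of N) (e, True) = node_k (edges N ! e)"
  "head (graph_of N) (e, True) = node_l (edges N ! e)"
  "tail (graph_of N) (e, False) = node_l (edges N ! e)"
  "head (graph_of N) (e, False) = node_k (edges N ! e)"
  by (simp_all add: graph_of_def)

lemma end_nodes:
  assumes "e < num_edges N"
  shows "node_k (edges N ! e) \<in> {1..num_nodes N}" "node_l (edges N ! e) \<in> {1..num_nodes N}"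
  using G.tail_in_verts[of "(e, True)"] G.head_in_verts[of "(e, True)"] assms
  by (simp_all add: arcs arc_ends verts)

lemma length_pos: "e < num_edges N \<Longrightarrow> 0 < edge_length (edges N ! e)"
  using is_network by (simp add: is_network_def)

lemma cost_nonneg: "a \<in> arcs (graph_of N) \<Longrightarrow> 0 \<le> cost a"
  using length_pos by (auto simp: arcs less_imp_le)

lemma reachable:
  assumes "u \<in> {1..num_nodes N}" "v \<in> {1..num_nodes N}"
  shows "u \<rightarrow>\<^sup>*\<^bsub>graph_of N\<^esub> v"
proof -
  have "strongly_connected (graph_of N)"
    using is_network by (intro G.symmetric_connected_imp_strongly_connected G.sym_arcs)
      (simp add: is_network_def)
  with assms show ?thesis
    by (simp add: strongly_connected_def verts)
qed

lemma shortest_path: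
  assumes "u \<in> {1..num_nodes N}" "v \<in> {1..num_nodes N}"
  obtains p where "G.apath u p v" "node_dist N u v = G.awalk_cost cost p"
    "G.\<mu> cost u v = ereal (node_dist N u v)"
proof -
  have "\<exists>p. G.apath u p v \<and> G.\<mu> cost u v = ereal (G.awalk_cost cost p)"
    by (rule G.min_cost_awalk[OF reachable[OF assms] cost_nonneg])
  then show thesis
    by (auto simp: node_dist_def intro: that)
qed

lemma node_dist_le:
  assumes "G.awalk u p v"
  shows "node_dist N u v \<le> G.awalk_cost cost p"
proof -
  have "u \<in> {1..num_nodes N}" "v \<in> {1..num_nodes N}"
    using G.awalk_hd_in_verts[OF assms] G.awalk_last_in_verts[OF assms] by (simp_all add: verts)
  then obtain q where "G.\<mu> cost u v = ereal (node_dist N u v)"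
    by (rule shortest_path)
  moreover have "G.\<mu> cost u v \<le> ereal (G.awalk_cost cost p)"
    using assms by (rule G.min_cost_le_walk_cost)
  ultimately show ?thesis
    by simp
qed

lemma node_dist_nonneg:
  assumes "u \<in> {1..num_nodes N}" "v \<in> {1..num_nodes N}"
  shows "0 \<le> node_dist N u v"
proof -
  obtain p where "G.apath u p v" "node_dist N u v = G.awalk_cost cost p"
    using assms by (rule shortest_path)
  then show ?thesis
    using G.pos_cost_pos_awalk_cost[where c = cost, OF G.awalkI_apath cost_nonneg] by auto
qed

lemma node_dist_refl: "u \<in> {1..num_nodes N} \<Longrightarrow> node_dist N u u = 0"
  using node_dist_le[of u "[]" u] node_dist_nonneg[of u u] by (simp add: G.awalk_Nil_iff verts)

lemma node_dist_triangle:
  assumes "u \<in> {1..num_nodes N}" "v \<in> {1..num_nodes N}" "w \<in> {1..num_nodes N}"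
  shows "node_dist N u w \<le> node_dist N u v + node_dist N v w"
proof -
  obtain p where p: "G.apath u p v" "node_dist N u v = G.awalk_cost cost p"
    using assms(1,2) by (rule shortest_path)
  obtain q where q: "G.apath v q w" "node_dist N v w = G.awalk_cost cost q"
    using assms(2,3) by (rule shortest_path)
  have "G.awalk u (p @ q) w"
    using p(1) q(1) by (intro G.awalk_appendI G.awalkI_apath)
  from node_dist_le[OF this] p(2) q(2) show ?thesis
    by simp
qed

lemma reverse_walk:
  "G.awalk u p v \<Longrightarrow> \<exists>q. G.awalk v q u \<and> G.awalk_cost cost q = G.awalk_cost cost p"
proof (induction p arbitrary: u)
  case Nil
  then show ?case
    by (intro exI[of _ "[]"]) (auto simp: G.awalk_Nil_iff)
next
  case (Cons a p)
  obtain e dir where a: "a = (e, dir)"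
    by (cases a)
  have "a \<in> arcs (graph_of N)" "u = tail (graph_of N) a" "G.awalk (head (graph_of N) a) p v"
    using Cons.prems by (simp_all add: G.awalk_Cons_iff)
  from Cons.IH[OF this(3)] obtain q where
    q: "G.awalk v q (head (graph_of N) a)" "G.awalk_cost cost q = G.awalk_cost cost p"
    by blast
  have "(e, \<not> dir) \<in> arcs (graph_of N)"
    using \<open>a \<in> arcs (graph_of N)\<close> by (simp add: a arcs)
  then have "G.awalk (head (graph_of N) a) [(e, \<not> dir)] u"
    using G.arc_implies_awalk[of "(e, \<not> dir)"] \<open>u = tail (graph_of N) a\<close>
    by (cases dir) (simp_all add: a arc_ends)
  with q show ?case
    by (intro exI[of _ "q @ [(e, \<not> dir)]"] conjI G.awalk_appendI) (simp_all add: a)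
qed

lemma node_dist_sym:
  assumes "u \<in> {1..num_nodes N}" "v \<in> {1..num_nodes N}"
  shows "node_dist N u v = node_dist N v u"
proof -
  have "node_dist N u v \<le> node_dist N v u"
    if uv: "u \<in> {1..num_nodes N}" "v \<in> {1..num_nodes N}" for u v
  proof -
    obtain p where p: "G.apath v p u" "node_dist N v u = G.awalk_cost cost p"
      using uv(2,1) by (rule shortest_path)
    then show ?thesis
      using reverse_walk[OF G.awalkI_apath[OF p(1)]] node_dist_le by fastforce
  qed
  from this[OF assms] this[OF assms(2,1)] show ?thesis
    by simp
qed

lemma node_dist_edge:
  "e < num_edges N \<Longrightarrow>
    node_dist N (node_k (edges N ! e)) (node_l (edges N ! e)) = edge_length (edges N ! e)"
  using is_network by (simp add: is_network_def)

text \<open>A shortest walk can be taken to be a path, which uses no arc twice and therefore costs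
  at most the sum over all arcs.\<close>

lemma node_dist_le_far:
  assumes "u \<in> {1..num_nodes N}" "v \<in> {1..num_nodes N}"
  shows "node_dist N u v \<le> far N"
proof -
  obtain p where p: "G.apath u p v" "node_dist N u v = G.awalk_cost cost p"
    using assms by (rule shortest_path)
  have p_arcs: "set p \<subseteq> arcs (graph_of N)"
    using p(1) by (auto simp: G.apath_def)
  have "distinct (map (tail (graph_of N)) p)"
    using p(1) G.awalk_verts_conv[of u p] by (auto simp: G.apath_def split: if_splits)
  then have "distinct p"
    by (simp add: distinct_map)
  then have "G.awalk_cost cost p = (\<Sum>a\<in>set p. cost a)"
    by (simp add: G.awalk_cost_def sum_list_distinct_conv_sum_set)
  also have "\<dots> \<le> (\<Sum>a\<in>arcs (graph_of N). cost a)"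
    using p_arcs cost_nonneg by (intro sum_mono2) auto
  \<comment> \<open>Every edge carries two arcs; this is the factor 2 in \<open>far\<close>.\<close>
  also have "\<dots> = (\<Sum>e<num_edges N. \<Sum>dir\<in>(UNIV :: bool set). edge_length (edges N ! e))"
    unfolding arcs by (rule sum.cartesian_product[symmetric])
  also have "\<dots> = far N"
    by (simp add: far_def UNIV_bool sum_distrib_left)
  finally show ?thesis
    using p(2) by simp
qed

lemma layer_ge:
  assumes "u \<in> {1..num_nodes N}" "v \<in> {1..num_nodes N}"
  shows "node_dist N u v \<le> layer N r u v"
  using assms(2)
proof (induction r arbitrary: v)
  case 0
  then show ?case
    using assms(1) node_dist_le_far by (simp add: node_dist_refl)
next
  case (Suc r)
  have step: "node_dist N u v \<le> layer N r u w + edge_length (edges N ! e)"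
    if "e < num_edges N" "v = node_l (edges N ! e) \<and> w = node_k (edges N ! e) \<or>
      v = node_k (edges N ! e) \<and> w = node_l (edges N ! e)" for e w
  proof -
    have w: "w \<in> {1..num_nodes N}"
      using that end_nodes by auto
    have "node_dist N u v \<le> node_dist N u w + node_dist N w v"
      using assms(1) w Suc.prems by (rule node_dist_triangle)
    moreover have "node_dist N w v = edge_length (edges N ! e)"
      using that node_dist_edge[OF that(1)] node_dist_sym[OF w Suc.prems] by auto
    ultimately show ?thesis
      using Suc.IH[OF w] by simp
  qed
  show ?case
    unfolding layer.simps
  proof (rule relax_all_ge)
    show "node_dist N u v \<le> layer N r u v"
      by (rule Suc.IH[OF Suc.prems])
    show "node_dist N u v \<le> layer N r u (end_k N e) + len N e"
      if "e < num_edges N" "v = end_l N e" for e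
      using step[OF that(1), of "node_k (edges N ! e)"] that by simp
    show "node_dist N u v \<le> layer N r u (end_l N e) + len N e"
      if "e < num_edges N" "v = end_k N e" for e
      using step[OF that(1), of "node_l (edges N ! e)"] that by simp
  qed
qed

lemma layer_le:
  "G.awalk u p v \<Longrightarrow> length p \<le> r \<Longrightarrow> layer N r u v \<le> G.awalk_cost cost p"
proof (induction r arbitrary: p v)
  case 0
  from 0(2) have "p = []"
    by simp
  from 0(1) have "u = v"
    unfolding \<open>p = []\<close> by (rule G.awalk_empty_ends)
  with \<open>p = []\<close> show ?case
    by simp
next
  case (Suc r)
  show ?case
  proof (cases p rule: rev_cases)
    case Nil
    then have "layer N r u v \<le> 0"
      using Suc.IH[of p v] Suc.prems by simp
    then show ?thesis
      using Nil relax_all_le[of N "layer N r u" v] by simp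
  next
    case (snoc q a)
    obtain e dir where a: "a = (e, dir)"
      by (cases a)
    have q: "G.awalk u q (tail (graph_of N) a)" and "a \<in> arcs (graph_of N)" "v = head (graph_of N) a"
      using Suc.prems(1) by (auto simp: snoc G.awalk_simps)
    then have e: "e < num_edges N"
      by (simp add: a arcs)
    have "layer N r u (tail (graph_of N) a) \<le> G.awalk_cost cost q"
      using q Suc.prems(2) by (intro Suc.IH) (simp_all add: snoc)
    moreover have "layer N (Suc r) u v \<le> layer N r u (tail (graph_of N) a) + edge_length (edges N ! e)"
      using relax_all_le_arc[OF e, of v "layer N r u"] e \<open>v = head (graph_of N) a\<close>
      by (cases dir) (simp_all add: a arc_ends)
    ultimately show ?thesis
      by (simp add: snoc a)
  qed
qed

text \<open>A path visits distinct nodes, so it has fewer than \<open>num_nodes N\<close> arcs and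
  that many rounds suffice.\<close>

lemma layer_eq_node_dist:
  assumes "u \<in> {1..num_nodes N}" "v \<in> {1..num_nodes N}"
  shows "layer N (num_nodes N) u v = node_dist N u v"
proof -
  obtain p where p: "G.apath u p v" "node_dist N u v = G.awalk_cost cost p"
    using assms by (rule shortest_path)
  have "set (G.awalk_verts u p) \<subseteq> verts (graph_of N)"
    using G.awalkI_apath[OF p(1)] by (rule G.awalkE')
  then have "card (set (G.awalk_verts u p)) \<le> num_nodes N"
    using card_mono[of "{1..num_nodes N}" "set (G.awalk_verts u p)"] by (simp add: verts)
  moreover have "card (set (G.awalk_verts u p)) = Suc (length p)"
    using p(1) by (simp add: G.apath_def distinct_card G.length_awalk_verts)
  ultimately have "layer N (num_nodes N) u v \<le> G.awalk_cost cost p"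
    using p(1) by (intro layer_le G.awalkI_apath) simp_all
  with layer_ge[OF assms] p(2) show ?thesis
    by (simp add: antisym)
qed

lemma node_has_edge:
  assumes "v \<in> {1..num_nodes N}" "v' \<in> {1..num_nodes N}" "v \<noteq> v'"
  obtains a where "a \<in> arcs (graph_of N)" "tail (graph_of N) a = v"
proof -
  obtain p where "G.apath v p v'"
    using assms(1,2) by (rule shortest_path)
  then have "G.awalk v p v'"
    by (rule G.awalkI_apath)
  then show thesis
  proof (cases p)
    case Nil
    have "v = v'"
      using \<open>G.awalk v p v'\<close> unfolding Nil by (rule G.awalk_empty_ends)
    with assms(3) show thesis
      by blast
  next
    case (Cons a q)
    have "a \<in> arcs (graph_of N)" "v = tail (graph_of N) a"
      using \<open>G.awalk v p v'\<close> unfolding Cons G.awalk_Cons_iff by blast+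
    then show thesis
      by (intro that[of a]) simp_all
  qed
qed

text \<open>Time is measured in edges, so loops over nodes need this bound. By connectedness every
  node of a network with at least two nodes is the tail of one of the two arcs per edge; the
  \<open>+ 1\<close> is for the single node without edges.\<close>

lemma num_nodes_le: "num_nodes N \<le> 2 * num_edges N + 1"
proof (cases "num_nodes N \<le> 1")
  case False
  have "{1..num_nodes N} \<subseteq> tail (graph_of N) ` arcs (graph_of N)"
  proof
    fix v
    assume "v \<in> {1..num_nodes N}"
    moreover have "(if v = 1 then 2 else 1) \<in> {1..num_nodes N}" "v \<noteq> (if v = 1 then 2 else 1)"
      using False by auto
    ultimately obtain a where "a \<in> arcs (graph_of N)" "tail (graph_of N) a = v"
      by (rule node_has_edge)
    then show "v \<in> tail (graph_of N) ` arcs (graph_of N)"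
      by blast
  qed
  then have "card {1..num_nodes N} \<le> card (arcs (graph_of N))"
    by (meson G.finite_arcs card_image_le card_mono finite_imageI le_trans)
  then show ?thesis
    by (simp add: arcs card_cartesian_product)
qed simp

lemma num_nodes_pos: "0 < num_nodes N"
proof -
  have "verts (graph_of N) \<noteq> {}"
    using is_network
    by (auto simp: is_network_def Digraph_Component.connected_def strongly_connected_def)
  then show ?thesis
    by (simp add: verts)
qed

text \<open>Allows nodes to be replaced by ends of edges, so that the search can be confined to
  points on edges.\<close>

lemma node_is_end:
  assumes "0 < num_edges N" "v \<in> {1..num_nodes N}"
  obtains e where "e < num_edges N" "v = node_k (edges N ! e) \<or> v = node_l (edges N ! e)"
proof -
  have "(0, True) \<in> arcs (graph_of N)"
    using assms(1) by (simp add: arcs)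
  then have "node_k (edges N ! 0) \<noteq> node_l (edges N ! 0)"
    using G.no_loops[of "(0, True)"] by (simp add: arc_ends)
  then obtain v' where "v' \<in> {1..num_nodes N}" "v \<noteq> v'"
    using end_nodes[OF assms(1)] by metis
  with assms(2) obtain a where "a \<in> arcs (graph_of N)" "tail (graph_of N) a = v"
    by (rule node_has_edge)
  moreover obtain e dir where "a = (e, dir)"
    by (cases a)
  ultimately have "e < num_edges N" "v = node_k (edges N ! e) \<or> v = node_l (edges N ! e)"
    by (cases dir; simp add: arcs arc_ends)+
  then show thesis
    by (rule that)
qed

end


section \<open>Computation of the distance table\<close>

lemma real_comp_edge_array:
  assumes "nat_comp a"
  shows "real_comp (\<lambda>z. len (net z) (a z))" "real_comp (\<lambda>z. edge_array (net z) lb_a [a z])"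
    "real_comp (\<lambda>z. edge_array (net z) lb_b [a z])" "real_comp (\<lambda>z. edge_array (net z) ub_a [a z])"
    "real_comp (\<lambda>z. edge_array (net z) ub_b [a z])"
  using real_comp_array[of "''edge_length''" a] real_comp_array[of "''lb_a''" a]
    real_comp_array[of "''lb_b''" a] real_comp_array[of "''ub_a''" a]
    real_comp_array[of "''ub_b''" a] assms
  by (simp_all add: input_store_def)

lemma nat_comp_edge_array:
  assumes "nat_comp a"
  shows "nat_comp (\<lambda>z. end_k (net z) (a z))" "nat_comp (\<lambda>z. end_l (net z) (a z))"
  using nat_comp_array[of "''node_k''" a] nat_comp_array[of "''node_l''" a] assms
  by (simp_all add: input_store_def)

lemmas real_comp_intros = real_comp_arith real_comp_uminus real_comp_numeral real_comp_max_min
  real_comp_radius real_comp_edge_array real_comp_table real_comp_rtop real_comp_if_eq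
  nat_comp_edge_array nat_comp_const nat_comp_num_nodes nat_comp_ntop view_intros

lemma real_comp_far: "real_comp (\<lambda>z. far (net z))"
proof -
  have "real_comp (\<lambda>z. len (net (npop z)) (ntop z))"
    unfolding net_simps by (intro real_comp_intros)
  from real_comp_sum[where f = "\<lambda>i z. len (net z) i", OF this] show ?thesis
    unfolding far_def by (intro real_comp_intros)
qed

text \<open>Variables 0, 1 and 2 are round, source and target; the previous round is read from the
  table.\<close>

lemma real_comp_relax_all:
  "real_comp (\<lambda>z. relax_all (net z)
    (\<lambda>w. table z [nat_vars z 0, nat_vars z 1, w]) (nat_vars z 2))"
proof -
  have var: "nat_vars z 0 = ntop z" "nat_vars z 1 = ntop (npop z)" "nat_vars z 2 = ntop (npop (npop z))"
    for z
    by (simp_all add: ntop_def npop_def nat_vars_def numeral_2_eq_2)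
  show ?thesis
    unfolding var relax_all_def
  proof (rule real_comp_fold[where h = "\<lambda>x e z. relax (net z)
      (\<lambda>w. table z [ntop z, ntop (npop z), w]) (ntop (npop (npop z))) x e"])
    show "real_comp (\<lambda>z. table z [ntop z, ntop (npop z), ntop (npop (npop z))])"
      by (intro real_comp_intros)
    show "real_comp (\<lambda>z. relax (net (rpop (npop z)))
        (\<lambda>w. table (rpop (npop z)) [ntop (rpop (npop z)), ntop (npop (rpop (npop z))), w])
        (ntop (npop (npop (rpop (npop z))))) (rtop z) (ntop z))"
      unfolding relax_def net_simps table_simps by (intro real_comp_intros)
  qed
qed

text \<open>\<open>For\<close> counts from 0 while nodes are numbered from 1, so the bound
  \<open>num_nodes + 1\<close> is what reaches the last node.\<close>

definition fill_layer :: "nexp \<Rightarrow> com \<Rightarrow> com" where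
  "fill_layer L c =
    (let b = NAdd (NCell ''num_nodes'' []) (NConst 1)
     in For 1 b (For 2 b (Seq c
       (RAssign ''dd'' [L, NCell ''i'' [NConst 1], NCell ''i'' [NConst 2]] (RCell ''r'' [NConst 1])))))"

definition layers_done :: "network \<Rightarrow> nat \<Rightarrow> store \<Rightarrow> bool" where
  "layers_done N L s \<longleftrightarrow> holds_input N s \<and>
    (\<forall>r<L. \<forall>u\<le>num_nodes N. \<forall>v\<le>num_nodes N. real_cells s ''dd'' [r, u, v] = layer N r u v)"

lemma layers_done_frame: "layers_done N L s \<Longrightarrow> frame d k s s' \<Longrightarrow> layers_done N L s'"
  unfolding layers_done_def by (auto intro: frame_holds_input simp: frame_def)

lemma holds_input_write_table: "holds_input N s \<Longrightarrow> holds_input N (write_real ''dd'' js x s)"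
  by (auto simp: holds_input_def write_real_def input_real_arrays_def)

lemma holds_input_num_nodes: "holds_input N s \<Longrightarrow> nat_cells s ''num_nodes'' [] = num_nodes N"
  by (simp add: holds_input_def input_nat_arrays_def input_store_def scalar_def)

text \<open>\<open>i[0]\<close>, \<open>i[1]\<close> and \<open>i[2]\<close> hold round, source and
  target; the minimum in \<open>nl\<close> keeps every variable below the scratch offset 3.
  \<open>Lx\<close> names the layer to be written: 0 for the initial layer, \<open>i[0] + 1\<close>
  in the rounds.\<close>

lemma exec_fill_layer:
  fixes f :: "env \<Rightarrow> real"
  defines "nl \<equiv> \<lambda>j::nat. min j 2" and "rl \<equiv> \<lambda>j::nat. 0::nat"
  assumes c: "computes 3 1 nl rl c p f"
    and L: "\<And>s. nat_cells s ''i'' [0] = r0 \<Longrightarrow> nval Lx s = L"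
    and f: "\<And>s. layers_done N L s \<Longrightarrow> nat_cells s ''i'' [0] = r0 \<Longrightarrow>
      nat_cells s ''i'' [1] \<le> num_nodes N \<Longrightarrow> nat_cells s ''i'' [2] \<le> num_nodes N \<Longrightarrow>
      f (env_of N nl rl s) = layer N L (nat_cells s ''i'' [1]) (nat_cells s ''i'' [2])"
    and start: "layers_done N L s" "nat_cells s ''i'' [0] = r0"
  shows "\<exists>t s'. exec (fill_layer Lx c) s t s' \<and>
    t \<le> 2 + (num_nodes N + 1) * (2 + (num_nodes N + 1) * (poly p (num_edges N) + 1 + 2) + 2) \<and>
    layers_done N (Suc L) s' \<and> nat_cells s' ''i'' [0] = r0"
proof -
  let ?n = "num_nodes N"
  let ?b = "NAdd (NCell ''num_nodes'' []) (NConst 1)"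
  let ?body = "Seq c (RAssign ''dd'' [Lx, NCell ''i'' [NConst 1], NCell ''i'' [NConst 2]]
    (RCell ''r'' [NConst 1]))"
  define Good where "Good s \<longleftrightarrow> layers_done N L s \<and> nat_cells s ''i'' [0] = r0" for s
  define Rows where "Rows u s \<longleftrightarrow> Good s \<and>
    (\<forall>u'<u. \<forall>v\<le>?n. real_cells s ''dd'' [L, u', v] = layer N L u' v)" for u s
  define Cols where "Cols u v s \<longleftrightarrow> Rows u s \<and> nat_cells s ''i'' [1] = u \<and>
    (\<forall>v'<v. real_cells s ''dd'' [L, u, v'] = layer N L u v')" for u v s
  have Good_counter: "Good (write_nat ''i'' [Suc j] x s)" if "Good s" for j x s
    using that layers_done_frame[of N L s 1 0, OF _ frame_write_nat[of 1 "Suc j" 0 s x]]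
    by (simp add: Good_def, simp add: write_nat_def)
  have Rows_counter: "Rows u (write_nat ''i'' [Suc j] x s)" if "Rows u s" for u j x s
    using that Good_counter[of s j x] by (simp add: Rows_def, simp add: write_nat_def)
  have bound: "nval ?b s = ?n + 1" if "Good s" for s
    using that by (simp add: Good_def layers_done_def holds_input_num_nodes)
  have inner: "\<exists>t s'. exec (For 2 ?b ?body) s t s' \<and>
      t \<le> 2 + (?n + 1) * (poly p (num_edges N) + 1 + 2) \<and> Cols u (?n + 1) s'"
    if u: "u \<le> ?n" and s: "Rows u s" "nat_cells s ''i'' [1] = u" for u s
  proof (rule exec_For)
    show "nval ?b s = ?n + 1" if "Cols u q s" for q s
      using that bound by (simp add: Cols_def Rows_def)
    show "Cols u q (write_nat ''i'' [2] x s)" if "Cols u q s" for q s x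
      using that Rows_counter[of u s 1 x]
      by (simp add: Cols_def numeral_2_eq_2, simp add: write_nat_def)
    show "Cols u 0 s"
      using s by (simp add: Cols_def)
  next
    fix v s
    assume v: "v < ?n + 1" "Cols u v s" "nat_cells s ''i'' [2] = v"
    then have s: "layers_done N L s" "nat_cells s ''i'' [0] = r0" "nat_cells s ''i'' [1] = u"
      by (simp_all add: Cols_def Rows_def Good_def)
    then have "holds_input N s"
      by (simp add: layers_done_def)
    with c obtain t s1 where 1: "exec c s t s1" "t \<le> poly p (num_edges N)"
      "real_cells s1 ''r'' [1] = f (env_of N nl rl s)" "frame 3 1 s s1"
      by (rule computesE)
    have i: "nat_cells s1 ''i'' [0] = r0" "nat_cells s1 ''i'' [1] = u" "nat_cells s1 ''i'' [2] = v"
      using frame_nat[OF 1(4)] s v(3) by simp_all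
    have dd: "real_cells s1 ''dd'' = real_cells s ''dd''"
      using 1(4) by (auto simp: frame_def)
    have val: "real_cells s1 ''r'' [1] = layer N L u v"
      using f[OF s(1,2)] s(3) v(1,3) u 1(3) by simp
    let ?s = "write_real ''dd'' [L, u, v] (layer N L u v) s1"
    have "exec ?body s (t + 1) ?s"
      using exec_Seq[OF 1(1) exec_RAssign[of "''dd''"
          "[Lx, NCell ''i'' [NConst 1], NCell ''i'' [NConst 2]]"
          "RCell ''r'' [NConst 1]"]] i L[OF i(1)] val by simp
    moreover have "layers_done N L ?s"
    proof -
      have s1: "layers_done N L s1"
        using s(1) 1(4) by (rule layers_done_frame)
      then have "holds_input N ?s"
        by (intro holds_input_write_table) (simp add: layers_done_def)
      with s1 show ?thesis
        by (simp add: layers_done_def) (simp add: write_real_def)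
    qed
    then have "Cols u (Suc v) ?s"
      using v(2) i dd by (auto simp: Cols_def Rows_def Good_def write_real_def less_Suc_eq)
    moreover have "nat_cells ?s ''i'' [2] = v"
      using i by (simp add: write_real_def)
    ultimately show "\<exists>t s'. exec ?body s t s' \<and> t \<le> poly p (num_edges N) + 1 \<and>
        Cols u (Suc v) s' \<and> nat_cells s' ''i'' [2] = v"
      using 1(2) by (intro exI[of _ "t + 1"] exI[of _ ?s]) simp
  qed
  have "\<exists>t s'. exec (For 1 ?b (For 2 ?b ?body)) s t s' \<and>
    t \<le> 2 + (?n + 1) * (2 + (?n + 1) * (poly p (num_edges N) + 1 + 2) + 2) \<and> Rows (?n + 1) s'"
  proof (rule exec_For)
    show "nval ?b s = ?n + 1" if "Rows q s" for q s
      using that bound by (simp add: Rows_def)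
    show "Rows q (write_nat ''i'' [1] x s)" if "Rows q s" for q s x
      using Rows_counter[OF that, of 0 x] by simp
    show "Rows 0 s"
      using start by (simp add: Rows_def Good_def)
  next
    fix u s
    assume u: "u < ?n + 1" "Rows u s" "nat_cells s ''i'' [1] = u"
    then obtain t s' where "exec (For 2 ?b ?body) s t s'"
      "t \<le> 2 + (?n + 1) * (poly p (num_edges N) + 1 + 2)" "Cols u (?n + 1) s'"
      using inner[of u s] by auto
    moreover have "Rows (Suc u) s'"
    proof -
      have "Rows u s'" "\<forall>v\<le>?n. real_cells s' ''dd'' [L, u, v] = layer N L u v"
        using calculation(3) by (simp_all add: Cols_def less_Suc_eq_le)
      then show ?thesis
        by (auto simp: Rows_def less_Suc_eq)
    qed
    moreover have "nat_cells s' ''i'' [1] = u"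
      using calculation(3) by (simp add: Cols_def)
    ultimately show "\<exists>t s'. exec (For 2 ?b ?body) s t s' \<and>
        t \<le> 2 + (?n + 1) * (poly p (num_edges N) + 1 + 2) \<and> Rows (Suc u) s' \<and>
        nat_cells s' ''i'' [1] = u"
      by blast
  qed
  moreover have "layers_done N (Suc L) s' \<and> nat_cells s' ''i'' [0] = r0" if "Rows (?n + 1) s'" for s'
  proof -
    have "Good s'" "\<forall>u\<le>?n. \<forall>v\<le>?n. real_cells s' ''dd'' [L, u, v] = layer N L u v"
      using that by (simp_all add: Rows_def less_Suc_eq_le)
    then show ?thesis
      by (auto simp: Good_def layers_done_def less_Suc_eq)
  qed
  ultimately show ?thesis
    unfolding fill_layer_def Let_def by blast
qed

lemma distance_table_program:
  "\<exists>c (p :: nat poly). \<forall>N s. is_network N \<longrightarrow> holds_input N s \<longrightarrow>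
    (\<exists>t s'. exec c s t s' \<and> t \<le> poly p (num_edges N) \<and> layers_done N (Suc (num_nodes N)) s')"
proof -
  let ?nl = "\<lambda>j::nat. min j 2" and ?rl = "\<lambda>j::nat. 0::nat"
  let ?f0 = "\<lambda>z. if nat_vars z 1 = nat_vars z 2 then 0 else far (net z)"
  let ?f1 = "\<lambda>z. relax_all (net z) (\<lambda>w. table z [nat_vars z 0, nat_vars z 1, w]) (nat_vars z 2)"
  have var: "nat_vars z 1 = ntop (npop z)" "nat_vars z 2 = ntop (npop (npop z))" for z
    by (simp_all add: ntop_def npop_def nat_vars_def numeral_2_eq_2)
  have bounds: "\<forall>j. ?nl j < 3" "\<forall>j. ?rl j < 1"
    by auto
  have "real_comp ?f0"
    unfolding var by (intro real_comp_intros real_comp_far)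
  then obtain c0 p0 where c0: "computes 3 1 ?nl ?rl c0 p0 ?f0"
    using real_compD[OF _ bounds] by blast
  obtain c1 p1 where c1: "computes 3 1 ?nl ?rl c1 p1 ?f1"
    using real_compD[OF real_comp_relax_all bounds] by blast
  let ?i0 = "NCell ''i'' [NConst 0]"
  let ?init = "fill_layer (NConst 0) c0" and ?step = "fill_layer (NAdd ?i0 (NConst 1)) c1"
  let ?loop = "For 0 (NCell ''num_nodes'' []) ?step"
  \<comment> \<open>\<open>2 + 2 * m\<close> bounds \<open>num_nodes + 1\<close> by
    \<open>num_nodes_le\<close>; \<open>?T\<close> then bounds the two nested loops that fill one
    layer.\<close>
  let ?n = "[:2, 2:] :: nat poly"
  let ?T = "\<lambda>p. 2 + ?n * (2 + ?n * (p + 1 + 2) + 2)"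
  let ?p = "?T p0 + (2 + ?n * (?T p1 + 2))"
  show ?thesis
  proof (intro exI[of _ "Seq ?init ?loop"] exI[of _ ?p] allI impI)
    fix N s
    assume N: "is_network N" and s: "holds_input N s"
    interpret valid_network N
      using N by unfold_locales
    let ?m = "num_edges N"
    have n: "num_nodes N + 1 \<le> poly ?n ?m"
      using num_nodes_le by simp
    have time: "2 + (num_nodes N + 1) * (2 + (num_nodes N + 1) * (poly p ?m + 1 + 2) + 2) \<le>
        poly (?T p) ?m" for p
    proof -
      have "(num_nodes N + 1) * (2 + (num_nodes N + 1) * (poly p ?m + 1 + 2) + 2) \<le>
          poly ?n ?m * (2 + poly ?n ?m * (poly p ?m + 1 + 2) + 2)"
        by (intro mult_le_mono add_mono n order_refl)
      then show ?thesis
        by (simp only: poly_add poly_mult poly_numeral poly_1 add_le_cancel_left)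
    qed
    have "\<exists>t s'. exec ?init s t s' \<and>
        t \<le> 2 + (num_nodes N + 1) * (2 + (num_nodes N + 1) * (poly p0 ?m + 1 + 2) + 2) \<and>
        layers_done N (Suc 0) s' \<and> nat_cells s' ''i'' [0] = nat_cells s ''i'' [0]"
      using s by (intro exec_fill_layer[OF c0])
        (simp_all add: layers_done_def env_of_def nat_vars_def net_def)
    then obtain t0 s0 where 0: "exec ?init s t0 s0" "t0 \<le> poly (?T p0) ?m" "layers_done N 1 s0"
      using time[of p0] by (auto intro: order_trans)
    have "\<exists>t s'. exec ?loop s0 t s' \<and> t \<le> 2 + num_nodes N * (poly (?T p1) ?m + 2) \<and>
        layers_done N (Suc (num_nodes N)) s'"
    proof (rule exec_For[where Inv = "\<lambda>r. layers_done N (Suc r)"])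
      show "nval (NCell ''num_nodes'' []) s = num_nodes N" if "layers_done N (Suc q) s" for q s
        using that by (simp add: layers_done_def holds_input_num_nodes)
      show "layers_done N (Suc q) (write_nat ''i'' [0] v s)" if "layers_done N (Suc q) s" for q s v
        using that frame_write_nat[of 0 0 0] by (rule layers_done_frame) simp
      show "layers_done N (Suc 0) s0"
        using 0(3) by simp
    next
      fix q s
      assume q: "q < num_nodes N" "layers_done N (Suc q) s" "nat_cells s ''i'' [0] = q"
      have "\<exists>t s'. exec ?step s t s' \<and>
          t \<le> 2 + (num_nodes N + 1) * (2 + (num_nodes N + 1) * (poly p1 ?m + 1 + 2) + 2) \<and>
          layers_done N (Suc (Suc q)) s' \<and> nat_cells s' ''i'' [0] = q"
      proof (rule exec_fill_layer[OF c1 _ _ q(2,3)])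
        fix s
        assume s: "layers_done N (Suc q) s" "nat_cells s ''i'' [0] = q"
          "nat_cells s ''i'' [1] \<le> num_nodes N" "nat_cells s ''i'' [2] \<le> num_nodes N"
        define u where "u = nat_cells s ''i'' [1]"
        have eq: "real_cells s ''dd'' [q, u, w] = layer N q u w"
          if "w \<le> num_nodes N" for w
          using s(1,3) that by (simp add: layers_done_def u_def)
        \<comment> \<open>Relaxation reads the table only at end nodes of edges, where it agrees
          with the previous layer.\<close>
        have relax: "relax N (\<lambda>w. real_cells s ''dd'' [q, u, w]) v x e =
            relax N (layer N q u) v x e" if "e < ?m" for v x e
          using end_nodes[OF that] that by (simp add: relax_def eq)
        have "rec_nat y (\<lambda>e x. relax N (\<lambda>w. real_cells s ''dd'' [q, u, w]) v x e) m
            = rec_nat y (\<lambda>e x. relax N (layer N q u) v x e) m"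
          if "m \<le> ?m" for v y m
          using that by (induction m) (simp_all add: relax)
        then have "relax_all N (\<lambda>w. real_cells s ''dd'' [q, u, w]) (nat_cells s ''i'' [2])
            = relax_all N (layer N q u) (nat_cells s ''i'' [2])"
          using s(4) by (simp add: relax_all_def eq)
        then show "?f1 (env_of N ?nl ?rl s) =
            layer N (Suc q) (nat_cells s ''i'' [1]) (nat_cells s ''i'' [2])"
          using s(2) by (simp add: u_def env_of_def nat_vars_def net_def table_def)
      qed simp
      then show "\<exists>t s'. exec ?step s t s' \<and> t \<le> poly (?T p1) ?m \<and>
          layers_done N (Suc (Suc q)) s' \<and> nat_cells s' ''i'' [0] = q"
        using time[of p1] by (blast intro: order_trans)
    qed
    then obtain t1 s1 where 1: "exec ?loop s0 t1 s1"
      "t1 \<le> 2 + num_nodes N * (poly (?T p1) ?m + 2)" "layers_done N (Suc (num_nodes N)) s1"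
      by blast
    have "num_nodes N * (poly (?T p1) ?m + 2) \<le> poly ?n ?m * (poly (?T p1) ?m + 2)"
      using n by (intro mult_le_mono) simp_all
    with 1(2) have "t1 \<le> 2 + poly ?n ?m * (poly (?T p1) ?m + 2)"
      by (meson add_left_mono order_trans)
    also have "\<dots> = poly (2 + ?n * (?T p1 + 2)) ?m"
      by (simp only: poly_add poly_mult poly_numeral)
    finally have "t1 \<le> poly (2 + ?n * (?T p1 + 2)) ?m" .
    with 0(2) have "t0 + t1 \<le> poly (?T p0) ?m + poly (2 + ?n * (?T p1 + 2)) ?m"
      by (rule add_mono)
    also have "\<dots> = poly ?p ?m"
      by (rule poly_add[symmetric])
    finally have "t0 + t1 \<le> poly ?p ?m" .
    then show "\<exists>t s'. exec (Seq ?init ?loop) s t s' \<and> t \<le> poly ?p ?m \<and>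
        layers_done N (Suc (num_nodes N)) s'"
      using exec_Seq[OF 0(1) 1(1)] 1(3) by blast
  qed
qed


section \<open>Roots and interpolation\<close>

text \<open>Always four numbers: \<open>kth_root\<close> yields 0 for missing roots, so the set may
  contain a spurious 0. Only completeness for nonzero polynomials is needed of it.\<close>

definition roots :: "real \<Rightarrow> real \<Rightarrow> real \<Rightarrow> real \<Rightarrow> real \<Rightarrow> real set" where
  "roots c0 c1 c2 c3 c4 = (\<Union>j<4. {kth_root j (Poly [c0, c1, c2, c3, c4])})"

lemma finite_roots [simp]: "finite (roots c0 c1 c2 c3 c4)"
  by (simp add: roots_def)

lemma roots_complete:
  assumes "c0 + c1 * x + c2 * x\<^sup>2 + c3 * x ^ 3 + c4 * x ^ 4 = 0"
    and "\<not> (c0 = 0 \<and> c1 = 0 \<and> c2 = 0 \<and> c3 = 0 \<and> c4 = 0)"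
  shows "x \<in> roots c0 c1 c2 c3 c4"
proof -
  let ?p = "Poly [c0, c1, c2, c3, c4]"
  let ?R = "{y. poly ?p y = 0}"
  have "?p \<noteq> 0"
    using assms(2) by auto
  then have fin: "finite ?R"
    by (rule poly_roots_finite)
  have "card ?R \<le> degree ?p"
    using \<open>?p \<noteq> 0\<close> by (rule card_poly_roots_bound)
  also have "\<dots> \<le> 4"
    by simp
  finally have card: "card ?R \<le> 4" .
  have "poly ?p x = c0 + c1 * x + c2 * x\<^sup>2 + c3 * x ^ 3 + c4 * x ^ 4"
    by (simp add: algebra_simps power2_eq_square power3_eq_cube power4_eq_xxxx)
  with assms(1) have "x \<in> set (sorted_list_of_set ?R)"
    using fin by simp
  then obtain j where j: "j < length (sorted_list_of_set ?R)" "sorted_list_of_set ?R ! j = x"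
    by (auto simp: in_set_conv_nth)
  then have "kth_root j ?p = x"
    using \<open>?p \<noteq> 0\<close> by (simp add: kth_root_def del: Poly.simps)
  moreover have "j < 4"
    using j(1) card by simp
  ultimately show ?thesis
    unfolding roots_def by blast
qed

text \<open>The leading coefficient of the quadratic that interpolates \<open>f\<close> at
  \<open>u\<close>, the midpoint and \<open>v\<close>, read off the second difference. Since
  \<open>x / 0 = 0\<close>, it is defined for every pair, including equal points.\<close>

definition quad2 :: "(real \<Rightarrow> real) \<Rightarrow> real \<Rightarrow> real \<Rightarrow> real" where
  "quad2 f u v = 2 * (f u - 2 * f ((u + v) / 2) + f v) / ((v - u) * (v - u))"

definition quad1 :: "(real \<Rightarrow> real) \<Rightarrow> real \<Rightarrow> real \<Rightarrow> real" where
  "quad1 f u v = (f v - f u) / (v - u) - quad2 f u v * (u + v)"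

definition quad0 :: "(real \<Rightarrow> real) \<Rightarrow> real \<Rightarrow> real \<Rightarrow> real" where
  "quad0 f u v = f u - quad2 f u v * u * u - quad1 f u v * u"

definition quad_at :: "real \<Rightarrow> real \<Rightarrow> real \<Rightarrow> real \<Rightarrow> real" where
  "quad_at a b c t = a * t * t + b * t + c"

definition quadratic_on :: "real \<Rightarrow> real \<Rightarrow> (real \<Rightarrow> real) \<Rightarrow> bool" where
  "quadratic_on u v f \<longleftrightarrow> (\<exists>a b c. \<forall>t\<in>{u..v}. f t = quad_at a b c t)"

lemma quad_coeffs:
  assumes "u < v" "\<And>t. t \<in> {u..v} \<Longrightarrow> f t = quad_at a b c t"
  shows "quad2 f u v = a" "quad1 f u v = b" "quad0 f u v = c"
proof -
  have f: "f u = quad_at a b c u" "f v = quad_at a b c v" "f ((u + v) / 2) = quad_at a b c ((u + v) / 2)"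
    using assms by simp_all
  have "2 * (f u - 2 * f ((u + v) / 2) + f v) = a * ((v - u) * (v - u))"
    unfolding f quad_at_def by (simp add: field_simps)
  then show 2: "quad2 f u v = a"
    using assms(1) by (simp add: quad2_def)
  have "f v - f u = (a * (u + v) + b) * (v - u)"
    unfolding f quad_at_def by (simp add: algebra_simps)
  then have "(f v - f u) / (v - u) = a * (u + v) + b"
    using assms(1) by simp
  then show 1: "quad1 f u v = b"
    by (simp add: quad1_def 2)
  show "quad0 f u v = c"
    by (simp add: quad0_def 1 2 f quad_at_def)
qed

lemma quad_interpolation:
  assumes "quadratic_on u v f" "u < v" "t \<in> {u..v}"
  shows "f t = quad_at (quad2 f u v) (quad1 f u v) (quad0 f u v) t"
proof -
  obtain a b c where *: "\<And>t. t \<in> {u..v} \<Longrightarrow> f t = quad_at a b c t"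
    using assms(1) by (auto simp: quadratic_on_def)
  from quad_coeffs[OF assms(2) this] show ?thesis
    using *[OF assms(3)] by simp
qed

lemma consecutive_elements:
  fixes C :: "real set"
  assumes "finite C" "c1 \<in> C" "c2 \<in> C" "c1 \<le> x" "x < c2"
  obtains c c' where "c \<in> C" "c' \<in> C" "c \<le> x" "x < c'" "{c<..<c'} \<inter> C = {}" "c1 \<le> c" "c' \<le> c2"
proof -
  let ?L = "{y \<in> C. y \<le> x}" and ?U = "{y \<in> C. x < y}"
  have L: "finite ?L" "?L \<noteq> {}" and U: "finite ?U" "?U \<noteq> {}"
    using assms by auto
  show thesis
  proof (rule that)
    show "Max ?L \<in> C" "Max ?L \<le> x"
      using Max_in[OF L] by auto
    show "Min ?U \<in> C" "x < Min ?U"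
      using Min_in[OF U] by auto
    show "{Max ?L<..<Min ?U} \<inter> C = {}"
    proof (intro equals0I)
      fix y
      assume y: "y \<in> {Max ?L<..<Min ?U} \<inter> C"
      show False
      proof (cases "y \<le> x")
        case True
        then have "y \<le> Max ?L"
          using y L(1) by (intro Max_ge) auto
        with y show False
          by simp
      next
        case False
        then have "Min ?U \<le> y"
          using y U(1) by (intro Min_le) auto
        with y show False
          by simp
      qed
    qed
    show "c1 \<le> Max ?L"
      using assms L(1) by (intro Max_ge) auto
    show "Min ?U \<le> c2"
      using assms U(1) by (intro Min_le) auto
  qed
qed


section \<open>Sign cells of a family of curves\<close>

text \<open>Positions s at which the curve a t^2 + b t + c(s) = 0 passes through the height
  \<open>t\<close>. It is used for the ends of the rectangle and for the apex height -b/(2a), where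
  two branches of the curve merge.\<close>

definition crit1 :: "real \<Rightarrow> real \<Rightarrow> real \<Rightarrow> real \<Rightarrow> real \<Rightarrow> real \<Rightarrow> real set" where
  "crit1 a b c0 c1 c2 t = roots (quad_at a b c0 t) c1 c2 0 0"

text \<open>Meant for proportional pairs (a, b) and (a', b'): such curves meet above s only if the
  constant terms are in the same proportion, that is, if both differences vanish at s.\<close>

definition crit2 ::
  "real \<Rightarrow> real \<Rightarrow> real \<Rightarrow> real \<Rightarrow> real \<Rightarrow> real \<Rightarrow> real \<Rightarrow> real \<Rightarrow> real \<Rightarrow> real \<Rightarrow> real set" where
  "crit2 a b c0 c1 c2 a' b' c0' c1' c2' =
    roots (a' * c0 - a * c0') (a' * c1 - a * c1') (a' * c2 - a * c2') 0 0 \<union>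
    roots (b' * c0 - b * c0') (b' * c1 - b * c1') (b' * c2 - b * c2') 0 0"

text \<open>
  For \<open>D = a * b' - a' * b \<noteq> 0\<close>, two curves \<open>a * t\<^sup>2 + b * t + c(s) = 0\<close> and
  \<open>a' * t\<^sup>2 + b' * t + c'(s) = 0\<close> can meet only at \<open>t = W(s) / D\<close>, where
  \<open>W = a' * c - a * c'\<close>. The polynomial below is \<open>a * W\<^sup>2 + b * D * W + D\<^sup>2 * c\<close>, that is, \<open>D\<^sup>2\<close>
  times the left-hand side of the first equation at this \<open>t\<close>.
\<close>

definition crit3_poly ::
  "real \<Rightarrow> real \<Rightarrow> real \<Rightarrow> real \<Rightarrow> real \<Rightarrow> real \<Rightarrow> real \<Rightarrow> real \<Rightarrow> real \<Rightarrow> real set" where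
  "crit3_poly a b c0 c1 c2 D w0 w1 w2 =
    roots (a * w0 * w0 + b * D * w0 + D * D * c0)
      (2 * a * w0 * w1 + b * D * w1 + D * D * c1)
      (a * (2 * w0 * w2 + w1 * w1) + b * D * w2 + D * D * c2)
      (2 * a * w1 * w2) (a * w2 * w2)"

definition crit3 ::
  "real \<Rightarrow> real \<Rightarrow> real \<Rightarrow> real \<Rightarrow> real \<Rightarrow> real \<Rightarrow> real \<Rightarrow> real \<Rightarrow> real \<Rightarrow> real \<Rightarrow> real set" where
  "crit3 a b c0 c1 c2 a' b' c0' c1' c2' =
    crit3_poly a b c0 c1 c2 (a * b' - a' * b)
      (a' * c0 - a * c0') (a' * c1 - a * c1') (a' * c2 - a * c2')"

lemma finite_crit [simp]:
  "finite (crit1 a b c0 c1 c2 t)"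
  "finite (crit2 a b c0 c1 c2 a' b' c0' c1' c2')"
  "finite (crit3 a b c0 c1 c2 a' b' c0' c1' c2')"
  by (simp_all add: crit1_def crit2_def crit3_def crit3_poly_def)

definition curve :: "real \<Rightarrow> real \<Rightarrow> real \<Rightarrow> real \<Rightarrow> real \<Rightarrow> real \<Rightarrow> real \<Rightarrow> real" where
  "curve a b c0 c1 c2 s t = quad_at a b (quad_at c2 c1 c0 s) t"

text \<open>Since \<open>roots\<close> is complete for nonzero polynomials, a polynomial that
  vanishes at a non-critical s vanishes identically. In this way \<open>crit1D\<close>,
  \<open>crit2D\<close> and \<open>crit3D\<close> extend an incidence at one position to all
  positions.\<close>

lemma crit1D:
  assumes "s \<notin> crit1 a b c0 c1 c2 t" "curve a b c0 c1 c2 s t = 0"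
  shows "quad_at a b c0 t = 0" "c1 = 0" "c2 = 0"
proof -
  have "quad_at a b c0 t + c1 * s + c2 * s\<^sup>2 + 0 * s ^ 3 + 0 * s ^ 4 = 0"
    using assms(2) by (simp add: curve_def quad_at_def algebra_simps power2_eq_square)
  with assms(1) have "quad_at a b c0 t = 0 \<and> c1 = 0 \<and> c2 = 0"
    using roots_complete unfolding crit1_def by blast
  then show "quad_at a b c0 t = 0" "c1 = 0" "c2 = 0"
    by simp_all
qed

lemma crit2D:
  assumes "s \<notin> crit2 a b c0 c1 c2 a' b' c0' c1' c2'"
  shows "a' * quad_at c2 c1 c0 s - a * quad_at c2' c1' c0' s = 0 \<Longrightarrow>
      a' * quad_at c2 c1 c0 x - a * quad_at c2' c1' c0' x = 0" (is "?A s \<Longrightarrow> _")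
    and "b' * quad_at c2 c1 c0 s - b * quad_at c2' c1' c0' s = 0 \<Longrightarrow>
      b' * quad_at c2 c1 c0 x - b * quad_at c2' c1' c0' x = 0"
proof -
  have *: "r' * quad_at c2 c1 c0 x - r * quad_at c2' c1' c0' x = 0"
    if "s \<notin> roots (r' * c0 - r * c0') (r' * c1 - r * c1') (r' * c2 - r * c2') 0 0"
      "r' * quad_at c2 c1 c0 s - r * quad_at c2' c1' c0' s = 0" for r r'
  proof -
    have "(r' * c0 - r * c0') + (r' * c1 - r * c1') * s + (r' * c2 - r * c2') * s\<^sup>2
        + 0 * s ^ 3 + 0 * s ^ 4 = 0"
      using that(2) by (simp add: quad_at_def algebra_simps power2_eq_square)
    with that(1) have "r' * c0 - r * c0' = 0 \<and> r' * c1 - r * c1' = 0 \<and> r' * c2 - r * c2' = 0"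
      using roots_complete by blast
    moreover have "r' * quad_at c2 c1 c0 x - r * quad_at c2' c1' c0' x =
        (r' * c0 - r * c0') + (r' * c1 - r * c1') * x + (r' * c2 - r * c2') * x * x"
      by (simp add: quad_at_def algebra_simps)
    ultimately show ?thesis
      by simp
  qed
  show "?A s \<Longrightarrow> ?A x"
    using assms * unfolding crit2_def by blast
  show "b' * quad_at c2 c1 c0 s - b * quad_at c2' c1' c0' s = 0 \<Longrightarrow>
      b' * quad_at c2 c1 c0 x - b * quad_at c2' c1' c0' x = 0"
    using assms * unfolding crit2_def by blast
qed

lemma crit3D:
  assumes "s \<notin> crit3 a b c0 c1 c2 a' b' c0' c1' c2'" "D = a * b' - a' * b" "D \<noteq> 0"
    and W: "\<And>x. W x = a' * quad_at c2 c1 c0 x - a * quad_at c2' c1' c0' x"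
    and "curve a b c0 c1 c2 s (W s / D) = 0"
  shows "curve a b c0 c1 c2 x (W x / D) = 0"
proof -
  define w0 w1 w2 where "w0 = a' * c0 - a * c0'" "w1 = a' * c1 - a * c1'" "w2 = a' * c2 - a * c2'"
  have W': "W x = w0 + w1 * x + w2 * x * x" for x
    by (simp add: W w0_w1_w2_def quad_at_def algebra_simps)
  define e0 e1 e2 e3 e4 where
    "e0 = a * w0 * w0 + b * D * w0 + D * D * c0"
    "e1 = 2 * a * w0 * w1 + b * D * w1 + D * D * c1"
    "e2 = a * (2 * w0 * w2 + w1 * w1) + b * D * w2 + D * D * c2"
    "e3 = 2 * a * w1 * w2" "e4 = a * w2 * w2"
  have E: "e0 + e1 * x + e2 * x\<^sup>2 + e3 * x ^ 3 + e4 * x ^ 4 =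
      D * D * curve a b c0 c1 c2 x (W x / D)" for x
  proof -
    have "D * D * curve a b c0 c1 c2 x (W x / D) =
        a * W x * W x + b * D * W x + D * D * quad_at c2 c1 c0 x"
      using assms(3) by (simp add: curve_def quad_at_def field_simps)
    also have "\<dots> = e0 + e1 * x + e2 * x\<^sup>2 + e3 * x ^ 3 + e4 * x ^ 4"
      unfolding W' e0_e1_e2_e3_e4_def quad_at_def
      by (simp add: algebra_simps power2_eq_square power3_eq_cube power4_eq_xxxx)
    finally show ?thesis ..
  qed
  have "s \<notin> roots e0 e1 e2 e3 e4"
    using assms(1) unfolding crit3_def crit3_poly_def e0_e1_e2_e3_e4_def w0_w1_w2_def assms(2) .
  then have "e0 = 0 \<and> e1 = 0 \<and> e2 = 0 \<and> e3 = 0 \<and> e4 = 0"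
    using roots_complete[of e0 e1 s e2 e3 e4] E[of s] assms(5) by auto
  with E[of x] assms(3) show ?thesis
    by auto
qed

lemma quad_at_factor:
  "quad_at a b c t - quad_at a b c u = (t - u) * (a * (t + u) + b)"
  by (simp add: quad_at_def algebra_simps)

lemma quad_at_zero:
  assumes "\<And>x. quad_at a b c x = 0"
  shows "a = 0" "b = 0" "c = 0"
  using assms[of 0] assms[of 1] assms[of "-1"] by (simp_all add: quad_at_def)

text \<open>A strip above \<open>{k1<..<k2}\<close> without critical positions, as in a cylindrical
  decomposition: over it no curve crosses the ends \<open>t1\<close>, \<open>t2\<close> or its own
  apex height, and no two curves meet at an isolated point unless both are static.\<close>

locale curves =
  fixes I :: "'i set" and a b c0 c1 c2 :: "'i \<Rightarrow> real" and k1 k2 t1 t2 :: real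
  assumes finite_I: "finite I"
    and t1_t2: "t1 < t2"
    and no_crit1: "\<And>i t s. i \<in> I \<Longrightarrow> t \<in> {t1, t2, - b i / (2 * a i)} \<Longrightarrow> s \<in> {k1<..<k2} \<Longrightarrow>
      s \<notin> crit1 (a i) (b i) (c0 i) (c1 i) (c2 i) t"
    and no_crit2: "\<And>i j s. i \<in> I \<Longrightarrow> j \<in> I \<Longrightarrow> s \<in> {k1<..<k2} \<Longrightarrow>
      s \<notin> crit2 (a i) (b i) (c0 i) (c1 i) (c2 i) (a j) (b j) (c0 j) (c1 j) (c2 j)"
    and no_crit3: "\<And>i j s. i \<in> I \<Longrightarrow> j \<in> I \<Longrightarrow> s \<in> {k1<..<k2} \<Longrightarrow>
      s \<notin> crit3 (a i) (b i) (c0 i) (c1 i) (c2 i) (a j) (b j) (c0 j) (c1 j) (c2 j)"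
begin

definition u :: "'i \<Rightarrow> real \<Rightarrow> real \<Rightarrow> real" where
  "u i s t = curve (a i) (b i) (c0 i) (c1 i) (c2 i) s t"

definition static :: "'i \<Rightarrow> bool" where
  "static i \<longleftrightarrow> c1 i = 0 \<and> c2 i = 0"

text \<open>Identically vanishing functions are dropped: they have sign 0 everywhere, so no point
  could be generic for them.\<close>

definition I' :: "'i set" where
  "I' = {i \<in> I. \<exists>s t. u i s t \<noteq> 0}"

lemma u_static: "static i \<Longrightarrow> u i s t = u i s' t"
  by (simp add: u_def curve_def quad_at_def static_def)

lemma static_if_critical:
  assumes "i \<in> I" "s \<in> {k1<..<k2}" "t \<in> {t1, t2, - b i / (2 * a i)}" "u i s t = 0"
  shows "static i"
  using crit1D[OF no_crit1[OF assms(1,3,2)]] assms(4) by (simp add: u_def static_def)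

text \<open>A function of s alone that vanishes above s vanishes at height \<open>t1\<close> too;
  \<open>crit1\<close> then makes it static and hence identically zero.\<close>

lemma active_nonzero:
  assumes "i \<in> I'" "s \<in> {k1<..<k2}" "u i s t = 0"
  shows "a i \<noteq> 0 \<or> b i \<noteq> 0"
proof (rule ccontr)
  assume ab: "\<not> (a i \<noteq> 0 \<or> b i \<noteq> 0)"
  then have "u i s x = 0" for x
    using assms(3) by (simp add: u_def curve_def quad_at_def)
  then have "static i"
    using assms static_if_critical[of i s t1] by (simp add: I'_def)
  then have "u i s' t' = 0" for s' t'
    using \<open>\<And>x. u i s x = 0\<close> u_static[of i s' t' s] by simp
  with assms(1) show False
    by (auto simp: I'_def)
qed

text \<open>
  Two curves through a common point over \<open>{k1<..<k2}\<close> coincide near that point; the functions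
  \<open>m\<close> and \<open>m'\<close> are their cofactors.
\<close>

lemma common_component:
  assumes i: "i \<in> I'" "u i s t = 0" "\<not> static i" and k: "k \<in> I'" "u k s t = 0" and s: "s \<in> {k1<..<k2}"
  obtains m m' :: "real \<Rightarrow> real \<Rightarrow> real" where
    "\<And>x y. u k x y * m x y = u i x y * m' x y" "m s t \<noteq> 0" "m' s t \<noteq> 0"
    "isCont (\<lambda>z. m (fst z) (snd z)) (s, t)" "isCont (\<lambda>z. m' (fst z) (snd z)) (s, t)"
proof -
  have I: "i \<in> I" "k \<in> I"
    using i k by (auto simp: I'_def)
  have nz: "a i \<noteq> 0 \<or> b i \<noteq> 0" "a k \<noteq> 0 \<or> b k \<noteq> 0"
    using active_nonzero i k s by blast+
  define ci ck where "ci x = quad_at (c2 i) (c1 i) (c0 i) x" and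
    "ck x = quad_at (c2 k) (c1 k) (c0 k) x" for x
  have u_i: "u i x y = a i * y * y + b i * y + ci x" and u_k: "u k x y = a k * y * y + b k * y + ck x"
    for x y
    by (simp_all add: u_def curve_def quad_at_def ci_def ck_def)
  define D where "D = a i * b k - a k * b i"
  define W where "W x = a k * ci x - a i * ck x" for x
  define V where "V x = b k * ci x - b i * ck x" for x
  \<comment> \<open>Eliminating the square or the linear term: at a common zero,
    \<open>W = D * t\<close> and \<open>V = - D * t * t\<close>.\<close>
  have W_eq: "a k * u i x y - a i * u k x y = W x - D * y" for x y
    by (simp add: u_i u_k D_def W_def algebra_simps)
  have V_eq: "b k * u i x y - b i * u k x y = V x + D * y * y" for x y
    by (simp add: u_i u_k D_def V_def algebra_simps)
  have Ws: "W s = D * t" and Vs: "V s = - D * t * t"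
    using W_eq[of s t] V_eq[of s t] i k by simp_all
  show thesis
  proof (cases "D = 0")
    case True
    \<comment> \<open>For proportional (a, b) the differences vanish at the non-critical s, hence
      everywhere, and the two functions are proportional.\<close>
    have "W x = 0" for x
      using crit2D(1)[OF no_crit2[OF I s], of x] Ws True by (simp add: W_def ci_def ck_def)
    moreover have "V x = 0" for x
      using crit2D(2)[OF no_crit2[OF I s], of x] Vs True by (simp add: V_def ci_def ck_def)
    ultimately have eqs: "u k x y * a i = u i x y * a k" "u k x y * b i = u i x y * b k" for x y
      using W_eq[of x y] V_eq[of x y] True by (simp_all add: algebra_simps)
    have D: "a i * b k = a k * b i"
      using True by (simp add: D_def)
    show thesis
    proof (cases "a i = 0")
      case False
      then have "a k \<noteq> 0"
        using D nz by auto
      with False show thesis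
        by (intro that[of "\<lambda>_ _. a i" "\<lambda>_ _. a k"] eqs) simp_all
    next
      case True
      then have "b i \<noteq> 0" "b k \<noteq> 0"
        using D nz by auto
      then show thesis
        by (intro that[of "\<lambda>_ _. b i" "\<lambda>_ _. b k"] eqs) simp_all
    qed
  next
    case False
    \<comment> \<open>\<open>\<tau> x\<close> is the only height at which both curves can meet above
      \<open>x\<close>. By \<open>crit3D\<close> they do meet there for every \<open>x\<close>, so
      \<open>y - \<tau> x\<close> is a common factor and the remaining linear factors are the
      cofactors.\<close>
    define \<tau> where "\<tau> x = W x / D" for x
    have \<tau>s: "\<tau> s = t"
      using Ws False by (simp add: \<tau>_def)
    have on_i: "u i x (\<tau> x) = 0" for x
    proof -
      have "curve (a i) (b i) (c0 i) (c1 i) (c2 i) s (W s / D) = 0"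
        using i(2) \<tau>s by (simp add: u_def \<tau>_def)
      from crit3D[where W = W, OF no_crit3[OF I s] D_def False _ this] show ?thesis
        by (simp add: u_def \<tau>_def W_def ci_def ck_def)
    qed
    have on_k: "u k x (\<tau> x) = 0" for x
    proof -
      have D': "- D = a k * b i - a i * b k"
        by (simp add: D_def)
      have zero: "curve (a k) (b k) (c0 k) (c1 k) (c2 k) s (- W s / - D) = 0"
        using k(2) \<tau>s by (simp add: u_def \<tau>_def)
      have W': "- W x = a i * quad_at (c2 k) (c1 k) (c0 k) x - a k * quad_at (c2 i) (c1 i) (c0 i) x"
        for x
        by (simp add: W_def ci_def ck_def)
      from crit3D[where W = "\<lambda>x. - W x", OF no_crit3[OF I(2,1) s] D' _ W' zero] False
      show ?thesis
        by (simp add: u_def \<tau>_def)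
    qed
    have fac_i: "u i x y = (y - \<tau> x) * (a i * (y + \<tau> x) + b i)" for x y
      using quad_at_factor[of "a i" "b i" "ci x" y "\<tau> x"] on_i[of x]
      by (simp add: u_def curve_def ci_def)
    have fac_k: "u k x y = (y - \<tau> x) * (a k * (y + \<tau> x) + b k)" for x y
      using quad_at_factor[of "a k" "b k" "ck x" y "\<tau> x"] on_k[of x]
      by (simp add: u_def curve_def ck_def)
    \<comment> \<open>A vanishing cofactor would make \<open>t\<close> a double root, that is, the
      apex height of curve \<open>i\<close>, where only static curves may pass.\<close>
    have m_i: "a i * (t + \<tau> s) + b i \<noteq> 0"
    proof
      assume 0: "a i * (t + \<tau> s) + b i = 0"
      with nz(1) \<tau>s have "a i \<noteq> 0"
        by auto
      with 0 \<tau>s have "t = - b i / (2 * a i)"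
        by (simp add: field_simps)
      with static_if_critical[OF I(1) s _ i(2)] i(3) show False
        by simp
    qed
    \<comment> \<open>Curve \<open>k\<close> could be static and touch its apex. Then
      \<open>\<tau>\<close> is constant, so curve \<open>i\<close> contains a horizontal line and
      would be static as well.\<close>
    have m_k: "a k * (t + \<tau> s) + b k \<noteq> 0"
    proof
      assume 0: "a k * (t + \<tau> s) + b k = 0"
      with nz(2) \<tau>s have ak: "a k \<noteq> 0"
        by auto
      with 0 \<tau>s have "t = - b k / (2 * a k)"
        by (simp add: field_simps)
      with static_if_critical[OF I(2) s _ k(2)] have "static k"
        by simp
      have "\<tau> x = t" for x
      proof -
        have "u k s (\<tau> x) = 0"
          using on_k[of x] u_static[OF \<open>static k\<close>, of s "\<tau> x" x] by simp
        then have "(\<tau> x - t) * (a k * (\<tau> x + t) + b k) = 0"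
          using fac_k[of s "\<tau> x"] \<tau>s by simp
        moreover have "a k * (\<tau> x + t) + b k = a k * (\<tau> x - t)"
          using 0 \<tau>s by (simp add: algebra_simps)
        ultimately show ?thesis
          using ak by simp
      qed
      then have "quad_at (c2 i) (c1 i) (a i * t * t + b i * t + c0 i) x = 0" for x
        using on_i[of x] by (simp add: u_i ci_def quad_at_def algebra_simps)
      from quad_at_zero(1,2)[OF this] i(3) show False
        by (simp add: static_def)
    qed
    show thesis
    proof (rule that)
      show "u k x y * (a i * (y + \<tau> x) + b i) = u i x y * (a k * (y + \<tau> x) + b k)" for x y
        by (simp add: fac_i fac_k)
      show "isCont (\<lambda>z. a i * (snd z + \<tau> (fst z)) + b i) (s, t)"
        unfolding \<tau>_def W_def ci_def ck_def quad_at_def divide_inverse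
        by (intro continuous_intros)
      show "isCont (\<lambda>z. a k * (snd z + \<tau> (fst z)) + b k) (s, t)"
        unfolding \<tau>_def W_def ci_def ck_def quad_at_def divide_inverse
        by (intro continuous_intros)
    qed (fact m_i m_k)+
  qed
qed

lemma u_tendsto:
  assumes "x \<longlonglongrightarrow> s" "y \<longlonglongrightarrow> t"
  shows "(\<lambda>n. u i (x n) (y n)) \<longlonglongrightarrow> u i s t"
  unfolding u_def curve_def quad_at_def by (intro tendsto_intros assms)

text \<open>Near the common zero the continuous cofactors keep their nonzero signs, so the signs of
  \<open>u k\<close> and \<open>u i\<close> differ by a constant factor: all functions vanishing at
  the point change sign together.\<close>

lemma common_sign:
  assumes "i \<in> I'" "u i s t = 0" "\<not> static i" "k \<in> I'" "u k s t = 0" "s \<in> {k1<..<k2}"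
  obtains \<epsilon> where "\<And>x y. x \<longlonglongrightarrow> s \<Longrightarrow> y \<longlonglongrightarrow> t \<Longrightarrow>
    \<forall>\<^sub>F n in sequentially. sgn (u k (x n) (y n)) = \<epsilon> * sgn (u i (x n) (y n))"
proof -
  from assms obtain m m' :: "real \<Rightarrow> real \<Rightarrow> real" where
    m: "\<And>x y. u k x y * m x y = u i x y * m' x y" "m s t \<noteq> 0" "m' s t \<noteq> 0"
    and cont: "isCont (\<lambda>z. m (fst z) (snd z)) (s, t)" "isCont (\<lambda>z. m' (fst z) (snd z)) (s, t)"
    by (rule common_component) blast
  show thesis
  proof (rule that)
    fix x y :: "nat \<Rightarrow> real"
    assume "x \<longlonglongrightarrow> s" "y \<longlonglongrightarrow> t"
    then have lim: "(\<lambda>n. (x n, y n)) \<longlonglongrightarrow> (s, t)"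
      by (rule tendsto_Pair)
    have *: "(\<lambda>n. m (x n) (y n) * m s t) \<longlonglongrightarrow> m s t * m s t"
      "(\<lambda>n. m' (x n) (y n) * m' s t) \<longlonglongrightarrow> m' s t * m' s t"
      using isCont_tendsto_compose[OF cont(1) lim] isCont_tendsto_compose[OF cont(2) lim]
      by (auto intro: tendsto_mult_right)
    have "0 < m s t * m s t" "0 < m' s t * m' s t"
      using m(2,3) by (auto simp: zero_less_mult_iff linorder_neq_iff)
    then have "\<forall>\<^sub>F n in sequentially. 0 < m (x n) (y n) * m s t"
      "\<forall>\<^sub>F n in sequentially. 0 < m' (x n) (y n) * m' s t"
      using order_tendstoD(1)[OF *(1)] order_tendstoD(1)[OF *(2)] by simp_all
    then show "\<forall>\<^sub>F n in sequentially.
        sgn (u k (x n) (y n)) = sgn (m s t * m' s t) * sgn (u i (x n) (y n))"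
    proof eventually_elim
      case (elim n)
      then have "sgn (m (x n) (y n)) = sgn (m s t)" "sgn (m' (x n) (y n)) = sgn (m' s t)"
        by (auto simp: zero_less_mult_iff)
      with m(1)[of "x n" "y n"]
      have "sgn (u k (x n) (y n)) * sgn (m s t) = sgn (u i (x n) (y n)) * sgn (m' s t)"
        by (metis sgn_mult)
      then have "sgn (u k (x n) (y n)) * (sgn (m s t) * sgn (m s t)) =
          sgn (u i (x n) (y n)) * sgn (m' s t) * sgn (m s t)"
        by (metis mult.assoc)
      moreover have "sgn (m s t) * sgn (m s t) = 1"
        using m(2) by (simp add: sgn_if)
      ultimately show ?case
        by (simp add: sgn_mult ac_simps)
    qed
  qed
qed

text \<open>If all functions vanishing at the limit point are static, the heights \<open>y n\<close>
  serve above \<open>s\<close> directly. Otherwise a non-static one has nonzero slope there, so a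
  small vertical step gives it the sign of \<open>\<sigma>\<close>, and \<open>common_sign\<close>
  carries the other vanishing functions along.\<close>

lemma sign_cell_limit:
  assumes s: "s \<in> {k1<..<k2}" and lim: "x \<longlonglongrightarrow> s" "y \<longlonglongrightarrow> t"
    and y: "\<And>n. y n \<in> {t1<..<t2}" and t: "t \<in> {t1..t2}"
    and pos: "\<And>n i. i \<in> I' \<Longrightarrow> 0 < \<sigma> i * u i (x n) (y n)"
  shows "\<exists>t'\<in>{t1<..<t2}. \<forall>i\<in>I'. 0 < \<sigma> i * u i s t'"
proof -
  define Z where "Z = {i \<in> I'. u i s t = 0}"
  have fin: "finite I'" "finite Z"
    using finite_I by (simp_all add: I'_def Z_def)
  have \<sigma>: "\<sigma> i \<noteq> 0" if "i \<in> I'" for i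
    using pos[OF that, of 0] by auto
  have inactive: "\<forall>\<^sub>F n in sequentially. 0 < \<sigma> i * u i s (y' n)"
    if "i \<in> I' - Z" "y' \<longlonglongrightarrow> t" for i y'
  proof -
    have "(\<lambda>n. \<sigma> i * u i (x n) (y n)) \<longlonglongrightarrow> \<sigma> i * u i s t"
      by (intro tendsto_intros u_tendsto lim)
    then have "0 \<le> \<sigma> i * u i s t"
      using pos[of i] that(1) by (intro LIMSEQ_le_const) (auto intro: less_imp_le)
    moreover have "\<sigma> i * u i s t \<noteq> 0"
      using that(1) \<sigma> by (auto simp: Z_def)
    ultimately have "0 < \<sigma> i * u i s t"
      by (metis order_less_le)
    moreover have "(\<lambda>n. \<sigma> i * u i s (y' n)) \<longlonglongrightarrow> \<sigma> i * u i s t"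
      by (intro tendsto_intros u_tendsto that)
    ultimately show ?thesis
      by (intro order_tendstoD(1))
  qed
  have finish: ?thesis
    if y': "y' \<longlonglongrightarrow> t" "\<forall>\<^sub>F n in sequentially. y' n \<in> {t1<..<t2}"
      "\<And>i. i \<in> Z \<Longrightarrow> \<forall>\<^sub>F n in sequentially. 0 < \<sigma> i * u i s (y' n)" for y'
  proof -
    have "\<forall>i\<in>I'. \<forall>\<^sub>F n in sequentially. 0 < \<sigma> i * u i s (y' n)"
      using y'(3) inactive[OF _ y'(1)] by (meson DiffI)
    then have "\<forall>\<^sub>F n in sequentially. \<forall>i\<in>I'. 0 < \<sigma> i * u i s (y' n)"
      using fin(1) by (simp add: eventually_ball_finite)
    with y'(2) have "\<forall>\<^sub>F n in sequentially. y' n \<in> {t1<..<t2} \<and> (\<forall>i\<in>I'. 0 < \<sigma> i * u i s (y' n))"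
      by (rule eventually_conj)
    then have "\<exists>n. y' n \<in> {t1<..<t2} \<and> (\<forall>i\<in>I'. 0 < \<sigma> i * u i s (y' n))"
      by (rule eventually_happens'[OF sequentially_bot])
    then show ?thesis
      by blast
  qed
  show ?thesis
  proof (cases "\<forall>i\<in>Z. static i")
    case True
    have "0 < \<sigma> i * u i s (y n)" if "i \<in> Z" for i n
      using pos[of i n] that True u_static[of i "x n" "y n" s] by (simp add: Z_def)
    then show ?thesis
      using lim(2) y by (intro finish[of y]) simp_all
  next
    case False
    then obtain i where i: "i \<in> I'" "u i s t = 0" "\<not> static i"
      by (auto simp: Z_def)
    then have "i \<in> I"
      by (simp add: I'_def)
    have not_crit: "t \<notin> {t1, t2, - b i / (2 * a i)}"
      using static_if_critical[OF \<open>i \<in> I\<close> s _ i(2)] i(3) by blast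
    \<comment> \<open>The derivative of \<open>u i s\<close> at \<open>t\<close>; it is nonzero
      because \<open>t\<close> is not the apex height.\<close>
    define r where "r = a i * (t + t) + b i"
    have r: "r \<noteq> 0"
    proof
      assume "r = 0"
      moreover have "a i \<noteq> 0 \<or> b i \<noteq> 0"
        using active_nonzero[OF i(1) s i(2)] .
      ultimately have "a i \<noteq> 0"
        by (auto simp: r_def)
      with \<open>r = 0\<close> have "t = - b i / (2 * a i)"
        by (simp add: r_def field_simps)
      with not_crit show False
        by simp
    qed
    \<comment> \<open>The vertical direction in which \<open>\<sigma> i * u i s\<close>
      increases.\<close>
    define \<theta> where "\<theta> = sgn (\<sigma> i * r)"
    define y' where "y' n = t + \<theta> * inverse (real (Suc n))" for n
    have y'_lim: "y' \<longlonglongrightarrow> t"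
      using tendsto_add[OF tendsto_const tendsto_mult[OF tendsto_const LIMSEQ_inverse_real_of_nat],
          of t \<theta>] by (simp add: y'_def[abs_def])
    have u_y': "\<sigma> i * u i s (y' n) = inverse (real (Suc n)) * (\<theta> * (\<sigma> i * (a i * (y' n + t) + b i)))"
      for n
    proof -
      have "u i s (y' n) - u i s t = (y' n - t) * (a i * (y' n + t) + b i)"
        by (simp add: u_def curve_def quad_at_factor)
      then show ?thesis
        using i(2) by (simp add: y'_def)
    qed
    have "(\<lambda>n. \<theta> * (\<sigma> i * (a i * (y' n + t) + b i))) \<longlonglongrightarrow> \<theta> * (\<sigma> i * r)"
      unfolding r_def by (intro tendsto_intros y'_lim)
    moreover have "\<theta> * (\<sigma> i * r) = \<bar>\<sigma> i * r\<bar>"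
      by (simp only: \<theta>_def abs_sgn mult.commute)
    then have "0 < \<theta> * (\<sigma> i * r)"
      using r \<sigma>[OF i(1)] by simp
    ultimately have "\<forall>\<^sub>F n in sequentially. 0 < \<theta> * (\<sigma> i * (a i * (y' n + t) + b i))"
      by (rule order_tendstoD(1))
    then have y'_i: "\<forall>\<^sub>F n in sequentially. 0 < \<sigma> i * u i s (y' n)"
      by eventually_elim (simp add: u_y' zero_less_mult_iff)
    have sgn_eq: "sgn (v :: real) = sgn r" if "0 < r * v" for r v
      using that by (auto simp: zero_less_mult_iff)
    show ?thesis
    proof (rule finish[OF y'_lim])
      have "t1 < t" "t < t2"
        using t not_crit by auto
      then show "\<forall>\<^sub>F n in sequentially. y' n \<in> {t1<..<t2}"
        using order_tendstoD[OF y'_lim] by (auto intro: eventually_conj)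
    next
      fix k
      assume "k \<in> Z"
      then have k: "k \<in> I'" "u k s t = 0"
        by (simp_all add: Z_def)
      obtain \<epsilon> where \<epsilon>: "\<And>x y. x \<longlonglongrightarrow> s \<Longrightarrow> y \<longlonglongrightarrow> t \<Longrightarrow>
          \<forall>\<^sub>F n in sequentially. sgn (u k (x n) (y n)) = \<epsilon> * sgn (u i (x n) (y n))"
        by (rule common_sign[OF i k s]) blast
      \<comment> \<open>One late member of the given sequence suffices to read off how the
        prescribed signs of \<open>k\<close> and \<open>i\<close> are related.\<close>
      have "\<exists>n. sgn (u k (x n) (y n)) = \<epsilon> * sgn (u i (x n) (y n))"
        by (rule eventually_happens'[OF sequentially_bot \<epsilon>[OF lim]])
      then have *: "sgn (\<sigma> k) = \<epsilon> * sgn (\<sigma> i)"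
        using sgn_eq[OF pos[OF k(1)]] sgn_eq[OF pos[OF i(1)]] by auto
      show "\<forall>\<^sub>F n in sequentially. 0 < \<sigma> k * u k s (y' n)"
        using \<epsilon>[OF tendsto_const y'_lim] y'_i
      proof eventually_elim
        case (elim n)
        then have "sgn (u k s (y' n)) = sgn (\<sigma> k)"
          using * sgn_eq[OF elim(2)] by simp
        then have "sgn (\<sigma> k * u k s (y' n)) = 1"
          using \<sigma>[OF k(1)] by (simp add: sgn_mult)
        then show ?case
          by (simp add: sgn_1_pos)
      qed
    qed
  qed
qed

text \<open>The positions above which a given sign pattern occurs form an open set, and by
  \<open>sign_cell_limit\<close> a relatively closed one; an open interval is connected, so the
  pattern occurs above all of it.\<close>

lemma sign_cells:
  assumes s: "s \<in> {k1<..<k2}" "s' \<in> {k1<..<k2}" and t: "t \<in> {t1<..<t2}"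
    and generic: "\<And>i. i \<in> I' \<Longrightarrow> u i s t \<noteq> 0"
  shows "\<exists>t'\<in>{t1<..<t2}. \<forall>i\<in>I'. 0 < u i s t * u i s' t'"
proof -
  define \<sigma> where "\<sigma> i = u i s t" for i
  define A where "A = {x \<in> {k1<..<k2}. \<exists>y\<in>{t1<..<t2}. \<forall>i\<in>I'. 0 < \<sigma> i * u i x y}"
  have fin: "finite I'"
    using finite_I by (simp add: I'_def)
  have "open A"
  proof -
    have "A = (\<Union>y\<in>{t1<..<t2}. {k1<..<k2} \<inter> (\<Inter>i\<in>I'. {x. 0 < \<sigma> i * u i x y}))"
      by (auto simp: A_def)
    moreover have "open {x. 0 < \<sigma> i * u i x y}" for i y
      unfolding u_def curve_def quad_at_def by (intro open_Collect_less continuous_intros)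
    ultimately show ?thesis
      using fin by (auto intro!: open_UN open_Int open_INT)
  qed
  then have "openin (top_of_set {k1<..<k2}) A"
    by (intro open_subset) (auto simp: A_def)
  moreover have "l \<in> A" if l: "l \<in> {k1<..<k2}" "l \<in> closure A" for l
  proof -
    obtain x where x: "\<And>n. x n \<in> A" "x \<longlonglongrightarrow> l"
      using l(2) unfolding closure_sequential by blast
    then have "\<forall>n. \<exists>y\<in>{t1<..<t2}. \<forall>i\<in>I'. 0 < \<sigma> i * u i (x n) y"
      using x(1) by (simp add: A_def)
    then obtain y where y: "\<And>n. y n \<in> {t1<..<t2}" "\<And>n i. i \<in> I' \<Longrightarrow> 0 < \<sigma> i * u i (x n) (y n)"
      by metis
    have "\<forall>n. y n \<in> {t1..t2}"
      using y(1) by (simp add: less_imp_le)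
    \<comment> \<open>The realising heights need not converge; compactness gives a convergent
      subsequence whose limit may be an end of the interval.\<close>
    then obtain r l' where r: "l' \<in> {t1..t2}" "strict_mono r" "(y \<circ> r) \<longlonglongrightarrow> l'"
      using compact_Icc[of t1 t2, unfolded compact_eq_seq_compact_metric] unfolding seq_compact_def
      by blast
    have "(x \<circ> r) \<longlonglongrightarrow> l"
      using x(2) r(2) by (rule LIMSEQ_subseq_LIMSEQ)
    then have "\<exists>t'\<in>{t1<..<t2}. \<forall>i\<in>I'. 0 < \<sigma> i * u i l t'"
      using l r y by (intro sign_cell_limit[where x = "x \<circ> r" and y = "y \<circ> r"]) auto
    with l show ?thesis
      by (simp add: A_def)
  qed
  then have "A = {k1<..<k2} \<inter> closure A"
    using closure_subset[of A] by (auto simp: A_def[symmetric]) (auto simp: A_def)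
  then have "closedin (top_of_set {k1<..<k2}) A"
    using closedin_closed_Int[OF closed_closure] by metis
  moreover have "s \<in> A"
  proof -
    have "0 < \<sigma> i * u i s t" if "i \<in> I'" for i
      using generic[OF that] by (simp add: \<sigma>_def flip: power2_eq_square)
    with s(1) t show ?thesis
      unfolding A_def by blast
  qed
  ultimately have "A = {k1<..<k2}"
    using connected_Ioo[of k1 k2] unfolding connected_clopen by blast
  with s(2) have "s' \<in> A"
    by simp
  then show ?thesis
    unfolding A_def \<sigma>_def by blast
qed

lemma nonzero_on_line:
  assumes "i \<in> I'" "s \<in> {k1<..<k2}"
  shows "\<exists>t. u i s t \<noteq> 0"
proof (rule ccontr)
  assume "\<not> (\<exists>t. u i s t \<noteq> 0)"
  then have "u i s t = 0" for t
    by blast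
  then have "a i = 0" "b i = 0"
    using quad_at_zero(1,2)[of "a i" "b i"] by (auto simp: u_def curve_def)
  with active_nonzero[OF assms] \<open>\<And>t. u i s t = 0\<close> show False
    by blast
qed

end


section \<open>Best responses\<close>

text \<open>For \<open>l \<le> r\<close>, the maximum of \<open>w * z\<close> over
  \<open>l \<le> w \<le> r\<close>: the effect of the worst demand at one end of an edge.\<close>

definition hinge :: "real \<Rightarrow> real \<Rightarrow> real \<Rightarrow> real" where
  "hinge l r z = max (l * z) (r * z)"

definition hinge_sum ::
  "'i set \<Rightarrow> ('i \<Rightarrow> real) \<Rightarrow> ('i \<Rightarrow> real) \<Rightarrow> ('i \<Rightarrow> real) \<Rightarrow> real" where
  "hinge_sum I l r z = (\<Sum>i\<in>I. hinge (l i) (r i) (z i))"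

lemma hinge_ge: "l * z \<le> hinge l r z" "r * z \<le> hinge l r z"
  by (simp_all add: hinge_def)

lemma hinge_pos: "l \<le> r \<Longrightarrow> 0 \<le> z \<Longrightarrow> hinge l r z = r * z"
  by (simp add: hinge_def max_def mult_right_mono antisym)

lemma hinge_neg: "l \<le> r \<Longrightarrow> z \<le> 0 \<Longrightarrow> hinge l r z = l * z"
  by (simp add: hinge_def max_def mult_right_mono_neg antisym)

lemma quad_at_cont: "continuous_on A (quad_at a b c)"
  unfolding quad_at_def by (intro continuous_intros)

lemma quad_root_in_roots:
  assumes "quad_at a b c x \<noteq> 0" "quad_at a b c t = 0"
  shows "t \<in> roots c b a 0 0"
proof (rule roots_complete)
  show "c + b * t + a * t\<^sup>2 + 0 * t ^ 3 + 0 * t ^ 4 = 0"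
    using assms(2) by (simp add: quad_at_def power2_eq_square algebra_simps)
  show "\<not> (c = 0 \<and> b = 0 \<and> a = 0 \<and> 0 = (0::real) \<and> 0 = (0::real))"
    using assms(1) by (auto simp: quad_at_def)
qed

lemma finite_quad_roots:
  assumes "quad_at a b c x \<noteq> 0"
  shows "finite {t. quad_at a b c t = 0}"
  by (rule finite_subset[OF _ finite_roots]) (use quad_root_in_roots[OF assms] in blast)

lemma sign_between_roots:
  fixes f :: "real \<Rightarrow> real"
  assumes cont: "continuous_on {\<alpha>..\<beta>} f" and nz: "\<And>x. x \<in> {\<alpha><..<\<beta>} \<Longrightarrow> f x \<noteq> 0"
    and y: "\<alpha> \<le> y" "y < \<beta>" "0 < f y" and t: "t \<in> {\<alpha>..\<beta>}"
  shows "0 \<le> f t"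
proof (rule ccontr)
  assume "\<not> 0 \<le> f t"
  then have neg: "f t < 0"
    by simp
  consider "t < y" | "y < t"
    using neg y(3) by (cases t y rule: linorder_cases) auto
  then show False
  proof cases
    case 1
    have "continuous_on {t..y} f"
      using cont by (rule continuous_on_subset) (use t y in auto)
    then obtain x where x: "t \<le> x" "x \<le> y" "f x = 0"
      using IVT'[of f t 0 y] 1 neg y(3) by auto
    moreover have "x \<noteq> t" "x \<noteq> y"
      using x(3) neg y(3) by auto
    ultimately show False
      using nz[of x] t y by auto
  next
    case 2
    have "continuous_on {y..t} f"
      using cont by (rule continuous_on_subset) (use t y in auto)
    then obtain x where x: "y \<le> x" "x \<le> t" "f x = 0"
      using IVT2'[of f t 0 y] 2 neg y(3) by auto
    moreover have "x \<noteq> t" "x \<noteq> y"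
      using x(3) neg y(3) by auto
    ultimately show False
      using nz[of x] t y by auto
  qed
qed

text \<open>A quadratic without zeros inside the interval keeps there the sign it has at
  \<open>y\<close>, so one branch of the hinge applies throughout. The conditional assumptions admit
  the zero quadratic, for which both sides are 0.\<close>

lemma hinge_between_roots:
  fixes a b c :: real
  assumes nz: "\<And>x t. x \<in> {\<alpha><..<\<beta>} \<Longrightarrow> quad_at a b c t \<noteq> 0 \<Longrightarrow> quad_at a b c x \<noteq> 0"
    and y: "\<alpha> \<le> y" "y < \<beta>" "\<And>t. quad_at a b c t \<noteq> 0 \<Longrightarrow> quad_at a b c y \<noteq> 0"
    and t: "t \<in> {\<alpha>..\<beta>}" and lr: "l \<le> r"
  shows "hinge l r (quad_at a b c t) = (if 0 < quad_at a b c y then r else l) * quad_at a b c t"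
proof (cases "quad_at a b c y" "0::real" rule: linorder_cases)
  case less
  have "0 \<le> - quad_at a b c t"
    using quad_at_cont nz[of _ y] less y(1,2) t
    by (intro sign_between_roots[of \<alpha> \<beta> "\<lambda>t. - quad_at a b c t" y t] continuous_intros) auto
  then show ?thesis
    using less lr by (simp add: hinge_neg)
next
  case equal
  then have "quad_at a b c t = 0"
    using y(3) by blast
  then show ?thesis
    by (simp add: hinge_def)
next
  case greater
  have "0 \<le> quad_at a b c t"
    using quad_at_cont nz[of _ y] greater y(1,2) t
    by (intro sign_between_roots[of \<alpha> \<beta> "quad_at a b c" y t]) auto
  then show ?thesis
    using greater lr by (simp add: hinge_pos)
qed

lemma sum_quad_at:
  "(\<Sum>i\<in>I. \<kappa> i * quad_at (a i) (b i) (c i) t) =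
    quad_at (\<Sum>i\<in>I. \<kappa> i * a i) (\<Sum>i\<in>I. \<kappa> i * b i) (\<Sum>i\<in>I. \<kappa> i * c i) t"
  by (simp add: quad_at_def sum_distrib_right sum.distrib distrib_left mult.assoc)

lemma quad_at_local_max:
  assumes "x \<in> {t1<..<t2}" "\<And>t. t \<in> {t1<..<t2} \<Longrightarrow> quad_at a b c t \<le> quad_at a b c x"
  shows "2 * a * x + b = 0"
proof -
  have deriv: "(quad_at a b c has_real_derivative 2 * a * x + b) (at x)"
    unfolding quad_at_def[abs_def] by (auto intro!: derivative_eq_intros)
  show ?thesis
  proof (rule DERIV_local_max[OF deriv])
    show "0 < min (x - t1) (t2 - x)"
      using assms(1) by simp
    show "\<forall>y. \<bar>x - y\<bar> < min (x - t1) (t2 - x) \<longrightarrow> quad_at a b c y \<le> quad_at a b c x"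
    proof (intro allI impI)
      fix y
      assume "\<bar>x - y\<bar> < min (x - t1) (t2 - x)"
      then have "\<bar>x - y\<bar> < x - t1" "\<bar>x - y\<bar> < t2 - x"
        by simp_all
      then have "y \<in> {t1<..<t2}"
        by (simp add: abs_less_iff)
      then show "quad_at a b c y \<le> quad_at a b c x"
        by (rule assms(2))
    qed
  qed
qed

text \<open>
  The largest maximiser is the vertex of the quadratic that the sum of hinges equals immediately to
  the right of it: this quadratic bounds the sum from below, so that it has a local maximum there.
\<close>

lemma hinge_sum_maximiser:
  fixes I :: "'i set" and a b c l r :: "'i \<Rightarrow> real"
  defines "G \<equiv> \<lambda>t. hinge_sum I l r (\<lambda>i. quad_at (a i) (b i) (c i) t)"
  assumes I: "finite I" and lr: "\<And>i. i \<in> I \<Longrightarrow> l i \<le> r i" and "t1 < t2"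
  obtains x where "x \<in> {t1..t2}" "\<forall>t\<in>{t1..t2}. G t \<le> G x"
      "x = t1 \<or> x = t2 \<or> (\<exists>y\<in>{t1<..<t2}.
        (\<forall>i\<in>I. (\<exists>t. quad_at (a i) (b i) (c i) t \<noteq> 0) \<longrightarrow> quad_at (a i) (b i) (c i) y \<noteq> 0) \<and>
        (\<Sum>i\<in>I. (if 0 < quad_at (a i) (b i) (c i) y then r i else l i) * a i) \<noteq> 0 \<and>
        x = - (\<Sum>i\<in>I. (if 0 < quad_at (a i) (b i) (c i) y then r i else l i) * b i) /
          (2 * (\<Sum>i\<in>I. (if 0 < quad_at (a i) (b i) (c i) y then r i else l i) * a i)))"
proof -
  let ?v = "\<lambda>i. quad_at (a i) (b i) (c i)"
  have cont: "continuous_on A G" for A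
    unfolding G_def hinge_sum_def hinge_def
    by (intro continuous_intros continuous_on_max quad_at_cont)
  obtain x0 where x0: "x0 \<in> {t1..t2}" "\<And>t. t \<in> {t1..t2} \<Longrightarrow> G t \<le> G x0"
    using continuous_attains_sup[OF compact_Icc _ cont, of t1 t2] \<open>t1 < t2\<close> by auto
  define M where "M = {t1..t2} \<inter> {t. G x0 \<le> G t}"
  have "closed {t. G x0 \<le> G t}"
    by (intro closed_Collect_le continuous_on_const cont)
  then have "compact M"
    unfolding M_def by (intro compact_Int_closed compact_Icc)
  moreover have "x0 \<in> M"
    using x0 by (simp add: M_def)
  ultimately obtain x where x: "x \<in> M" "\<And>t. t \<in> M \<Longrightarrow> t \<le> x"
    using compact_attains_sup[of M] by auto
  have x_max: "G t \<le> G x" if "t \<in> {t1..t2}" for t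
    using x0(2)[OF that] x(1) by (simp add: M_def)
  have x_largest: "G t < G x" if "x < t" "t \<in> {t1..t2}" for t
  proof -
    have "t \<notin> M"
      using x(2)[of t] that(1) by auto
    then show ?thesis
      using that x(1) by (auto simp: M_def)
  qed
  show thesis
  proof (rule that)
    show x_in: "x \<in> {t1..t2}"
      using x(1) by (simp add: M_def)
    show "\<forall>t\<in>{t1..t2}. G t \<le> G x"
      using x_max by blast
    show "x = t1 \<or> x = t2 \<or> (\<exists>y\<in>{t1<..<t2}.
        (\<forall>i\<in>I. (\<exists>t. quad_at (a i) (b i) (c i) t \<noteq> 0) \<longrightarrow> quad_at (a i) (b i) (c i) y \<noteq> 0) \<and>
        (\<Sum>i\<in>I. (if 0 < quad_at (a i) (b i) (c i) y then r i else l i) * a i) \<noteq> 0 \<and>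
        x = - (\<Sum>i\<in>I. (if 0 < quad_at (a i) (b i) (c i) y then r i else l i) * b i) /
          (2 * (\<Sum>i\<in>I. (if 0 < quad_at (a i) (b i) (c i) y then r i else l i) * a i)))"
    proof (cases "x = t1 \<or> x = t2")
      case False
      with x_in have x': "x \<in> {t1<..<t2}"
        by auto
      define R where "R = (\<Union>i\<in>{i \<in> I. \<exists>t. ?v i t \<noteq> 0}. {t. ?v i t = 0})"
      have "finite R"
        unfolding R_def using I finite_quad_roots by (intro finite_UN_I) auto
      \<comment> \<open>The first zero to the right of \<open>x\<close>, or \<open>t2\<close>. No
        sign changes up to \<open>e\<close>, so the point \<open>y\<close> below records the signs
        immediately to the right of \<open>x\<close>.\<close>
      define e where "e = Min (insert t2 {z \<in> R. x < z})"
      have fin: "finite (insert t2 {z \<in> R. x < z})"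
        using \<open>finite R\<close> by simp
      have e: "x < e" "e \<le> t2"
        using Min_in[OF fin] Min_le[OF fin] x' by (auto simp: e_def)
      have no_root: "z \<notin> R" if "z \<in> {x<..<e}" for z
        using Min_le[OF fin, of z] that by (auto simp: e_def)
      define y where "y = (x + e) / 2"
      have y: "y \<in> {x<..<e}"
        using e(1) by (simp add: y_def)
      let ?\<kappa> = "\<lambda>i. if 0 < ?v i y then r i else l i"
      let ?A = "\<Sum>i\<in>I. ?\<kappa> i * a i" and ?B = "\<Sum>i\<in>I. ?\<kappa> i * b i" and ?C = "\<Sum>i\<in>I. ?\<kappa> i * c i"
      have ge: "quad_at ?A ?B ?C t \<le> G t" for t
        unfolding G_def hinge_sum_def sum_quad_at[symmetric]
        by (intro sum_mono) (auto simp: hinge_ge)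
      have eq: "G t = quad_at ?A ?B ?C t" if t: "t \<in> {x..e}" for t
        unfolding G_def hinge_sum_def sum_quad_at[symmetric]
      proof (rule sum.cong)
        fix i
        assume "i \<in> I"
        then have "?v i z \<noteq> 0" if "z \<in> {x<..<e}" "?v i t \<noteq> 0" for z t
          using no_root[OF that(1)] that(2) by (auto simp: R_def)
        then show "hinge (l i) (r i) (?v i t) = ?\<kappa> i * ?v i t"
          using y t lr[OF \<open>i \<in> I\<close>] by (intro hinge_between_roots[of x e]) auto
      qed simp
      have "2 * ?A * x + ?B = 0"
      proof (rule quad_at_local_max[OF x'])
        fix t
        assume "t \<in> {t1<..<t2}"
        then have "quad_at ?A ?B ?C t \<le> G x"
          using ge[of t] x_max[of t] by auto
        then show "quad_at ?A ?B ?C t \<le> quad_at ?A ?B ?C x"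
          using eq[of x] e by simp
      qed
      \<comment> \<open>Otherwise the sum would be constant up to \<open>e\<close>, and
        \<open>e\<close> would be a larger maximiser.\<close>
      moreover have "?A \<noteq> 0"
      proof
        assume "?A = 0"
        with \<open>2 * ?A * x + ?B = 0\<close> have "?B = 0"
          by simp
        have "G e = G x"
          using eq[of e] eq[of x] e(1) unfolding \<open>?A = 0\<close> \<open>?B = 0\<close> by (simp add: quad_at_def)
        then show False
          using x_largest[of e] e x' by simp
      qed
      ultimately have "x = - ?B / (2 * ?A)"
        by (simp add: field_simps)
      moreover have "\<forall>i\<in>I. (\<exists>t. ?v i t \<noteq> 0) \<longrightarrow> ?v i y \<noteq> 0"
        using no_root[OF y] by (auto simp: R_def)
      moreover have "y \<in> {t1<..<t2}"
        using y e x' by auto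
      ultimately show ?thesis
        using \<open>?A \<noteq> 0\<close> by blast
    qed blast
  qed
qed

section \<open>Finite sets of possible best responses\<close>

definition vertex :: "(real \<Rightarrow> real) \<Rightarrow> real \<Rightarrow> real \<Rightarrow> real" where
  "vertex f u v = - quad1 f u v / (2 * quad2 f u v)"

text \<open>Between the neighbours of \<open>y\<close> among the zeros the hinge sum is the
  quadratic selected by the signs at \<open>y\<close>, so interpolation there yields its vertex
  without inspecting any sign.\<close>

lemma vertex_of_hinge_sum:
  fixes I :: "'i set" and a b c l r :: "'i \<Rightarrow> real"
  assumes G: "\<And>t. t \<in> {t1..t2} \<Longrightarrow> G t = hinge_sum I l r (\<lambda>i. quad_at (a i) (b i) (c i) t)"
    and T: "finite T" "t1 \<in> T" "t2 \<in> T"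
    and roots: "\<And>i z t. i \<in> I \<Longrightarrow> quad_at (a i) (b i) (c i) t \<noteq> 0 \<Longrightarrow>
      quad_at (a i) (b i) (c i) z = 0 \<Longrightarrow> z \<in> T"
    and y: "y \<in> {t1<..<t2}" "\<And>i t. i \<in> I \<Longrightarrow> quad_at (a i) (b i) (c i) t \<noteq> 0 \<Longrightarrow>
      quad_at (a i) (b i) (c i) y \<noteq> 0"
    and lr: "\<And>i. i \<in> I \<Longrightarrow> l i \<le> r i"
  shows "\<exists>\<tau>\<in>T. \<exists>\<tau>'\<in>T. vertex G \<tau> \<tau>' =
    - (\<Sum>i\<in>I. (if 0 < quad_at (a i) (b i) (c i) y then r i else l i) * b i) /
      (2 * (\<Sum>i\<in>I. (if 0 < quad_at (a i) (b i) (c i) y then r i else l i) * a i))"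
proof -
  let ?v = "\<lambda>i. quad_at (a i) (b i) (c i)"
  let ?\<kappa> = "\<lambda>i. if 0 < ?v i y then r i else l i"
  have "t1 \<le> y" "y < t2"
    using y(1) by simp_all
  from consecutive_elements[OF T this] obtain \<tau> \<tau>' where \<tau>: "\<tau> \<in> T" "\<tau>' \<in> T" "\<tau> \<le> y" "y < \<tau>'"
    "{\<tau><..<\<tau>'} \<inter> T = {}" "t1 \<le> \<tau>" "\<tau>' \<le> t2"
    by blast
  have "G t = quad_at (\<Sum>i\<in>I. ?\<kappa> i * a i) (\<Sum>i\<in>I. ?\<kappa> i * b i) (\<Sum>i\<in>I. ?\<kappa> i * c i) t"
    if t: "t \<in> {\<tau>..\<tau>'}" for t
  proof -
    have "hinge (l i) (r i) (?v i t) = ?\<kappa> i * ?v i t" if i: "i \<in> I" for i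
    proof -
      have "?v i z \<noteq> 0" if "z \<in> {\<tau><..<\<tau>'}" "?v i t \<noteq> 0" for z t
        using roots[OF i that(2), of z] that(1) \<tau>(5) by auto
      then show ?thesis
        using y(2)[OF i] t \<tau>(3,4) lr[OF i] by (intro hinge_between_roots[of \<tau> \<tau>']) auto
    qed
    moreover have "G t = hinge_sum I l r (\<lambda>i. ?v i t)"
      using t \<tau>(6,7) by (intro G) simp
    ultimately show ?thesis
      unfolding sum_quad_at[symmetric] hinge_sum_def by simp
  qed
  then have "vertex G \<tau> \<tau>' = - (\<Sum>i\<in>I. ?\<kappa> i * b i) / (2 * (\<Sum>i\<in>I. ?\<kappa> i * a i))"
    unfolding vertex_def using quad_coeffs(1,2)[of \<tau> \<tau>'] \<tau>(3,4) by simp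
  with \<tau>(1,2) show ?thesis
    by blast
qed

text \<open>Curve \<open>i\<close> is \<open>q i t - p i s = 0\<close> in one rectangle, in
  interpolated coefficients: \<open>p i\<close> contributes only to the constant term of the
  quadratic in \<open>t\<close>.\<close>

definition crits ::
  "'i set \<Rightarrow> ('i \<Rightarrow> real \<Rightarrow> real) \<Rightarrow> ('i \<Rightarrow> real \<Rightarrow> real) \<Rightarrow> real \<Rightarrow> real \<Rightarrow> real \<Rightarrow> real \<Rightarrow> real set" where
  "crits I p q s1 s2 t1 t2 =
    (\<Union>i\<in>I. \<Union>t\<in>{t1, t2, vertex (q i) t1 t2}.
      crit1 (quad2 (q i) t1 t2) (quad1 (q i) t1 t2) (quad0 (q i) t1 t2 - quad0 (p i) s1 s2)
        (- quad1 (p i) s1 s2) (- quad2 (p i) s1 s2) t) \<union>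
    (\<Union>i\<in>I. \<Union>j\<in>I.
      crit2 (quad2 (q i) t1 t2) (quad1 (q i) t1 t2) (quad0 (q i) t1 t2 - quad0 (p i) s1 s2)
        (- quad1 (p i) s1 s2) (- quad2 (p i) s1 s2)
        (quad2 (q j) t1 t2) (quad1 (q j) t1 t2) (quad0 (q j) t1 t2 - quad0 (p j) s1 s2)
        (- quad1 (p j) s1 s2) (- quad2 (p j) s1 s2) \<union>
      crit3 (quad2 (q i) t1 t2) (quad1 (q i) t1 t2) (quad0 (q i) t1 t2 - quad0 (p i) s1 s2)
        (- quad1 (p i) s1 s2) (- quad2 (p i) s1 s2)
        (quad2 (q j) t1 t2) (quad1 (q j) t1 t2) (quad0 (q j) t1 t2 - quad0 (p j) s1 s2)
        (- quad1 (p j) s1 s2) (- quad2 (p j) s1 s2))"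

text \<open>All pairs are taken, so that neighbouring positions need not be identified by
  sorting.\<close>

definition midpoints :: "real set \<Rightarrow> real set" where
  "midpoints C = (\<Union>c\<in>C. \<Union>c'\<in>C. {(c + c') / 2})"

text \<open>An intersection with \<open>{0..1}\<close>, written as a union of conditional singletons
  because this is the shape for which \<open>set_comp_UN\<close> and \<open>set_comp_if_le\<close>
  give computability.\<close>

definition unit_part :: "real set \<Rightarrow> real set" where
  "unit_part C = (\<Union>c\<in>C. if 0 \<le> c then if c \<le> 1 then {c} else {} else {})"

definition vertices :: "(real \<Rightarrow> real) \<Rightarrow> real set \<Rightarrow> real set" where
  "vertices f T = (\<Union>u\<in>T. \<Union>v\<in>T. {vertex f u v})"

text \<open>The heights at which the vertical line above \<open>s\<close> meets the curves, that is,
  the breakpoints in \<open>t\<close> of the hinge sum.\<close>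

definition line_roots ::
  "'i set \<Rightarrow> ('i \<Rightarrow> real \<Rightarrow> real) \<Rightarrow> ('i \<Rightarrow> real \<Rightarrow> real) \<Rightarrow> real \<Rightarrow> real \<Rightarrow> real \<Rightarrow> real set" where
  "line_roots I p q s t1 t2 =
    (\<Union>i\<in>I. roots (quad0 (q i) t1 t2 - p i s) (quad1 (q i) t1 t2) (quad2 (q i) t1 t2) 0 0)"

definition cell_vertices ::
  "'i set \<Rightarrow> ('i \<Rightarrow> real) \<Rightarrow> ('i \<Rightarrow> real) \<Rightarrow> ('i \<Rightarrow> real \<Rightarrow> real) \<Rightarrow> ('i \<Rightarrow> real \<Rightarrow> real) \<Rightarrow>
    real \<Rightarrow> real \<Rightarrow> real \<Rightarrow> real \<Rightarrow> real set" where
  "cell_vertices I l r p q s1 s2 t1 t2 =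
    (\<Union>s0\<in>midpoints (insert s1 (insert s2 (crits I p q s1 s2 t1 t2))).
      vertices (\<lambda>t. hinge_sum I l r (\<lambda>i. q i t - p i s0))
        (insert t1 (insert t2 (line_roots I p q s0 t1 t2))))"

definition best_responses ::
  "'i set \<Rightarrow> ('i \<Rightarrow> real) \<Rightarrow> ('i \<Rightarrow> real) \<Rightarrow> ('i \<Rightarrow> real \<Rightarrow> real) \<Rightarrow> ('i \<Rightarrow> real \<Rightarrow> real) \<Rightarrow>
    real set \<Rightarrow> real set \<Rightarrow> real set" where
  "best_responses I l r p q S T = T \<union>
    unit_part (\<Union>s1\<in>S. \<Union>s2\<in>S. \<Union>t1\<in>T. \<Union>t2\<in>T. cell_vertices I l r p q s1 s2 t1 t2)"

lemma unit_part_iff: "c \<in> unit_part C \<longleftrightarrow> c \<in> C \<and> 0 \<le> c \<and> c \<le> 1"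
  by (auto simp: unit_part_def split: if_splits)

lemma finite_crits: "finite I \<Longrightarrow> finite (crits I p q s1 s2 t1 t2)"
  unfolding crits_def by simp

lemma finite_unit_part: "finite C \<Longrightarrow> finite (unit_part C)"
  by (rule finite_subset[of _ C]) (auto simp: unit_part_iff)

lemma finite_cell_vertices: "finite I \<Longrightarrow> finite (cell_vertices I l r p q s1 s2 t1 t2)"
  unfolding cell_vertices_def midpoints_def vertices_def line_roots_def
  by (intro finite_UN_I) (auto simp: finite_crits)

lemma finite_best_responses:
  "finite I \<Longrightarrow> finite S \<Longrightarrow> finite T \<Longrightarrow> finite (best_responses I l r p q S T)"
  unfolding best_responses_def
  by (intro finite_UnI finite_unit_part finite_UN_I finite_cell_vertices)

text \<open>An interior maximiser is the vertex belonging to the sign pattern of some point above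
  \<open>s\<close>. By \<open>sign_cells\<close> the same pattern occurs above the midpoint
  \<open>s0\<close> of the gap around \<open>s\<close>, and it has the same vertex there because
  \<open>a\<close> and \<open>b\<close> do not depend on the position.\<close>

lemma maximiser_in_rectangle:
  fixes I :: "'i set"
  assumes I: "finite I" and lr: "\<And>i. i \<in> I \<Longrightarrow> l i \<le> r i"
    and p: "\<And>i. i \<in> I \<Longrightarrow> quadratic_on s1 s2 (p i)" and q: "\<And>i. i \<in> I \<Longrightarrow> quadratic_on t1 t2 (q i)"
    and s: "s \<in> {s1<..<s2}" "s \<notin> crits I p q s1 s2 t1 t2" and t12: "t1 < t2"
  shows "\<exists>x\<in>{t1..t2}. x \<in> {t1, t2} \<union> cell_vertices I l r p q s1 s2 t1 t2 \<and>
    (\<forall>t\<in>{t1..t2}. hinge_sum I l r (\<lambda>i. q i t - p i s) \<le> hinge_sum I l r (\<lambda>i. q i x - p i s))"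
proof -
  define a b c0 c1 c2 where "a i = quad2 (q i) t1 t2" and "b i = quad1 (q i) t1 t2" and
    "c0 i = quad0 (q i) t1 t2 - quad0 (p i) s1 s2" and "c1 i = - quad1 (p i) s1 s2" and
    "c2 i = - quad2 (p i) s1 s2" for i
  define c where "c x i = quad_at (c2 i) (c1 i) (c0 i) x" for x i
  have p_eq: "p i x = quad_at (quad2 (p i) s1 s2) (quad1 (p i) s1 s2) (quad0 (p i) s1 s2) x"
    if "i \<in> I" "x \<in> {s1..s2}" for i x
    using quad_interpolation[OF p[OF that(1)] _ that(2)] s(1) by simp
  have q_eq: "q i t = quad_at (a i) (b i) (quad0 (q i) t1 t2) t" if "i \<in> I" "t \<in> {t1..t2}" for i t
    using quad_interpolation[OF q[OF that(1)] _ that(2)] t12 by (simp add: a_def b_def)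
  have c_eq: "c x i = quad0 (q i) t1 t2 - p i x" if "i \<in> I" "x \<in> {s1..s2}" for i x
    unfolding p_eq[OF that] by (simp add: c_def c0_def c1_def c2_def quad_at_def algebra_simps)
  have diff_eq: "q i t - p i x = quad_at (a i) (b i) (c x i) t"
    if "i \<in> I" "x \<in> {s1..s2}" "t \<in> {t1..t2}" for i x t
    unfolding q_eq[OF that(1,3)] c_eq[OF that(1,2)] by (simp add: quad_at_def)
  have sum_eq: "hinge_sum I l r (\<lambda>i. q i t - p i x) =
      hinge_sum I l r (\<lambda>i. quad_at (a i) (b i) (c x i) t)" if "x \<in> {s1..s2}" "t \<in> {t1..t2}" for x t
    unfolding hinge_sum_def using diff_eq[OF _ that] by (intro sum.cong) simp_all
  let ?C = "insert s1 (insert s2 (crits I p q s1 s2 t1 t2))"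
  have "finite ?C" "s1 \<in> ?C" "s2 \<in> ?C" "s1 \<le> s" "s < s2"
    using I s(1) by (simp_all add: finite_crits)
  then obtain k1 k2 where k: "k1 \<in> ?C" "k2 \<in> ?C" "k1 \<le> s" "s < k2" "{k1<..<k2} \<inter> ?C = {}"
    "s1 \<le> k1" "k2 \<le> s2"
    by (rule consecutive_elements) blast
  have "k1 \<noteq> s"
    using k(1) s by auto
  with k(3,4) have s_in: "s \<in> {k1<..<k2}"
    by simp
  define s0 where "s0 = (k1 + k2) / 2"
  have s0: "s0 \<in> {k1<..<k2}" "s0 \<in> {s1..s2}" "s0 \<in> midpoints ?C"
    using s_in k(1,2,6,7) by (auto simp: s0_def midpoints_def)
  have not_crit: "x \<notin> crits I p q s1 s2 t1 t2" if "x \<in> {k1<..<k2}" for x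
    using that k(5) by auto
  interpret curves I a b c0 c1 c2 k1 k2 t1 t2
  proof
    show "x \<notin> crit1 (a i) (b i) (c0 i) (c1 i) (c2 i) t"
      if "i \<in> I" "t \<in> {t1, t2, - b i / (2 * a i)}" "x \<in> {k1<..<k2}" for i t x
      using not_crit[OF that(3)] that(1,2)
      unfolding crits_def vertex_def a_def b_def c0_def c1_def c2_def by blast
    show "x \<notin> crit2 (a i) (b i) (c0 i) (c1 i) (c2 i) (a j) (b j) (c0 j) (c1 j) (c2 j)"
      if "i \<in> I" "j \<in> I" "x \<in> {k1<..<k2}" for i j x
      using not_crit[OF that(3)] that(1,2)
      unfolding crits_def a_def b_def c0_def c1_def c2_def by blast
    show "x \<notin> crit3 (a i) (b i) (c0 i) (c1 i) (c2 i) (a j) (b j) (c0 j) (c1 j) (c2 j)"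
      if "i \<in> I" "j \<in> I" "x \<in> {k1<..<k2}" for i j x
      using not_crit[OF that(3)] that(1,2)
      unfolding crits_def a_def b_def c0_def c1_def c2_def by blast
  qed (use I t12 in auto)
  have u_eq: "u i x t = quad_at (a i) (b i) (c x i) t" for i x t
    by (simp add: u_def curve_def c_def)
  have s': "s \<in> {s1..s2}"
    using s(1) by simp
  obtain x where x: "x \<in> {t1..t2}"
    "\<forall>t\<in>{t1..t2}. hinge_sum I l r (\<lambda>i. u i s t) \<le> hinge_sum I l r (\<lambda>i. u i s x)"
    "x = t1 \<or> x = t2 \<or> (\<exists>y\<in>{t1<..<t2}. (\<forall>i\<in>I. (\<exists>t. u i s t \<noteq> 0) \<longrightarrow> u i s y \<noteq> 0) \<and>
        (\<Sum>i\<in>I. (if 0 < u i s y then r i else l i) * a i) \<noteq> 0 \<and>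
        x = - (\<Sum>i\<in>I. (if 0 < u i s y then r i else l i) * b i) /
          (2 * (\<Sum>i\<in>I. (if 0 < u i s y then r i else l i) * a i)))"
    by (rule hinge_sum_maximiser[OF I lr t12, where a = a and b = b and c = "c s", folded u_eq])
      (assumption, rule that)
  have "x \<in> {t1, t2} \<union> cell_vertices I l r p q s1 s2 t1 t2"
  proof (cases "x = t1 \<or> x = t2")
    case False
    with x(3) obtain y where y: "y \<in> {t1<..<t2}" "\<And>i t. i \<in> I \<Longrightarrow> u i s t \<noteq> 0 \<Longrightarrow> u i s y \<noteq> 0"
      and x_eq: "x = - (\<Sum>i\<in>I. (if 0 < u i s y then r i else l i) * b i) /
          (2 * (\<Sum>i\<in>I. (if 0 < u i s y then r i else l i) * a i))"
      by blast
    have "u i s y \<noteq> 0" if "i \<in> I'" for i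
      using nonzero_on_line[OF that s_in] y(2)[of i] that by (auto simp: I'_def)
    from sign_cells[OF s_in s0(1) y(1) this] obtain y' where
      y': "y' \<in> {t1<..<t2}" "\<And>i. i \<in> I' \<Longrightarrow> 0 < u i s y * u i s0 y'"
      by blast
    have sign: "0 < u i s y \<longleftrightarrow> 0 < u i s0 y'" if "i \<in> I" for i
      using y'(2)[of i] that by (cases "i \<in> I'") (auto simp: I'_def zero_less_mult_iff)
    let ?T = "insert t1 (insert t2 (line_roots I p q s0 t1 t2))"
    let ?G = "\<lambda>t. hinge_sum I l r (\<lambda>i. q i t - p i s0)"
    have "\<exists>\<tau>\<in>?T. \<exists>\<tau>'\<in>?T. vertex ?G \<tau> \<tau>' =
        - (\<Sum>i\<in>I. (if 0 < quad_at (a i) (b i) (c s0 i) y' then r i else l i) * b i) /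
          (2 * (\<Sum>i\<in>I. (if 0 < quad_at (a i) (b i) (c s0 i) y' then r i else l i) * a i))"
    proof (rule vertex_of_hinge_sum[where c = "c s0"])
      show "?G t = hinge_sum I l r (\<lambda>i. quad_at (a i) (b i) (c s0 i) t)" if "t \<in> {t1..t2}" for t
        using sum_eq[OF s0(2) that] .
      show "finite ?T"
        using I by (simp add: line_roots_def)
      show "z \<in> ?T" if "i \<in> I" "quad_at (a i) (b i) (c s0 i) t \<noteq> 0"
        "quad_at (a i) (b i) (c s0 i) z = 0" for i z t
        using quad_root_in_roots[OF that(2,3)] that(1) c_eq[OF that(1) s0(2)]
        by (auto simp: line_roots_def a_def b_def)
      show "quad_at (a i) (b i) (c s0 i) y' \<noteq> 0"
        if "i \<in> I" "quad_at (a i) (b i) (c s0 i) t \<noteq> 0" for i t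
      proof -
        have "i \<in> I'"
          using that unfolding I'_def u_eq by blast
        then show ?thesis
          using y'(2)[of i] by (auto simp: u_eq)
      qed
    qed (use y'(1) lr in auto)
    then obtain \<tau> \<tau>' where "\<tau> \<in> ?T" "\<tau>' \<in> ?T" "vertex ?G \<tau> \<tau>' =
        - (\<Sum>i\<in>I. (if 0 < u i s0 y' then r i else l i) * b i) /
          (2 * (\<Sum>i\<in>I. (if 0 < u i s0 y' then r i else l i) * a i))"
      unfolding u_eq by blast
    moreover have "(\<Sum>i\<in>I. (if 0 < u i s0 y' then r i else l i) * f i) =
        (\<Sum>i\<in>I. (if 0 < u i s y then r i else l i) * f i)" for f
      using sign by (intro sum.cong) simp_all
    ultimately have "\<tau> \<in> ?T" "\<tau>' \<in> ?T" "x = vertex ?G \<tau> \<tau>'"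
      by (simp_all add: x_eq)
    with s0(3) show ?thesis
      unfolding cell_vertices_def vertices_def by blast
  qed blast
  moreover have "hinge_sum I l r (\<lambda>i. q i t - p i s) \<le> hinge_sum I l r (\<lambda>i. q i x - p i s)"
    if "t \<in> {t1..t2}" for t
    using bspec[OF x(2) that] sum_eq[OF s' that] sum_eq[OF s' x(1)] by (simp add: u_eq)
  ultimately show ?thesis
    using x(1) by blast
qed

definition piecewise_quadratic :: "real set \<Rightarrow> (real \<Rightarrow> real) \<Rightarrow> bool" where
  "piecewise_quadratic B f \<longleftrightarrow>
    (\<forall>u v. 0 \<le> u \<longrightarrow> u < v \<longrightarrow> v \<le> 1 \<longrightarrow> {u<..<v} \<inter> B = {} \<longrightarrow> quadratic_on u v f)"

lemma piecewise_quadraticD: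
  "piecewise_quadratic B f \<Longrightarrow> 0 \<le> u \<Longrightarrow> u < v \<Longrightarrow> v \<le> 1 \<Longrightarrow> {u<..<v} \<inter> B = {} \<Longrightarrow>
    quadratic_on u v f"
  by (simp add: piecewise_quadratic_def)

text \<open>\<open>maximiser_in_rectangle\<close> leaves out the finite set \<open>E\<close> of
  positions. For fixed \<open>t\<close>, the positions at which some member of the finite response
  set is at least as good as \<open>t\<close> form a closed set; containing \<open>{0..1}\<close> up
  to finitely many points, it contains all of it.\<close>

lemma best_response:
  fixes I :: "'i set"
  assumes I: "finite I" and lr: "\<And>i. i \<in> I \<Longrightarrow> l i \<le> r i"
    and S: "finite S" "{0, 1} \<subseteq> S" "S \<subseteq> {0..1}" and T: "finite T" "{0, 1} \<subseteq> T" "T \<subseteq> {0..1}"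
    and p: "\<And>i. i \<in> I \<Longrightarrow> piecewise_quadratic S (p i)"
      "\<And>i. i \<in> I \<Longrightarrow> continuous_on UNIV (p i)"
    and q: "\<And>i. i \<in> I \<Longrightarrow> piecewise_quadratic T (q i)"
    and s: "s \<in> {0..1}" and t: "t \<in> {0..1}"
  shows "\<exists>x\<in>best_responses I l r p q S T.
    hinge_sum I l r (\<lambda>i. q i t - p i s) \<le> hinge_sum I l r (\<lambda>i. q i x - p i s)"
proof -
  let ?Y = "best_responses I l r p q S T"
  let ?F = "\<lambda>s t. hinge_sum I l r (\<lambda>i. q i t - p i s)"
  define A where "A = {s. \<exists>x\<in>?Y. ?F s t \<le> ?F s x}"
  define E where "E = S \<union> (\<Union>s1\<in>S. \<Union>s2\<in>S. \<Union>t1\<in>T. \<Union>t2\<in>T. crits I p q s1 s2 t1 t2)"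
  have "finite E"
    unfolding E_def using I S(1) T(1) by (intro finite_UnI finite_UN_I finite_crits)
  have "closed A"
  proof -
    have "A = (\<Union>x\<in>?Y. {s. ?F s t \<le> ?F s x})"
      by (auto simp: A_def)
    moreover have "closed {s. ?F s t \<le> ?F s x}" for x
      unfolding hinge_sum_def hinge_def
      using p(2) by (intro closed_Collect_le continuous_intros continuous_on_max)
    ultimately show ?thesis
      using finite_best_responses[OF I S(1) T(1)] by (auto intro: closed_UN)
  qed
  have A: "s \<in> A" if s: "s \<in> {0..1}" "s \<notin> E" for s
  proof (cases "t = 1")
    \<comment> \<open>The right end has no upper neighbour in \<open>T\<close>, but it belongs to
      \<open>T\<close> itself.\<close>
    case True
    then have "t \<in> ?Y"
      using T(2) by (simp add: best_responses_def)
    then show ?thesis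
      by (auto simp: A_def)
  next
    case False
    then have "0 \<le> t" "t < 1" "0 \<in> T" "1 \<in> T"
      using t T(2) by simp_all
    then obtain t1 t2 where
      t12: "t1 \<in> T" "t2 \<in> T" "t1 \<le> t" "t < t2" "{t1<..<t2} \<inter> T = {}"
      using consecutive_elements[OF T(1)] by metis
    have "s \<notin> S"
      using s(2) by (simp add: E_def)
    have "0 \<in> S" "1 \<in> S"
      using S(2) by simp_all
    then have "0 \<le> s" "s < 1"
      using s(1) \<open>s \<notin> S\<close> by (auto simp: order_less_le)
    with \<open>0 \<in> S\<close> \<open>1 \<in> S\<close> obtain s1 s2 where
      s12: "s1 \<in> S" "s2 \<in> S" "s1 \<le> s" "s < s2" "{s1<..<s2} \<inter> S = {}"
      using consecutive_elements[OF S(1)] by metis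
    have "s1 \<noteq> s"
      using s12(1) \<open>s \<notin> S\<close> by auto
    have bounds: "0 \<le> s1" "s2 \<le> 1" "0 \<le> t1" "t2 \<le> 1"
      using s12(1,2) t12(1,2) S(3) T(3) by auto
    have "\<exists>x\<in>{t1..t2}. x \<in> {t1, t2} \<union> cell_vertices I l r p q s1 s2 t1 t2 \<and>
        (\<forall>t\<in>{t1..t2}. ?F s t \<le> ?F s x)"
    proof (rule maximiser_in_rectangle[OF I lr])
      show "quadratic_on s1 s2 (p i)" if "i \<in> I" for i
        using piecewise_quadraticD[OF p(1)[OF that]] s12 bounds by simp
      show "quadratic_on t1 t2 (q i)" if "i \<in> I" for i
        using piecewise_quadraticD[OF q[OF that]] t12 bounds by simp
      show "s \<in> {s1<..<s2}"
        using s12 \<open>s1 \<noteq> s\<close> by simp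
      show "s \<notin> crits I p q s1 s2 t1 t2"
        using s(2) s12(1,2) t12(1,2) unfolding E_def by blast
    qed (use t12 in auto)
    moreover have "t \<in> {t1..t2}"
      using t12(3,4) by simp
    ultimately obtain x where
      x: "x \<in> {t1..t2}" "x \<in> {t1, t2} \<union> cell_vertices I l r p q s1 s2 t1 t2" "?F s t \<le> ?F s x"
      by blast
    have "x \<in> ?Y"
    proof (cases "x \<in> {t1, t2}")
      case True
      then show ?thesis
        using t12(1,2) by (auto simp: best_responses_def)
    next
      case False
      then have "x \<in> cell_vertices I l r p q s1 s2 t1 t2"
        using x(2) by blast
      moreover have "0 \<le> x" "x \<le> 1"
        using x(1) bounds by auto
      ultimately show ?thesis
        unfolding best_responses_def Un_iff unit_part_iff using s12(1,2) t12(1,2) by blast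
    qed
    with x(3) show ?thesis
      by (auto simp: A_def)
  qed
  have "s \<in> A"
  proof (rule ccontr)
    assume "s \<notin> A"
    moreover have "open (- A)"
      using \<open>closed A\<close> by (rule open_Compl)
    ultimately obtain e where e: "0 < e" "ball s e \<subseteq> - A"
      by (meson ComplI open_contains_ball)
    let ?U = "{max 0 (s - e)<..<min 1 (s + e)}"
    have "max 0 (s - e) < min 1 (s + e)"
      using s e(1) by auto
    then have "infinite ?U"
      by (rule infinite_Ioo)
    then obtain x where x: "x \<in> ?U" "x \<notin> E"
      using \<open>finite E\<close> by (meson finite_subset subsetI)
    then have "x \<in> A"
      by (intro A) auto
    moreover have "x \<in> ball s e"
      using x(1) by (auto simp: dist_real_def)
    ultimately show False
      using e(2) by blast
  qed
  then show ?thesis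
    by (simp add: A_def)
qed


section \<open>Minima of upper envelopes\<close>

text \<open>The positions at which a difference \<open>z i - p i s\<close> may change sign: the
  breakpoints in \<open>s\<close> of the regret against one fixed rival.\<close>

definition value_roots :: "'i set \<Rightarrow> ('i \<Rightarrow> real \<Rightarrow> real) \<Rightarrow> real set \<Rightarrow> ('i \<Rightarrow> real) \<Rightarrow> real set" where
  "value_roots I p S z = (\<Union>s1\<in>S. \<Union>s2\<in>S. \<Union>i\<in>I.
    roots (quad0 (p i) s1 s2 - z i) (quad1 (p i) s1 s2) (quad2 (p i) s1 s2) 0 0)"

definition envelope_points :: "real set \<Rightarrow> 'j set \<Rightarrow> ('j \<Rightarrow> real \<Rightarrow> real) \<Rightarrow> real set" where
  "envelope_points C J F = C \<union> unit_part (\<Union>u\<in>C. \<Union>v\<in>C. \<Union>j\<in>J.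
    insert (vertex (F j) u v) (\<Union>k\<in>J. roots (quad0 (F j) u v - quad0 (F k) u v)
      (quad1 (F j) u v - quad1 (F k) u v) (quad2 (F j) u v - quad2 (F k) u v) 0 0))"

lemma finite_value_roots: "finite I \<Longrightarrow> finite S \<Longrightarrow> finite (value_roots I p S z)"
  unfolding value_roots_def by (intro finite_UN_I finite_roots)

lemma finite_envelope_points: "finite C \<Longrightarrow> finite J \<Longrightarrow> finite (envelope_points C J F)"
  unfolding envelope_points_def
  by (intro finite_UnI finite_unit_part finite_UN_I finite.insertI finite_roots)

lemma piecewise_quadratic_hinge_sum:
  assumes I: "finite I" and lr: "\<And>i. i \<in> I \<Longrightarrow> l i \<le> r i"
    and S: "finite S" "{0, 1} \<subseteq> S" and p: "\<And>i. i \<in> I \<Longrightarrow> piecewise_quadratic S (p i)"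
    and C: "S \<subseteq> C" "unit_part (value_roots I p S z) \<subseteq> C" and S_unit: "S \<subseteq> {0..1}"
  shows "piecewise_quadratic C (\<lambda>s. hinge_sum I l r (\<lambda>i. z i - p i s))"
  unfolding piecewise_quadratic_def
proof (intro allI impI)
  fix u v :: real
  assume uv: "0 \<le> u" "u < v" "v \<le> 1" and empty: "{u<..<v} \<inter> C = {}"
  define y where "y = (u + v) / 2"
  have y: "u < y" "y < v"
    using uv(2) by (simp_all add: y_def)
  have "0 \<in> S" "1 \<in> S" "0 \<le> y" "y < 1"
    using S(2) uv y by simp_all
  then obtain s1 s2 where s12: "s1 \<in> S" "s2 \<in> S" "s1 \<le> y" "y < s2" "{s1<..<s2} \<inter> S = {}"
    using consecutive_elements[OF S(1)] by metis
  have "s1 \<notin> {u<..<v}" "s2 \<notin> {u<..<v}"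
    using s12(1,2) C(1) empty by blast+
  then have sub: "s1 \<le> u" "v \<le> s2"
    using s12(3,4) y by auto
  have s12_unit: "0 \<le> s1" "s2 \<le> 1"
    using s12(1,2) S_unit by auto
  define P2 P1 P0 where "P2 i = quad2 (p i) s1 s2" and "P1 i = quad1 (p i) s1 s2" and
    "P0 i = quad0 (p i) s1 s2" for i
  have p_eq: "p i x = quad_at (P2 i) (P1 i) (P0 i) x" if "i \<in> I" "x \<in> {s1..s2}" for i x
  proof -
    have "quadratic_on s1 s2 (p i)"
      using piecewise_quadraticD[OF p[OF that(1)]] s12 s12_unit by simp
    then show ?thesis
      unfolding P2_def P1_def P0_def using s12(3,4) that(2) by (intro quad_interpolation) auto
  qed
  let ?v = "\<lambda>i. quad_at (- P2 i) (- P1 i) (z i - P0 i)"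
  let ?\<kappa> = "\<lambda>i. if 0 < ?v i y then r i else l i"
  have diff_eq: "z i - p i x = ?v i x" if "i \<in> I" "x \<in> {s1..s2}" for i x
    unfolding p_eq[OF that] by (simp add: quad_at_def)
  have nz: "?v i x \<noteq> 0" if "i \<in> I" "x \<in> {u<..<v}" "?v i t \<noteq> 0" for i x t
  proof
    assume "?v i x = 0"
    have neg: "?v i t = - quad_at (P2 i) (P1 i) (P0 i - z i) t" for t
      by (simp add: quad_at_def)
    have "x \<in> roots (P0 i - z i) (P1 i) (P2 i) 0 0"
      using quad_root_in_roots[of "P2 i" "P1 i" "P0 i - z i" t x] \<open>?v i x = 0\<close> that(3) by (simp add: neg)
    then have "x \<in> value_roots I p S z"
      using s12(1,2) that(1) unfolding value_roots_def P0_def P1_def P2_def by blast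
    then have "x \<in> C"
      using C(2) that(2) uv by (auto simp: unit_part_iff)
    with that(2) empty show False
      by blast
  qed
  have "hinge_sum I l r (\<lambda>i. z i - p i s) =
      quad_at (\<Sum>i\<in>I. ?\<kappa> i * (- P2 i)) (\<Sum>i\<in>I. ?\<kappa> i * (- P1 i)) (\<Sum>i\<in>I. ?\<kappa> i * (z i - P0 i)) s"
    if s: "s \<in> {u..v}" for s
    unfolding sum_quad_at[symmetric] hinge_sum_def
  proof (rule sum.cong)
    fix i
    assume i: "i \<in> I"
    have "hinge (l i) (r i) (?v i s) = ?\<kappa> i * ?v i s"
      using nz[OF i] y s lr[OF i] by (intro hinge_between_roots[of u v]) auto
    then show "hinge (l i) (r i) (z i - p i s) = ?\<kappa> i * ?v i s"
      using diff_eq[OF i, of s] s sub by simp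
  qed simp
  then show "quadratic_on u v (\<lambda>s. hinge_sum I l r (\<lambda>i. z i - p i s))"
    unfolding quadratic_on_def by blast
qed

lemma continuous_on_Max_image:
  fixes F :: "'j \<Rightarrow> real \<Rightarrow> real"
  assumes "finite J" "J \<noteq> {}" "\<And>j. j \<in> J \<Longrightarrow> continuous_on A (F j)"
  shows "continuous_on A (\<lambda>s. Max ((\<lambda>j. F j s) ` J))"
  using assms
proof (induction J rule: finite_ne_induct)
  case (insert j J)
  then have "continuous_on A (\<lambda>s. max (F j s) (Max ((\<lambda>j. F j s) ` J)))"
    by (intro continuous_on_max) auto
  then show ?case
    using insert.hyps by (simp add: Max_insert)
qed simp

text \<open>Suppose a minimiser \<open>x\<close> is not among the points. Between the neighbouring
  points no two pieces cross, so the piece that is maximal at \<open>x\<close> is the whole envelope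
  there. Hence \<open>x\<close> is its vertex, or the piece is constant and a neighbouring point is
  a minimiser too; both are contradictions.\<close>

lemma envelope_minimum:
  fixes F :: "'j \<Rightarrow> real \<Rightarrow> real"
  assumes J: "finite J" "J \<noteq> {}" and C: "finite C" "{0, 1} \<subseteq> C" "C \<subseteq> {0..1}"
    and F: "\<And>j. j \<in> J \<Longrightarrow> piecewise_quadratic C (F j)" "\<And>j. j \<in> J \<Longrightarrow> continuous_on {0..1} (F j)"
    and s: "s \<in> {0..1}"
  shows "\<exists>c\<in>envelope_points C J F. Max ((\<lambda>j. F j c) ` J) \<le> Max ((\<lambda>j. F j s) ` J)"
proof (rule ccontr)
  let ?E = "envelope_points C J F"
  define f where "f s = Max ((\<lambda>j. F j s) ` J)" for s
  have "continuous_on {0..1} f"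
    unfolding f_def using J F(2) by (rule continuous_on_Max_image)
  then obtain x where x: "x \<in> {0..1}" "\<And>y. y \<in> {0..1} \<Longrightarrow> f x \<le> f y"
    using continuous_attains_inf[of "{0..1::real}" f] by auto
  assume "\<not> (\<exists>c\<in>?E. Max ((\<lambda>j. F j c) ` J) \<le> Max ((\<lambda>j. F j s) ` J))"
  then have E: "f x < f c" if "c \<in> ?E" for c
    using that x(2)[OF s] by (force simp: f_def)
  then have "x \<notin> ?E"
    by blast
  have "C \<subseteq> ?E"
    by (simp add: envelope_points_def)
  have E_unit: "?E \<subseteq> {0..1}"
    using C(3) by (auto simp: envelope_points_def unit_part_iff)
  have "0 \<in> C" "1 \<in> C" "0 \<le> x" "x < 1"
    using C(2) x(1) \<open>x \<notin> ?E\<close> \<open>C \<subseteq> ?E\<close> by (auto simp: order_less_le)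
  then obtain u v where uv: "u \<in> C" "v \<in> C" "u \<le> x" "x < v" "{u<..<v} \<inter> C = {}"
    using consecutive_elements[OF C(1)] by metis
  have "finite ?E" "u \<in> ?E" "v \<in> ?E"
    using C(1) J(1) uv(1,2) \<open>C \<subseteq> ?E\<close> by (auto intro: finite_envelope_points)
  then obtain c c' where c: "c \<in> ?E" "c' \<in> ?E" "c \<le> x" "x < c'" "{c<..<c'} \<inter> ?E = {}"
    "u \<le> c" "c' \<le> v"
    using consecutive_elements[of ?E u v x] uv(3,4) by metis
  have "c < x"
    using c(1,3) \<open>x \<notin> ?E\<close> by (auto simp: order_less_le)
  have uv_unit: "0 \<le> u" "v \<le> 1" "u < v"
    using uv C(3) by auto
  define a b d where "a j = quad2 (F j) u v" and "b j = quad1 (F j) u v" and "d j = quad0 (F j) u v"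
    for j
  have F_eq: "F j y = quad_at (a j) (b j) (d j) y" if "j \<in> J" "y \<in> {u..v}" for j y
    unfolding a_def b_def d_def
    using piecewise_quadraticD[OF F(1)[OF that(1)]] uv_unit uv(5) that(2)
    by (intro quad_interpolation) auto
  have "f x \<in> (\<lambda>j. F j x) ` J"
    unfolding f_def using J by (intro Max_in) auto
  then obtain j where j: "j \<in> J" "f x = F j x"
    by blast
  have f_ge: "F k y \<le> f y" if "k \<in> J" for k y
    unfolding f_def using J(1) that by (intro Max_ge) auto
  have sub: "y \<in> {u..v}" "y \<in> {0..1}" if "y \<in> {c..c'}" for y
    using that c(6,7) uv_unit by auto
  have dominates: "F k y \<le> F j y" if k: "k \<in> J" and y: "y \<in> {c..c'}" for k y
  proof -
    let ?q = "quad_at (a j - a k) (b j - b k) (d j - d k)"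
    have q: "?q y = F j y - F k y" if "y \<in> {c..c'}" for y
      using F_eq[OF j(1) sub(1)[OF that]] F_eq[OF k sub(1)[OF that]]
      by (simp add: quad_at_def algebra_simps)
    have nz: "?q z \<noteq> 0" if "z \<in> {c<..<c'}" "?q t \<noteq> 0" for z t
    proof
      assume "?q z = 0"
      with that(2) have "z \<in> roots (d j - d k) (b j - b k) (a j - a k) 0 0"
        by (rule quad_root_in_roots)
      then have "z \<in> (\<Union>u\<in>C. \<Union>v\<in>C. \<Union>j\<in>J. insert (vertex (F j) u v)
          (\<Union>k\<in>J. roots (quad0 (F j) u v - quad0 (F k) u v)
            (quad1 (F j) u v - quad1 (F k) u v) (quad2 (F j) u v - quad2 (F k) u v) 0 0))"
        unfolding a_def b_def d_def using uv(1,2) j(1) k by blast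
      then have "z \<in> ?E"
        using that(1) sub(2)[of z] by (auto simp: envelope_points_def unit_part_iff)
      with that(1) c(5) show False
        by blast
    qed
    have "0 \<le> ?q y"
    proof (cases "?q x = 0")
      case True
      then have "?q t = 0" for t
        using nz[of x t] \<open>c < x\<close> c(4) by auto
      then show ?thesis
        by simp
    next
      case False
      moreover have "0 \<le> ?q x"
        using q[of x] f_ge[OF k, of x] j(2) c(3,4) by simp
      ultimately have "0 < ?q x"
        by simp
      then show ?thesis
        using nz[OF _ False] c(3,4) y quad_at_cont by (intro sign_between_roots[of c c' ?q x]) auto
    qed
    with q[OF y] show ?thesis
      by simp
  qed
  have f_eq: "f y = F j y" if "y \<in> {c..c'}" for y
    unfolding f_def using J dominates[OF _ that] j(1) by (intro Max_eqI) auto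
  have "2 * - a j * x + - b j = 0"
  proof (rule quad_at_local_max[where c = "- d j"])
    show "x \<in> {c<..<c'}"
      using \<open>c < x\<close> c(4) by simp
    fix y
    assume "y \<in> {c<..<c'}"
    then have y: "y \<in> {c..c'}" "x \<in> {c..c'}"
      using c(3,4) by auto
    have "F j x \<le> F j y"
      using x(2)[OF sub(2)[OF y(1)]] f_eq y by simp
    then show "quad_at (- a j) (- b j) (- d j) y \<le> quad_at (- a j) (- b j) (- d j) x"
      using F_eq[OF j(1) sub(1)[OF y(1)]] F_eq[OF j(1) sub(1)[OF y(2)]] by (simp add: quad_at_def)
  qed
  then have crit: "2 * a j * x + b j = 0"
    by simp
  show False
  proof (cases "a j = 0")
    case True
    with crit have "b j = 0"
      by simp
    with True have "F j c = F j x"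
      using F_eq[OF j(1), of c] F_eq[OF j(1), of x] sub(1)[of c] sub(1)[of x] c(3,4)
      by (simp add: quad_at_def)
    then show False
      using E[OF c(1)] f_eq[of c] f_eq[of x] c(3,4) by simp
  next
    case False
    with crit have "x = vertex (F j) u v"
      unfolding vertex_def a_def[symmetric] b_def[symmetric] by (simp add: field_simps)
    then have "x \<in> (\<Union>u\<in>C. \<Union>v\<in>C. \<Union>j\<in>J. insert (vertex (F j) u v)
        (\<Union>k\<in>J. roots (quad0 (F j) u v - quad0 (F k) u v)
          (quad1 (F j) u v - quad1 (F k) u v) (quad2 (F j) u v - quad2 (F k) u v) 0 0))"
      using uv(1,2) j(1) by blast
    with x(1) have "x \<in> ?E"
      by (simp add: envelope_points_def unit_part_iff)
    with \<open>x \<notin> ?E\<close> show False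
      by blast
  qed
qed


section \<open>Coverage as a piecewise quadratic function\<close>

text \<open>
  For a point \<open>(g, s)\<close> at radius \<open>R\<close>, the covered part of an edge \<open>e \<noteq> g\<close> is bounded by maxima and
  minima of the functions with index 4 to 7, and the covered part of \<open>e = g\<close> by those with index 2
  and 3; the constants 0 and 1 clip it to \<open>e\<close>.
\<close>

definition aff :: "network \<Rightarrow> (nat \<Rightarrow> nat \<Rightarrow> real) \<Rightarrow> nat \<Rightarrow> nat \<Rightarrow> nat \<Rightarrow> real \<Rightarrow> real" where
  "aff N d g e j s =
    (if j = 0 then 0 else if j = 1 then 1
     else if j = 2 then s - radius N / len N e
     else if j = 3 then s + radius N / len N e
     else if j = 4 then (radius N - (s * len N g + d (end_k N g) (end_k N e))) / len N e
     else if j = 5 then (radius N - ((1 - s) * len N g + d (end_l N g) (end_k N e))) / len N e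
     else if j = 6 then 1 - (radius N - (s * len N g + d (end_k N g) (end_l N e))) / len N e
     else 1 - (radius N - ((1 - s) * len N g + d (end_l N g) (end_l N e))) / len N e)"

definition clip :: "real \<Rightarrow> real" where
  "clip x = max 0 (min 1 x)"

text \<open>\<open>moment True\<close> and \<open>moment False\<close> are antiderivatives of \<open>1 - t\<close> and \<open>t\<close>.\<close>

definition moment :: "bool \<Rightarrow> real \<Rightarrow> real" where
  "moment b x = (if b then x - x * x / 2 else x * x / 2)"

text \<open>The covered part of \<open>e\<close> that is reached through its end \<open>k\<close> is
  the interval from 0 to this value.\<close>

definition left_part :: "network \<Rightarrow> (nat \<Rightarrow> nat \<Rightarrow> real) \<Rightarrow> nat \<Rightarrow> nat \<Rightarrow> real \<Rightarrow> real" where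
  "left_part N d g e s = clip (max (aff N d g e 4 s) (aff N d g e 5 s))"

text \<open>The part reached through the end \<open>l\<close> runs from here to 1. The maximum with
  \<open>left_part\<close> prevents counting an overlap twice.\<close>

definition right_part :: "network \<Rightarrow> (nat \<Rightarrow> nat \<Rightarrow> real) \<Rightarrow> nat \<Rightarrow> nat \<Rightarrow> real \<Rightarrow> real" where
  "right_part N d g e s =
    max (left_part N d g e s) (clip (min (aff N d g e 6 s) (aff N d g e 7 s)))"

text \<open>The integral of 1 - t (for \<open>True\<close>) or t (for \<open>False\<close>) over the
  covered part of the edge, that is, the coefficient with which the demand at that end enters the
  coverage.\<close>

definition share :: "network \<Rightarrow> (nat \<Rightarrow> nat \<Rightarrow> real) \<Rightarrow> nat \<Rightarrow> nat \<times> bool \<Rightarrow> real \<Rightarrow> real" where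
  "share N d g i s =
    (if fst i = g
     then moment (snd i) (clip (aff N d g (fst i) 3 s))
       - moment (snd i) (clip (aff N d g (fst i) 2 s))
     else moment (snd i) (left_part N d g (fst i) s) + moment (snd i) 1
       - moment (snd i) (right_part N d g (fst i) s))"

text \<open>Where two affine functions agree. For parallel ones the division by zero gives 0, which
  is a break anyway.\<close>

definition crossing :: "(real \<Rightarrow> real) \<Rightarrow> (real \<Rightarrow> real) \<Rightarrow> real" where
  "crossing \<phi> \<psi> = (\<psi> 0 - \<phi> 0) / ((\<phi> 1 - \<phi> 0) - (\<psi> 1 - \<psi> 0))"

text \<open>Maxima, minima and clipping can switch from one affine function to another only where
  two of the eight agree.\<close>

definition breaks :: "network \<Rightarrow> (nat \<Rightarrow> nat \<Rightarrow> real) \<Rightarrow> nat \<Rightarrow> real set" where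
  "breaks N d g = {0, 1} \<union> unit_part (\<Union>e<num_edges N. \<Union>j<8. \<Union>k<8.
    {crossing (aff N d g e j) (aff N d g e k)})"

lemma finite_breaks: "finite (breaks N d g)"
  unfolding breaks_def by (intro finite_UnI finite_unit_part finite_UN_I) auto

lemma breaks_unit: "{0, 1} \<subseteq> breaks N d g" "breaks N d g \<subseteq> {0..1}"
  by (auto simp: breaks_def unit_part_iff)

lemma aff_affine: "aff N d g e j s = aff N d g e j 0 + s * (aff N d g e j 1 - aff N d g e j 0)"
  by (simp add: aff_def diff_divide_distrib add_divide_distrib algebra_simps)

lemma affine_order:
  fixes \<phi> \<psi> :: "real \<Rightarrow> real"
  assumes \<phi>: "\<And>s. \<phi> s = \<phi> 0 + s * (\<phi> 1 - \<phi> 0)" and \<psi>: "\<And>s. \<psi> s = \<psi> 0 + s * (\<psi> 1 - \<psi> 0)"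
    and z: "crossing \<phi> \<psi> \<notin> {u<..<v}"
  shows "(\<forall>s\<in>{u..v}. \<phi> s \<le> \<psi> s) \<or> (\<forall>s\<in>{u..v}. \<psi> s \<le> \<phi> s)"
proof -
  define b where "b = (\<phi> 1 - \<phi> 0) - (\<psi> 1 - \<psi> 0)"
  define z where "z = crossing \<phi> \<psi>"
  have diff: "\<phi> s - \<psi> s = (\<phi> 0 - \<psi> 0) + s * b" for s
    using \<phi>[of s] \<psi>[of s] by (simp add: b_def algebra_simps)
  show ?thesis
  proof (cases "b = 0")
    case True
    then have "\<phi> s - \<psi> s = \<phi> 0 - \<psi> 0" for s
      using diff[of s] by simp
    then have "\<phi> s \<le> \<psi> s \<longleftrightarrow> \<phi> 0 \<le> \<psi> 0" "\<psi> s \<le> \<phi> s \<longleftrightarrow> \<psi> 0 \<le> \<phi> 0" for s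
      by (metis diff_le_0_iff_le, metis diff_ge_0_iff_ge)
    then show ?thesis
      by (meson linear)
  next
    case False
    then have "z * b = \<psi> 0 - \<phi> 0"
      by (simp add: z_def crossing_def b_def)
    then have eq: "\<phi> s - \<psi> s = b * (s - z)" for s
      using diff[of s] by (simp add: algebra_simps)
    have "z \<le> u \<or> v \<le> z"
      using z by (auto simp: z_def)
    moreover have "0 \<le> \<phi> s - \<psi> s \<or> \<phi> s - \<psi> s \<le> 0" for s
      by linarith
    ultimately consider "\<forall>s\<in>{u..v}. 0 \<le> s - z" | "\<forall>s\<in>{u..v}. s - z \<le> 0"
      by fastforce
    then have "(\<forall>s\<in>{u..v}. \<phi> s - \<psi> s \<le> 0) \<or> (\<forall>s\<in>{u..v}. 0 \<le> \<phi> s - \<psi> s)"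
      unfolding eq by cases (auto simp: mult_le_0_iff zero_le_mult_iff)
    then show ?thesis
      by simp
  qed
qed

text \<open>Between breaks the eight functions are ordered, so this property passes through nested
  maxima, minima and clipping; what results is a single affine function.\<close>

definition selects :: "network \<Rightarrow> (nat \<Rightarrow> nat \<Rightarrow> real) \<Rightarrow> nat \<Rightarrow> nat \<Rightarrow> real \<Rightarrow> real \<Rightarrow> (real \<Rightarrow> real) \<Rightarrow> bool"
  where "selects N d g e u v f \<longleftrightarrow> (\<exists>j<8. \<forall>s\<in>{u..v}. f s = aff N d g e j s)"

lemma selects_aff: "j < 8 \<Longrightarrow> selects N d g e u v (\<lambda>s. aff N d g e j s)"
  unfolding selects_def by blast

lemma selects_0: "selects N d g e u v (\<lambda>s. 0)"
  unfolding selects_def by (intro exI[of _ 0]) (simp add: aff_def)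

lemma selects_1: "selects N d g e u v (\<lambda>s. 1)"
  unfolding selects_def by (intro exI[of _ 1]) (simp add: aff_def)

context
  fixes N :: network and d :: "nat \<Rightarrow> nat \<Rightarrow> real" and g e :: nat and u v :: real
  assumes e: "e < num_edges N" and uv: "0 \<le> u" "u < v" "v \<le> 1"
    and no_break: "{u<..<v} \<inter> breaks N d g = {}"
begin

lemma selects_max_min:
  assumes "selects N d g e u v f" "selects N d g e u v h"
  shows "selects N d g e u v (\<lambda>s. max (f s) (h s))" "selects N d g e u v (\<lambda>s. min (f s) (h s))"
proof -
  obtain j k where j: "j < 8" "\<And>s. s \<in> {u..v} \<Longrightarrow> f s = aff N d g e j s"
    and k: "k < 8" "\<And>s. s \<in> {u..v} \<Longrightarrow> h s = aff N d g e k s"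
    using assms by (auto simp: selects_def)
  have "crossing (aff N d g e j) (aff N d g e k) \<notin> {u<..<v}"
  proof
    assume *: "crossing (aff N d g e j) (aff N d g e k) \<in> {u<..<v}"
    moreover have "crossing (aff N d g e j) (aff N d g e k) \<in>
        (\<Union>e<num_edges N. \<Union>j<8. \<Union>k<8. {crossing (aff N d g e j) (aff N d g e k)})"
      using e j(1) k(1) by blast
    ultimately have "crossing (aff N d g e j) (aff N d g e k) \<in> breaks N d g"
      using uv by (simp add: breaks_def unit_part_iff)
    with * no_break show False
      by blast
  qed
  from affine_order[OF aff_affine aff_affine this]
  consider "\<And>s. s \<in> {u..v} \<Longrightarrow> f s \<le> h s" | "\<And>s. s \<in> {u..v} \<Longrightarrow> h s \<le> f s"
    using j(2) k(2) by force
  then have "((\<forall>s\<in>{u..v}. max (f s) (h s) = f s) \<and> (\<forall>s\<in>{u..v}. min (f s) (h s) = h s)) \<or>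
      ((\<forall>s\<in>{u..v}. max (f s) (h s) = h s) \<and> (\<forall>s\<in>{u..v}. min (f s) (h s) = f s))"
    by cases (simp_all add: max_absorb1 max_absorb2 min_absorb1 min_absorb2)
  then show "selects N d g e u v (\<lambda>s. max (f s) (h s))"
    "selects N d g e u v (\<lambda>s. min (f s) (h s))"
    unfolding selects_def using j k by (metis (no_types, lifting))+
qed

lemma selects_clip: "selects N d g e u v f \<Longrightarrow> selects N d g e u v (\<lambda>s. clip (f s))"
  unfolding clip_def by (intro selects_max_min selects_0 selects_1)

lemma quadratic_on_moment:
  assumes "selects N d g e u v f"
  shows "quadratic_on u v (\<lambda>s. moment b (f s))"
proof -
  obtain j where "\<And>s. s \<in> {u..v} \<Longrightarrow> f s = aff N d g e j s"
    using assms by (auto simp: selects_def)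
  then obtain x y where f: "\<And>s. s \<in> {u..v} \<Longrightarrow> f s = x + s * y"
    using aff_affine by metis
  show ?thesis
  proof (cases b)
    case True
    have "\<forall>s\<in>{u..v}. moment b (f s) = quad_at (- y * y / 2) (y - x * y) (x - x * x / 2) s"
      using f True by (simp add: moment_def quad_at_def field_simps)
    then show ?thesis
      unfolding quadratic_on_def by blast
  next
    case False
    have "\<forall>s\<in>{u..v}. moment b (f s) = quad_at (y * y / 2) (x * y) (x * x / 2) s"
      using f False by (simp add: moment_def quad_at_def field_simps)
    then show ?thesis
      unfolding quadratic_on_def by blast
  qed
qed

lemma quadratic_on_add_diff:
  assumes "quadratic_on u v f" "quadratic_on u v h"
  shows "quadratic_on u v (\<lambda>s. f s + h s)" "quadratic_on u v (\<lambda>s. f s - h s)"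
proof -
  obtain a b c where "\<forall>t\<in>{u..v}. f t = quad_at a b c t"
    using assms(1) unfolding quadratic_on_def by blast
  moreover obtain a' b' c' where "\<forall>t\<in>{u..v}. h t = quad_at a' b' c' t"
    using assms(2) unfolding quadratic_on_def by blast
  ultimately have "\<forall>t\<in>{u..v}. f t + h t = quad_at (a + a') (b + b') (c + c') t"
    "\<forall>t\<in>{u..v}. f t - h t = quad_at (a - a') (b - b') (c - c') t"
    by (simp_all add: quad_at_def algebra_simps)
  then show "quadratic_on u v (\<lambda>s. f s + h s)" "quadratic_on u v (\<lambda>s. f s - h s)"
    unfolding quadratic_on_def by blast+
qed

lemma quadratic_on_share: "fst i = e \<Longrightarrow> quadratic_on u v (\<lambda>s. share N d g i s)"
proof -
  assume i: "fst i = e"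
  have left: "selects N d g e u v (\<lambda>s. left_part N d g e s)"
    unfolding left_part_def by (intro selects_clip selects_max_min selects_aff) simp_all
  have right: "selects N d g e u v (\<lambda>s. right_part N d g e s)"
    unfolding right_part_def by (intro selects_clip selects_max_min selects_aff left) simp_all
  have "quadratic_on u v (\<lambda>s. moment (snd i) (clip (aff N d g e 3 s)) -
      moment (snd i) (clip (aff N d g e 2 s)))"
    by (intro quadratic_on_add_diff quadratic_on_moment selects_clip selects_aff) simp_all
  moreover have "quadratic_on u v (\<lambda>s. moment (snd i) (left_part N d g e s) + moment (snd i) 1 -
      moment (snd i) (right_part N d g e s))"
    by (intro quadratic_on_add_diff quadratic_on_moment left right selects_1)
  ultimately show ?thesis
    unfolding share_def i by (cases "e = g") simp_all
qed

end

lemma piecewise_quadratic_share: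
  "fst i < num_edges N \<Longrightarrow> piecewise_quadratic (breaks N d g) (share N d g i)"
  unfolding piecewise_quadratic_def by (auto intro: quadratic_on_share)

lemma continuous_share: "continuous_on UNIV (share N d g i)"
proof -
  have aff: "continuous_on UNIV (\<lambda>s. aff N d g e j s)" for e j
    by (subst aff_affine) (intro continuous_intros)
  have clip: "continuous_on UNIV (\<lambda>s. clip (f s))" if "continuous_on UNIV f" for f :: "real \<Rightarrow> real"
    unfolding clip_def by (intro continuous_intros continuous_on_max continuous_on_min that)
  have left: "continuous_on UNIV (\<lambda>s. left_part N d g e s)" for e
    unfolding left_part_def by (intro clip continuous_on_max aff)
  have right: "continuous_on UNIV (\<lambda>s. right_part N d g e s)" for e
    unfolding right_part_def by (intro clip continuous_on_max continuous_on_min aff left)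
  have moment: "continuous_on UNIV (\<lambda>s. moment b (f s))" if "continuous_on UNIV f"
    for b and f :: "real \<Rightarrow> real"
    unfolding moment_def by (cases b) (auto intro!: continuous_intros that)
  have "continuous_on UNIV (\<lambda>s. moment (snd i) (clip (aff N d g (fst i) 3 s)) -
      moment (snd i) (clip (aff N d g (fst i) 2 s)))"
    by (intro continuous_intros moment clip aff)
  moreover have "continuous_on UNIV (\<lambda>s. moment (snd i) (left_part N d g (fst i) s) +
      moment (snd i) 1 - moment (snd i) (right_part N d g (fst i) s))"
    by (intro continuous_intros moment left right)
  ultimately show ?thesis
    unfolding share_def[abs_def] by (cases "fst i = g") simp_all
qed


section \<open>Coverage and regret\<close>

lemma moment_mono_integral:
  assumes "x \<le> y"
  shows "(\<integral>t. indicator {x..y} t * (w0 * (1 - t) + w1 * t) \<partial>lborel) =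
      w0 * (moment True y - moment True x) + w1 * (moment False y - moment False x)"
    and "integrable lborel (\<lambda>t. indicator {x..y} t * (w0 * (1 - t) + w1 * t))"
proof -
  let ?f = "\<lambda>t. w0 * (1 - t) + w1 * t"
  let ?F = "\<lambda>t. w0 * moment True t + w1 * moment False t"
  have "(\<integral>t. indicator {x..y} t *\<^sub>R ?f t \<partial>lborel) = ?F y - ?F x"
  proof (rule integral_FTC_atLeastAtMost[OF assms])
    show "(?F has_vector_derivative ?f t) (at t within {x..y})" for t
      unfolding moment_def has_real_derivative_iff_has_vector_derivative[symmetric]
      by (auto intro!: derivative_eq_intros simp: field_simps)
  qed (intro continuous_intros)
  then show "(\<integral>t. indicator {x..y} t * ?f t \<partial>lborel) =
      w0 * (moment True y - moment True x) + w1 * (moment False y - moment False x)"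
    by (simp add: algebra_simps)
  have "set_integrable lborel {x..y} ?f"
    by (intro borel_integrable_atLeastAtMost' continuous_intros)
  then show "integrable lborel (\<lambda>t. indicator {x..y} t * ?f t)"
    by (simp add: set_integrable_def)
qed

lemma integral_one_interval:
  "(LBINT t:{t\<in>{0..1}. x \<le> t \<and> t \<le> y}. w0 * (1 - t) + w1 * t) =
    w0 * (moment True (clip y) - moment True (clip x)) +
    w1 * (moment False (clip y) - moment False (clip x))"
  if "x \<le> y"
proof -
  let ?f = "\<lambda>t. w0 * (1 - t) + w1 * t"
  have "clip x \<le> clip y"
    using that by (auto simp: clip_def)
  \<comment> \<open>An interval that misses \<open>{0..1}\<close> is clipped to the single point 0
    or 1, hence equality holds only almost everywhere.\<close>
  have "AE t in lborel. t \<noteq> (0::real)" "AE t in lborel. t \<noteq> (1::real)"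
    by (rule AE_lborel_singleton)+
  then have "AE t in lborel. indicator {t\<in>{0..1}. x \<le> t \<and> t \<le> y} t * ?f t =
      indicator {clip x..clip y} t * ?f t"
  proof eventually_elim
    case (elim t)
    then have "t \<in> {t\<in>{0..1}. x \<le> t \<and> t \<le> y} \<longleftrightarrow> t \<in> {clip x..clip y}"
      by (auto simp: clip_def)
    then show ?case
      by (simp add: indicator_def)
  qed
  moreover have "{t\<in>{0..1}. x \<le> t \<and> t \<le> y} \<in> sets borel"
    by measurable
  ultimately have "(\<integral>t. indicator {t\<in>{0..1}. x \<le> t \<and> t \<le> y} t * ?f t \<partial>lborel) =
      (\<integral>t. indicator {clip x..clip y} t * ?f t \<partial>lborel)"
    by (intro integral_cong_AE) simp_all
  then show ?thesis
    using moment_mono_integral(1)[OF \<open>clip x \<le> clip y\<close>] by (simp add: set_lebesgue_integral_def)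
qed

lemma integral_two_intervals:
  fixes x y w0 w1 :: real
  defines "l \<equiv> clip x" and "r \<equiv> max (clip x) (clip y)"
  shows "(LBINT t:{t\<in>{0..1}. t \<le> x \<or> y \<le> t}. w0 * (1 - t) + w1 * t) =
    w0 * (moment True l + moment True 1 - moment True r) +
    w1 * (moment False l + moment False 1 - moment False r)"
proof -
  let ?f = "\<lambda>t. w0 * (1 - t) + w1 * t"
  have lr: "0 \<le> l" "r \<le> 1"
    by (auto simp: l_def r_def clip_def)
  \<comment> \<open>Besides the clipping artefacts at 0 and 1, the two intervals may share the point
    \<open>r\<close>.\<close>
  have "AE t in lborel. t \<noteq> (0::real)" "AE t in lborel. t \<noteq> (1::real)" "AE t in lborel. t \<noteq> r"
    by (rule AE_lborel_singleton)+
  then have "AE t in lborel. indicator {t\<in>{0..1}. t \<le> x \<or> y \<le> t} t * ?f t =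
      indicator {0..l} t * ?f t + indicator {r..1} t * ?f t"
  proof eventually_elim
    case (elim t)
    have "t \<in> {0..1} \<and> (t \<le> x \<or> y \<le> t) \<longleftrightarrow> t \<in> {0..l} \<or> t \<in> {r..1}"
      using elim by (auto simp: l_def r_def clip_def min_def max_def split: if_splits)
    moreover have "\<not> (t \<in> {0..l} \<and> t \<in> {r..1})"
      using elim(3) by (auto simp: l_def r_def)
    ultimately show ?case
      by (auto simp: indicator_def)
  qed
  moreover have "{t\<in>{0..1}. t \<le> x \<or> y \<le> t} \<in> sets borel"
    by measurable
  ultimately have "(\<integral>t. indicator {t\<in>{0..1}. t \<le> x \<or> y \<le> t} t * ?f t \<partial>lborel) =
      (\<integral>t. indicator {0..l} t * ?f t + indicator {r..1} t * ?f t \<partial>lborel)"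
    by (intro integral_cong_AE) simp_all
  also have "\<dots> = (\<integral>t. indicator {0..l} t * ?f t \<partial>lborel) + (\<integral>t. indicator {r..1} t * ?f t \<partial>lborel)"
    by (intro Bochner_Integration.integral_add moment_mono_integral(2) lr)
  also have "\<dots> = w0 * (moment True l + moment True 1 - moment True r) +
      w1 * (moment False l + moment False 1 - moment False r)"
    unfolding moment_mono_integral(1)[OF lr(1)] moment_mono_integral(1)[OF lr(2)]
    by (simp add: moment_def algebra_simps)
  finally show ?thesis
    by (simp add: set_lebesgue_integral_def)
qed

text \<open>The lower bound at the end t = 0 or t = 1. A linear demand respects linear bounds
  exactly if it does so at both ends, and these two values can be chosen independently.\<close>

definition low :: "network \<Rightarrow> nat \<times> bool \<Rightarrow> real" where
  "low N i = (if snd i then edge_array N lb_a [fst i]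
    else edge_array N lb_a [fst i] + edge_array N lb_b [fst i])"

definition high :: "network \<Rightarrow> nat \<times> bool \<Rightarrow> real" where
  "high N i = (if snd i then edge_array N ub_a [fst i]
    else edge_array N ub_a [fst i] + edge_array N ub_b [fst i])"

text \<open>\<open>weight w (e, True)\<close> and \<open>weight w (e, False)\<close> are the demands at the two ends of \<open>e\<close>.\<close>

definition weight :: "demand \<Rightarrow> nat \<times> bool \<Rightarrow> real" where
  "weight w i = (if snd i then fst (w (fst i)) else fst (w (fst i)) + snd (w (fst i)))"

abbreviation indices :: "network \<Rightarrow> (nat \<times> bool) set" where
  "indices N \<equiv> {..<num_edges N} \<times> UNIV"

definition pair_regret ::
  "network \<Rightarrow> (nat \<Rightarrow> nat \<Rightarrow> real) \<Rightarrow> nat \<Rightarrow> real \<Rightarrow> nat \<Rightarrow> real \<Rightarrow> real" where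
  "pair_regret N d g s h t =
    hinge_sum (indices N) (low N) (high N) (\<lambda>i. share N d h i t - share N d g i s)"

definition rivals :: "network \<Rightarrow> (nat \<Rightarrow> nat \<Rightarrow> real) \<Rightarrow> nat \<Rightarrow> nat \<Rightarrow> real set" where
  "rivals N d g h = best_responses (indices N) (low N) (high N) (share N d g) (share N d h)
    (breaks N d g) (breaks N d h)"

definition rival_points :: "network \<Rightarrow> (nat \<Rightarrow> nat \<Rightarrow> real) \<Rightarrow> nat \<Rightarrow> (nat \<times> real) set" where
  "rival_points N d g = (SIGMA h:{..<num_edges N}. rivals N d g h)"

definition rival_breaks :: "network \<Rightarrow> (nat \<Rightarrow> nat \<Rightarrow> real) \<Rightarrow> nat \<Rightarrow> real set" where
  "rival_breaks N d g = breaks N d g \<union> unit_part (\<Union>j\<in>rival_points N d g.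
    value_roots (indices N) (share N d g) (breaks N d g) (\<lambda>i. share N d (fst j) i (snd j)))"

definition candidates :: "network \<Rightarrow> (nat \<Rightarrow> nat \<Rightarrow> real) \<Rightarrow> nat \<Rightarrow> real set" where
  "candidates N d g = envelope_points (rival_breaks N d g) (rival_points N d g)
    (\<lambda>j s. pair_regret N d g s (fst j) (snd j))"

definition worst_regret :: "network \<Rightarrow> (nat \<Rightarrow> nat \<Rightarrow> real) \<Rightarrow> nat \<Rightarrow> real \<Rightarrow> real" where
  "worst_regret N d g s =
    Max ((\<lambda>j. pair_regret N d g s (fst j) (snd j)) ` rival_points N d g)"

lemma finite_rival_points: "finite (rival_points N d g)"
  unfolding rival_points_def rivals_def
  by (intro finite_SigmaI finite_best_responses finite_breaks) simp_all

lemma finite_rival_breaks: "finite (rival_breaks N d g)"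
  unfolding rival_breaks_def
  by (intro finite_UnI finite_unit_part finite_UN_I finite_value_roots finite_breaks
      finite_rival_points) simp_all

lemma hinge_weight:
  assumes "l \<le> w" "w \<le> r"
  shows "w * z \<le> hinge l r z"
proof (cases "0 \<le> z")
  case True
  then have "w * z \<le> r * z"
    using assms(2) by (rule mult_right_mono[rotated])
  then show ?thesis
    using hinge_ge(2)[of r z l] by linarith
next
  case False
  then have "w * z \<le> l * z"
    using assms(1) by (intro mult_right_mono_neg) simp_all
  then show ?thesis
    using hinge_ge(1)[of l z r] by linarith
qed

lemma rival_point_unit: "(h, t) \<in> rival_points N d g \<Longrightarrow> h < num_edges N \<and> t \<in> {0..1}"
  using breaks_unit(2)[of N d h]
  by (auto simp: rival_points_def rivals_def best_responses_def unit_part_iff)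

text \<open>Distances enter through any \<open>d\<close> that is correct on nodes, since the program
  takes them from a table about which nothing else is known.\<close>

locale network_distances = valid_network +
  fixes d :: "nat \<Rightarrow> nat \<Rightarrow> real"
  assumes d: "\<And>u v. u \<in> {1..num_nodes N} \<Longrightarrow> v \<in> {1..num_nodes N} \<Longrightarrow> d u v = node_dist N u v"
begin

lemma covered_other_edge:
  assumes "g < num_edges N" "e < num_edges N" "e \<noteq> g"
  shows "covered N e (On_Edge g s) = {t\<in>{0..1}. t \<le> max (aff N d g e 4 s) (aff N d g e 5 s) \<or>
    min (aff N d g e 6 s) (aff N d g e 7 s) \<le> t}"
proof -
  let ?L = "edge_length (edges N ! e)"
  have L: "0 < ?L"
    using assms(2) by (rule length_pos)
  have single: "x + t * ?L \<le> radius N \<longleftrightarrow> t \<le> (radius N - x) / ?L" for x t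
    using L by (simp add: pos_le_divide_eq algebra_simps)
  have left: "min x y + t * ?L \<le> radius N \<longleftrightarrow>
      t \<le> (radius N - x) / ?L \<or> t \<le> (radius N - y) / ?L" for x y t
    unfolding single[symmetric] by (auto simp: min_def)
  have right: "min x y + (1 - t) * ?L \<le> radius N \<longleftrightarrow>
      1 - (radius N - x) / ?L \<le> t \<or> 1 - (radius N - y) / ?L \<le> t" for x y t
    unfolding left by auto
  have dist: "d (node_k (edges N ! g)) (node_k (edges N ! e)) =
      node_dist N (node_k (edges N ! g)) (node_k (edges N ! e))"
    "d (node_l (edges N ! g)) (node_k (edges N ! e)) =
      node_dist N (node_l (edges N ! g)) (node_k (edges N ! e))"
    "d (node_k (edges N ! g)) (node_l (edges N ! e)) =
      node_dist N (node_k (edges N ! g)) (node_l (edges N ! e))"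
    "d (node_l (edges N ! g)) (node_l (edges N ! e)) =
      node_dist N (node_l (edges N ! g)) (node_l (edges N ! e))"
    by (intro d end_nodes assms)+
  have "dist_node N (On_Edge g s) (node_k (edges N ! e)) + t * ?L \<le> radius N \<longleftrightarrow>
      t \<le> max (aff N d g e 4 s) (aff N d g e 5 s)" for t
    using assms by (simp add: dist aff_def left le_max_iff_disj)
  moreover have "dist_node N (On_Edge g s) (node_l (edges N ! e)) + (1 - t) * ?L \<le> radius N \<longleftrightarrow>
      min (aff N d g e 6 s) (aff N d g e 7 s) \<le> t" for t
    unfolding dist_node.simps right min_le_iff_disj using assms by (simp add: dist aff_def)
  ultimately show ?thesis
    using assms(3) by (simp add: covered_def min_le_iff_disj del: dist_node.simps)
qed

text \<open>An edge is a shortest path between its ends, so no detour through an end node is shorter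
  than the direct way along the edge.\<close>

lemma covered_own_edge:
  assumes "g < num_edges N" "s \<in> {0..1}"
  shows "covered N g (On_Edge g s) = {t\<in>{0..1}. aff N d g g 2 s \<le> t \<and> t \<le> aff N d g g 3 s}"
proof -
  let ?L = "edge_length (edges N ! g)" and ?k = "node_k (edges N ! g)" and ?l = "node_l (edges N ! g)"
  have L: "0 < ?L"
    using assms(1) by (rule length_pos)
  have dist: "node_dist N ?k ?k = 0" "node_dist N ?l ?l = 0" "node_dist N ?k ?l = ?L"
    "node_dist N ?l ?k = ?L"
    using end_nodes[OF assms(1)] node_dist_edge[OF assms(1)] node_dist_sym node_dist_refl by metis+
  have "point_dist N (On_Edge g s) (On_Edge g t) = \<bar>s - t\<bar> * ?L" if t: "t \<in> {0..1}" for t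
  proof -
    let ?A = "\<bar>s - t\<bar> * ?L"
    have le: "a * ?L \<le> b * ?L" if "a \<le> b" for a b
      using L that by (intro mult_right_mono) simp_all
    \<comment> \<open>The four detours: leave and re-enter the edge through either end node.\<close>
    have "?A \<le> (s + t) * ?L" "?A \<le> ((1 - s) + 1 + t) * ?L"
      "?A \<le> (s + 1 + (1 - t)) * ?L" "?A \<le> ((1 - s) + (1 - t)) * ?L"
      using assms(2) t by (intro le; auto simp: abs_if)+
    then have "?A \<le> s * ?L + t * ?L" "?A \<le> (1 - s) * ?L + ?L + t * ?L"
      "?A \<le> s * ?L + ?L + (1 - t) * ?L" "?A \<le> (1 - s) * ?L + (1 - t) * ?L"
      by (simp_all only: distrib_right mult_1_left)
    then have "?A \<le> min (s * ?L) ((1 - s) * ?L + ?L) + t * ?L"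
      "?A \<le> min (s * ?L + ?L) ((1 - s) * ?L) + (1 - t) * ?L"
      by (simp_all only: min_def simp_thms split: if_split)
    then show ?thesis
      by (simp add: dist min_absorb2)
  qed
  moreover have "\<bar>s - t\<bar> * ?L \<le> radius N \<longleftrightarrow> s - radius N / ?L \<le> t \<and> t \<le> s + radius N / ?L" for t
    using L by (simp add: pos_le_divide_eq[symmetric] abs_le_iff) linarith
  ultimately show ?thesis
    using assms(1) unfolding covered_def aff_def by auto
qed

lemma edge_coverage_eq:
  assumes "g < num_edges N" "e < num_edges N" "s \<in> {0..1}"
  shows "edge_coverage N e (On_Edge g s) w = (\<Sum>b\<in>UNIV. weight w (e, b) * share N d g (e, b) s)"
proof -
  have demand: "demand_at w e = (\<lambda>t. weight w (e, True) * (1 - t) + weight w (e, False) * t)"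
    by (auto simp: demand_at_def weight_def algebra_simps)
  show ?thesis
  proof (cases "e = g")
    case True
    have "0 < radius N"
      using is_network by (simp add: is_network_def)
    then have "0 \<le> radius N / edge_length (edges N ! g)"
      using length_pos[OF assms(1)] by (intro divide_nonneg_pos) simp_all
    then have "aff N d g g 2 s \<le> aff N d g g 3 s"
      using assms(1) by (simp add: aff_def)
    from integral_one_interval[OF this] show ?thesis
      unfolding edge_coverage_def demand unfolding True covered_own_edge[OF assms(1,3)]
      by (simp add: share_def UNIV_bool)
  next
    case False
    show ?thesis
      unfolding edge_coverage_def demand covered_other_edge[OF assms(1,2) False]
        integral_two_intervals
      using False by (simp add: share_def UNIV_bool left_part_def right_part_def)
  qed
qed

lemma coverage_diff:
  assumes "g < num_edges N" "s \<in> {0..1}" "h < num_edges N" "t \<in> {0..1}"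
  shows "coverage N (On_Edge h t) w - coverage N (On_Edge g s) w =
    (\<Sum>i\<in>indices N. weight w i * (share N d h i t - share N d g i s))"
proof -
  have "coverage N (On_Edge h t) w = (\<Sum>i\<in>indices N. weight w i * share N d h i t)"
    if "h < num_edges N" "t \<in> {0..1}" for h t
    using edge_coverage_eq[OF that(1) _ that(2)]
    by (simp add: coverage_def sum.cartesian_product)
  then show ?thesis
    using assms by (simp add: right_diff_distrib sum_subtractf)
qed

lemma weight_bounds:
  assumes "w \<in> realisations N" "i \<in> indices N"
  shows "low N i \<le> weight w i" "weight w i \<le> high N i"
proof -
  have e: "fst i < num_edges N"
    using assms(2) by auto
  then have "lb N (fst i) t \<le> demand_at w (fst i) t \<and> demand_at w (fst i) t \<le> ub N (fst i) t"
    if "t \<in> {0..1}" for t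
    using assms(1) that by (simp add: realisations_def)
  from this[of 0] this[of 1] e show "low N i \<le> weight w i" "weight w i \<le> high N i"
    by (simp_all add: low_def high_def weight_def lb_def ub_def demand_at_def)
qed

lemma low_le_high: "i \<in> indices N \<Longrightarrow> low N i \<le> high N i"
  using realisations_nonempty[OF is_network] weight_bounds by (meson equals0I order_trans)

text \<open>Interpolate the prescribed end values linearly; the bounds at the ends carry over to
  convex combinations.\<close>

lemma ex_realisation:
  assumes "\<And>i. i \<in> indices N \<Longrightarrow> low N i \<le> W i" "\<And>i. i \<in> indices N \<Longrightarrow> W i \<le> high N i"
  obtains w where "w \<in> realisations N" "\<And>i. weight w i = W i"
proof -
  define w where "w e = (W (e, True), W (e, False) - W (e, True))" for e
  have weight: "weight w i = W i" for i
    by (cases i) (simp add: weight_def w_def)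
  have "lb N e t \<le> demand_at w e t \<and> demand_at w e t \<le> ub N e t"
    if e: "e < num_edges N" and t: "t \<in> {0..1}" for e t
  proof -
    have "(e, b) \<in> indices N" for b
      using e by simp
    note bounds = assms(1)[OF this] assms(2)[OF this]
    have lb: "lb N e t = (1 - t) * low N (e, True) + t * low N (e, False)"
      and ub: "ub N e t = (1 - t) * high N (e, True) + t * high N (e, False)"
      and demand: "demand_at w e t = (1 - t) * W (e, True) + t * W (e, False)"
      using e by (simp_all add: lb_def ub_def low_def high_def demand_at_def w_def algebra_simps)
    show ?thesis
      unfolding lb ub demand using t by (intro conjI add_mono mult_left_mono bounds) simp_all
  qed
  then have "w \<in> realisations N"
    by (simp add: realisations_def)
  with weight show thesis
    by (rule that[rotated])
qed

text \<open>A node has the same distances to all points as the corresponding end of an incident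
  edge.\<close>

lemma coverage_At_Node:
  assumes "0 < num_edges N" "v \<in> {1..num_nodes N}"
  obtains g s where "g < num_edges N" "s \<in> {0..1}"
    "\<And>w. coverage N (At_Node v) w = coverage N (On_Edge g s) w"
proof -
  obtain g where g: "g < num_edges N" "v = node_k (edges N ! g) \<or> v = node_l (edges N ! g)"
    using assms by (rule node_is_end)
  define s :: real where "s = (if v = node_k (edges N ! g) then 0 else 1)"
  let ?L = "edge_length (edges N ! g)" and ?k = "node_k (edges N ! g)" and ?l = "node_l (edges N ! g)"
  have ends: "?k \<in> {1..num_nodes N}" "?l \<in> {1..num_nodes N}"
    using end_nodes[OF g(1)] by simp_all
  have L: "node_dist N ?k ?l = ?L" "node_dist N ?l ?k = ?L"
    using node_dist_edge[OF g(1)] node_dist_sym[OF ends] by simp_all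
  have node: "dist_node N (On_Edge g s) i = node_dist N v i" if i: "i \<in> {1..num_nodes N}" for i
  proof (cases "v = ?k")
    case True
    then show ?thesis
      using node_dist_triangle[OF ends i] L by (simp add: s_def)
  next
    case False
    then have "v = ?l"
      using g(2) by simp
    then show ?thesis
      using node_dist_triangle[OF ends(2,1) i] L False by (simp add: s_def)
  qed
  have "point_dist N (At_Node v) (On_Edge e t) = point_dist N (On_Edge g s) (On_Edge e t)"
    if "e < num_edges N" "t \<in> {0..1}" for e t
  proof (cases "e = g")
    case False
    then show ?thesis
      using node end_nodes[OF that(1)] by simp
  next
    case True
    \<comment> \<open>The direct way along \<open>g\<close> starts at an end node, so it is already
      among the ways through nodes.\<close>
    have "min (node_dist N v ?k + t * ?L) (node_dist N v ?l + (1 - t) * ?L) \<le> \<bar>s - t\<bar> * ?L"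
      using that(2) g(2) node_dist_refl[OF ends(1)] node_dist_refl[OF ends(2)]
      by (auto simp: s_def min_le_iff_disj)
    then show ?thesis
      using True node[OF ends(1)] node[OF ends(2)] by simp
  qed
  then have "covered N e (At_Node v) = covered N e (On_Edge g s)" if "e < num_edges N" for e
    using that unfolding covered_def by auto
  then have "coverage N (At_Node v) w = coverage N (On_Edge g s) w" for w
    by (simp add: coverage_def edge_coverage_def)
  then show thesis
    using g(1) by (intro that[of g s]) (simp_all add: s_def)
qed

text \<open>The hinges are attained by a single realisation: the upper bound at ends where the rival
  has the larger share, the lower bound elsewhere.\<close>

lemma pair_regret_le_max_regret:
  assumes "g < num_edges N" "s \<in> {0..1}" "h < num_edges N" "t \<in> {0..1}"
  shows "pair_regret N d g s h t \<le> max_regret N (On_Edge g s)"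
proof -
  define z where "z i = share N d h i t - share N d g i s" for i
  define W where "W i = (if 0 \<le> z i then high N i else low N i)" for i
  obtain w where w: "w \<in> realisations N" "\<And>i. weight w i = W i"
    by (rule ex_realisation[of W]) (auto simp: W_def low_le_high)
  have "pair_regret N d g s h t = (\<Sum>i\<in>indices N. W i * z i)"
    unfolding pair_regret_def hinge_sum_def z_def[symmetric]
    by (intro sum.cong) (auto simp: W_def hinge_pos hinge_neg low_le_high)
  also have "\<dots> = coverage N (On_Edge h t) w - coverage N (On_Edge g s) w"
    by (simp add: coverage_diff[OF assms] w(2) z_def)
  also have "\<dots> \<le> max_coverage N w - coverage N (On_Edge g s) w"
  proof -
    have "On_Edge h t \<in> points N"
      using assms(3,4) by (auto simp: points_def)
    then have "coverage N (On_Edge h t) w \<le> max_coverage N w"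
      unfolding max_coverage_def using bdd_above_coverage[OF is_network w(1)] by (rule cSUP_upper)
    then show ?thesis
      by simp
  qed
  also have "\<dots> \<le> max_regret N (On_Edge g s)"
    unfolding max_regret_def using w(1) bdd_above_regret[OF is_network] by (rule cSUP_upper)
  finally show ?thesis .
qed

lemma max_regret_le:
  assumes g: "g < num_edges N" "s \<in> {0..1}"
    and le: "\<And>h t. h < num_edges N \<Longrightarrow> t \<in> {0..1} \<Longrightarrow> pair_regret N d g s h t \<le> c"
  shows "max_regret N (On_Edge g s) \<le> c"
  unfolding max_regret_def
proof (rule cSUP_least)
  show "realisations N \<noteq> {}"
    by (rule realisations_nonempty[OF is_network])
  fix w
  assume w: "w \<in> realisations N"
  have edge: "coverage N (On_Edge h t) w \<le> c + coverage N (On_Edge g s) w"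
    if "h < num_edges N" "t \<in> {0..1}" for h t
  proof -
    have "coverage N (On_Edge h t) w - coverage N (On_Edge g s) w \<le> pair_regret N d g s h t"
      unfolding coverage_diff[OF g that] pair_regret_def hinge_sum_def
      by (intro sum_mono hinge_weight weight_bounds[OF w])
    then show ?thesis
      using le[OF that] by simp
  qed
  have "max_coverage N w \<le> c + coverage N (On_Edge g s) w"
    unfolding max_coverage_def
  proof (rule cSUP_least[OF points_nonempty[OF is_network]])
    fix y
    assume "y \<in> points N"
    then consider v where "y = At_Node v" "v \<in> {1..num_nodes N}" | h t where
      "y = On_Edge h t" "h < num_edges N" "t \<in> {0..1}"
      unfolding points_def by blast
    then show "coverage N y w \<le> c + coverage N (On_Edge g s) w"
    proof cases
      case 1
      have "0 < num_edges N"
        by (rule le_less_trans[OF le0 g(1)])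
      then obtain h t where "h < num_edges N" "t \<in> {0..1}"
        "\<And>w. coverage N (At_Node v) w = coverage N (On_Edge h t) w"
        using 1(2) by (rule coverage_At_Node) blast
      with edge 1(1) show ?thesis
        by simp
    next
      case 2
      with edge show ?thesis
        by simp
    qed
  qed
  then show "max_coverage N w - coverage N (On_Edge g s) w \<le> c"
    by simp
qed

text \<open>On each edge \<open>h\<close>, \<open>best_response\<close> replaces an arbitrary rival
  by one from the finite set; conversely every member of that set is a point of the network.\<close>

lemma max_regret_eq:
  assumes g: "g < num_edges N" "s \<in> {0..1}"
  shows "max_regret N (On_Edge g s) = worst_regret N d g s"
proof (rule antisym)
  let ?J = "rival_points N d g"
  let ?F = "\<lambda>j. pair_regret N d g s (fst j) (snd j)"
  have "(g, 0) \<in> ?J"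
    using g(1) breaks_unit(1)[of N d g] by (simp add: rival_points_def rivals_def best_responses_def)
  then have ne: "?J \<noteq> {}"
    by blast
  show "max_regret N (On_Edge g s) \<le> worst_regret N d g s"
  proof (rule max_regret_le[OF g])
    fix h t
    assume h: "h < num_edges N" "t \<in> {0..1::real}"
    have "\<exists>x\<in>rivals N d g h. pair_regret N d g s h t \<le> pair_regret N d g s h x"
      unfolding rivals_def pair_regret_def
      by (rule best_response)
        (use g(2) h(2) breaks_unit in \<open>auto simp: low_le_high finite_breaks continuous_share
          intro: piecewise_quadratic_share\<close>)
    then obtain x where x: "x \<in> rivals N d g h" "pair_regret N d g s h t \<le> pair_regret N d g s h x"
      by blast
    then have "(h, x) \<in> ?J"
      using h(1) by (simp add: rival_points_def)
    then have "?F (h, x) \<le> worst_regret N d g s"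
      unfolding worst_regret_def by (intro Max_ge finite_imageI finite_rival_points imageI)
    with x(2) show "pair_regret N d g s h t \<le> worst_regret N d g s"
      by simp
  qed
  have "?F j \<le> max_regret N (On_Edge g s)" if "j \<in> ?J" for j
    using rival_point_unit[of "fst j" "snd j"] that by (intro pair_regret_le_max_regret[OF g]) auto
  then show "worst_regret N d g s \<le> max_regret N (On_Edge g s)"
    unfolding worst_regret_def using finite_rival_points ne by (intro Max.boundedI) auto
qed

lemma candidates_unit: "candidates N d g \<subseteq> {0..1}"
  using breaks_unit(2)[of N d g]
  by (auto simp: candidates_def envelope_points_def rival_breaks_def unit_part_iff)

lemma candidate_le:
  assumes g: "g < num_edges N" "s \<in> {0..1}"
  shows "\<exists>c\<in>candidates N d g. worst_regret N d g c \<le> worst_regret N d g s"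
proof -
  have "(g, 0) \<in> rival_points N d g"
    using g(1) breaks_unit(1)[of N d g] by (simp add: rival_points_def rivals_def best_responses_def)
  then have ne: "rival_points N d g \<noteq> {}"
    by blast
  show ?thesis
    unfolding candidates_def worst_regret_def
  proof (rule envelope_minimum[OF finite_rival_points ne finite_rival_breaks _ _ _ _ g(2)])
    show "{0, 1} \<subseteq> rival_breaks N d g" "rival_breaks N d g \<subseteq> {0..1}"
      using breaks_unit[of N d g] by (auto simp: rival_breaks_def unit_part_iff)
  next
    fix j
    assume j: "j \<in> rival_points N d g"
    show "piecewise_quadratic (rival_breaks N d g) (\<lambda>s. pair_regret N d g s (fst j) (snd j))"
      unfolding pair_regret_def
    proof (rule piecewise_quadratic_hinge_sum)
      show "finite (breaks N d g)" "{0, 1} \<subseteq> breaks N d g" "breaks N d g \<subseteq> {0..1}"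
        by (fact finite_breaks breaks_unit)+
      show "breaks N d g \<subseteq> rival_breaks N d g"
        by (simp add: rival_breaks_def)
      show "piecewise_quadratic (breaks N d g) (share N d g i)" if "i \<in> indices N" for i
        using that by (intro piecewise_quadratic_share) auto
      show "low N i \<le> high N i" if "i \<in> indices N" for i
        using that by (rule low_le_high)
      show "unit_part (value_roots (indices N) (share N d g) (breaks N d g)
          (\<lambda>i. share N d (fst j) i (snd j))) \<subseteq> rival_breaks N d g"
        using j by (auto simp: rival_breaks_def unit_part_iff)
    qed simp
    show "continuous_on {0..1} (\<lambda>s. pair_regret N d g s (fst j) (snd j))"
      unfolding pair_regret_def hinge_sum_def hinge_def
      by (intro continuous_intros continuous_on_max
          continuous_on_subset[OF continuous_share subset_UNIV])
  qed
qed

lemma solution_if_best_candidate: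
  assumes g: "g < num_edges N" "s \<in> {0..1}"
    and best: "\<And>h c. h < num_edges N \<Longrightarrow> c \<in> candidates N d h \<Longrightarrow>
      worst_regret N d g s \<le> worst_regret N d h c"
  shows "minmax_regret_solution N (On_Edge g s)"
proof -
  have edge: "max_regret N (On_Edge g s) \<le> max_regret N (On_Edge h t)"
    if h: "h < num_edges N" "t \<in> {0..1}" for h t
  proof -
    obtain c where "c \<in> candidates N d h" "worst_regret N d h c \<le> worst_regret N d h t"
      using candidate_le[OF h] by blast
    with best[OF h(1)] show ?thesis
      unfolding max_regret_eq[OF g] max_regret_eq[OF h] by (blast intro: order_trans)
  qed
  have "max_regret N (On_Edge g s) \<le> max_regret N y" if "y \<in> points N" for y
  proof -
    from that consider v where "y = At_Node v" "v \<in> {1..num_nodes N}" | h t where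
      "y = On_Edge h t" "h < num_edges N" "t \<in> {0..1}"
      unfolding points_def by blast
    then show ?thesis
    proof cases
      case 1
      have "0 < num_edges N"
        by (rule le_less_trans[OF le0 g(1)])
      then obtain h t where "h < num_edges N" "t \<in> {0..1}"
        "\<And>w. coverage N (At_Node v) w = coverage N (On_Edge h t) w"
        using 1(2) by (rule coverage_At_Node) blast
      with edge[of h t] 1(1) show ?thesis
        by (simp add: max_regret_def)
    next
      case 2
      with edge show ?thesis
        by simp
    qed
  qed
  moreover have "On_Edge g s \<in> points N"
    using g by (auto simp: points_def)
  ultimately show ?thesis
    unfolding minmax_regret_solution_def is_arg_min_def by (simp add: not_less)
qed

end


section \<open>Computability of the candidate sets\<close>

text \<open>Layer number \<open>num_nodes\<close> holds the node distances, by
  \<open>layer_eq_node_dist\<close>.\<close>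

definition dst :: "env \<Rightarrow> nat \<Rightarrow> nat \<Rightarrow> real" where
  "dst z u v = table z [num_nodes (net z), u, v]"

lemma dst_simps [simp]: "dst (npop z) = dst z" "dst (rpop z) = dst z" "dst (rpush a z) = dst z"
  by (simp_all add: dst_def fun_eq_iff)

lemma real_comp_dst: "nat_comp a \<Longrightarrow> nat_comp b \<Longrightarrow> real_comp (\<lambda>z. dst z (a z) (b z))"
  unfolding dst_def by (intro real_comp_intros)

lemma real_comp_apply:
  assumes "real_comp (\<lambda>z. F (rtop z) (rpop z))" "real_comp a"
  shows "real_comp (\<lambda>z. F (a z) z)"
  using real_comp_subst[OF assms(2,1)] by simp

text \<open>Weakening below a binder: the innermost real variable is kept while the environment
  beneath it is changed by \<open>X\<close>.\<close>

lemma real_comp_shift: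
  assumes "real_comp (\<lambda>z. F (rtop z) (rpop z))" "view X"
  shows "real_comp (\<lambda>z. F (rtop z) (X (rpop z)))"
proof -
  have "view (\<lambda>z. X (rpop z))"
    using assms(2) unfolding view_def rpop_def net_def table_def nat_vars_def real_vars_def by auto
  then have "view (\<lambda>z. rpush (rtop z) (X (rpop z)))"
    by (intro view_intros)
  from real_comp_view[OF assms(1) this] show ?thesis
    by simp
qed

lemma real_comp_sum_pairs:
  assumes "finite J" "\<And>j. j \<in> J \<Longrightarrow> real_comp (\<lambda>z. f (ntop z, j) (npop z))"
  shows "real_comp (\<lambda>z. \<Sum>x\<in>{..<num_edges (net z)} \<times> J. f x z)"
proof -
  have "real_comp (\<lambda>z. \<Sum>j\<in>J. f (ntop z, j) (npop z))"
    using assms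
    by (induction J rule: finite_induct) (auto intro: real_comp_numeral real_comp_arith)
  then have "real_comp (\<lambda>z. \<Sum>i<num_edges (net z). \<Sum>j\<in>J. f (i, j) z)"
    by (rule real_comp_sum)
  then show ?thesis
    by (simp add: sum.cartesian_product)
qed

lemmas comp_intros = real_comp_intros real_comp_dst real_comp_sum_pairs real_comp_root
  real_comp_if_le set_comp_empty set_comp_insert set_comp_Un set_comp_UN_pairs set_comp_UN_edges
  set_comp_UN set_comp_UN_const set_comp_if_le finite_class.finite_UNIV finite_lessThan

lemmas pop_simps = net_simps dst_simps fst_conv snd_conv

lemma real_comp_aff:
  assumes "nat_comp g" "nat_comp e" "real_comp s"
  shows "real_comp (\<lambda>z. aff (net z) (dst z) (g z) (e z) j (s z))"
  unfolding aff_def by (intro comp_intros assms)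

lemma real_comp_clip: "real_comp f \<Longrightarrow> real_comp (\<lambda>z. clip (f z))"
  unfolding clip_def by (intro comp_intros)

lemma real_comp_moment: "real_comp f \<Longrightarrow> real_comp (\<lambda>z. moment b (f z))"
  unfolding moment_def by (cases b) (simp_all, (intro comp_intros; assumption)+)

lemma real_comp_parts:
  assumes "nat_comp g" "nat_comp e" "real_comp s"
  shows "real_comp (\<lambda>z. left_part (net z) (dst z) (g z) (e z) (s z))"
    "real_comp (\<lambda>z. right_part (net z) (dst z) (g z) (e z) (s z))"
  unfolding right_part_def left_part_def
  by (intro comp_intros real_comp_clip real_comp_aff assms)+

lemma real_comp_share:
  assumes "nat_comp g" "nat_comp e" "real_comp s"
  shows "real_comp (\<lambda>z. share (net z) (dst z) (g z) (e z, b) (s z))"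
  unfolding share_def fst_conv snd_conv
  by (intro comp_intros real_comp_moment real_comp_clip real_comp_aff real_comp_parts assms)

lemma set_comp_unit_part: "set_comp A \<Longrightarrow> set_comp (\<lambda>z. unit_part (A z))"
  unfolding unit_part_def by (intro comp_intros)

lemma set_comp_breaks:
  assumes "nat_comp g"
  shows "set_comp (\<lambda>z. breaks (net z) (dst z) (g z))"
  unfolding breaks_def crossing_def
  by ((intro comp_intros set_comp_unit_part real_comp_aff nat_comp_view[OF assms]) |
      simp only: pop_simps)+

lemma real_comp_quad:
  assumes "real_comp (\<lambda>z. F (rtop z) (rpop z))" "real_comp u" "real_comp v"
  shows "real_comp (\<lambda>z. quad2 (\<lambda>s. F s z) (u z) (v z))"
    "real_comp (\<lambda>z. quad1 (\<lambda>s. F s z) (u z) (v z))"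
    "real_comp (\<lambda>z. quad0 (\<lambda>s. F s z) (u z) (v z))"
    "real_comp (\<lambda>z. vertex (\<lambda>s. F s z) (u z) (v z))"
  unfolding vertex_def quad0_def quad1_def quad2_def
  by (intro comp_intros assms real_comp_apply[OF assms(1)])+

lemma real_comp_quad_at:
  "real_comp a \<Longrightarrow> real_comp b \<Longrightarrow> real_comp c \<Longrightarrow> real_comp t \<Longrightarrow>
    real_comp (\<lambda>z. quad_at (a z) (b z) (c z) (t z))"
  unfolding quad_at_def by (intro comp_intros)

lemma set_comp_roots:
  "real_comp c0 \<Longrightarrow> real_comp c1 \<Longrightarrow> real_comp c2 \<Longrightarrow> real_comp c3 \<Longrightarrow> real_comp c4 \<Longrightarrow>
    set_comp (\<lambda>z. roots (c0 z) (c1 z) (c2 z) (c3 z) (c4 z))"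
  unfolding roots_def by (intro comp_intros)

lemma set_comp_crit1:
  assumes "real_comp a" "real_comp b" "real_comp c0" "real_comp c1" "real_comp c2" "real_comp t"
  shows "set_comp (\<lambda>z. crit1 (a z) (b z) (c0 z) (c1 z) (c2 z) (t z))"
  unfolding crit1_def by (intro comp_intros set_comp_roots real_comp_quad_at assms)

lemma set_comp_crit3_poly:
  assumes "real_comp a" "real_comp b" "real_comp c0" "real_comp c1" "real_comp c2" "real_comp D"
    "real_comp w0" "real_comp w1" "real_comp w2"
  shows "set_comp (\<lambda>z. crit3_poly (a z) (b z) (c0 z) (c1 z) (c2 z) (D z) (w0 z) (w1 z) (w2 z))"
  unfolding crit3_poly_def by (intro comp_intros set_comp_roots assms)

lemma set_comp_crit23:
  assumes "real_comp a" "real_comp b" "real_comp c0" "real_comp c1" "real_comp c2"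
    "real_comp a'" "real_comp b'" "real_comp c0'" "real_comp c1'" "real_comp c2'"
  shows "set_comp (\<lambda>z. crit2 (a z) (b z) (c0 z) (c1 z) (c2 z) (a' z) (b' z) (c0' z) (c1' z) (c2' z))"
    "set_comp (\<lambda>z. crit3 (a z) (b z) (c0 z) (c1 z) (c2 z) (a' z) (b' z) (c0' z) (c1' z) (c2' z))"
  unfolding crit2_def crit3_def by (intro comp_intros set_comp_roots set_comp_crit3_poly assms)+

text \<open>\<open>C\<close> is traversed twice, and the inner traversal takes place under the
  variable of the outer one; this is the second assumption.\<close>

lemma set_comp_midpoints:
  "set_comp C \<Longrightarrow> set_comp (\<lambda>z. C (rpop z)) \<Longrightarrow> set_comp (\<lambda>z. midpoints (C z))"
  unfolding midpoints_def by (intro comp_intros)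

lemma set_comp_vertices:
  assumes "real_comp (\<lambda>z. F (rtop z) (rpop z))" "set_comp T" "set_comp (\<lambda>z. T (rpop z))"
  shows "set_comp (\<lambda>z. vertices (\<lambda>s. F s z) (T z))"
proof -
  have "real_comp (\<lambda>z. F (rtop z) (rpop (rpop (rpop z))))"
    using real_comp_shift[OF assms(1), of "\<lambda>z. rpop (rpop z)"] by (simp add: view_intros)
  then show ?thesis
    unfolding vertices_def by (intro comp_intros assms real_comp_quad)
qed

lemma real_comp_bounds:
  assumes "nat_comp e"
  shows "real_comp (\<lambda>z. low (net z) (e z, b))" "real_comp (\<lambda>z. high (net z) (e z, b))"
  using assms by (cases b; simp add: low_def high_def; intro comp_intros; assumption)+

lemma real_comp_pair_regret:
  assumes "nat_comp g" "nat_comp h" "real_comp s" "real_comp t"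
  shows "real_comp (\<lambda>z. pair_regret (net z) (dst z) (g z) (s z) (h z) (t z))"
  unfolding pair_regret_def hinge_sum_def hinge_def
  by ((intro comp_intros real_comp_share real_comp_bounds nat_comp_view[OF assms(1)]
      nat_comp_view[OF assms(2)] real_comp_view[OF assms(3)] real_comp_view[OF assms(4)]) |
      simp only: pop_simps)+

lemmas cell_intros = comp_intros real_comp_share real_comp_quad real_comp_pair_regret
  set_comp_crit1 set_comp_crit23 set_comp_roots set_comp_midpoints set_comp_vertices
  set_comp_unit_part set_comp_breaks

lemma set_comp_crits:
  assumes "nat_comp g" "nat_comp h" "real_comp s1" "real_comp s2" "real_comp t1" "real_comp t2"
  shows "set_comp (\<lambda>z. crits (indices (net z)) (share (net z) (dst z) (g z))
    (share (net z) (dst z) (h z)) (s1 z) (s2 z) (t1 z) (t2 z))"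
  unfolding crits_def
  by ((intro cell_intros assms(1,2)[THEN nat_comp_view] assms(3-6)[THEN real_comp_view]) |
      simp only: pop_simps)+

lemma set_comp_line_roots:
  assumes "nat_comp g" "nat_comp h" "real_comp s" "real_comp t1" "real_comp t2"
  shows "set_comp (\<lambda>z. line_roots (indices (net z)) (share (net z) (dst z) (g z))
    (share (net z) (dst z) (h z)) (s z) (t1 z) (t2 z))"
  unfolding line_roots_def
  by ((intro cell_intros assms(1,2)[THEN nat_comp_view] assms(3-5)[THEN real_comp_view]) |
      simp only: pop_simps)+

lemma set_comp_cell_vertices:
  assumes "nat_comp g" "nat_comp h" "real_comp s1" "real_comp s2" "real_comp t1" "real_comp t2"
  shows "set_comp (\<lambda>z. cell_vertices (indices (net z)) (low (net z)) (high (net z))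
    (share (net z) (dst z) (g z)) (share (net z) (dst z) (h z)) (s1 z) (s2 z) (t1 z) (t2 z))"
  unfolding cell_vertices_def pair_regret_def[symmetric]
  by ((intro cell_intros set_comp_crits set_comp_line_roots assms(1,2)[THEN nat_comp_view]
      assms(3-6)[THEN real_comp_view]) | simp only: pop_simps)+

lemma set_comp_rivals:
  assumes "nat_comp g" "nat_comp h"
  shows "set_comp (\<lambda>z. rivals (net z) (dst z) (g z) (h z))"
  unfolding rivals_def best_responses_def
  by ((intro cell_intros set_comp_cell_vertices assms[THEN nat_comp_view]) | simp only: pop_simps)+

text \<open>Computable sets consist of reals only, so a set of pairs is traversed as a loop over
  edges around a real set.\<close>

lemma set_comp_UN_rival_points:
  assumes g: "nat_comp g" and A: "set_comp (\<lambda>z. A (ntop (rpop z), rtop z) (npop (rpop z)))"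
  shows "set_comp (\<lambda>z. \<Union>j\<in>rival_points (net z) (dst z) (g z). A j z)"
proof -
  have "set_comp (\<lambda>z. rivals (net (npop z)) (dst (npop z)) (g (npop z)) (ntop z))"
    by ((intro set_comp_rivals nat_comp_view[OF g] comp_intros) | simp only: pop_simps)+
  then have "set_comp (\<lambda>z. \<Union>t\<in>rivals (net (npop z)) (dst (npop z)) (g (npop z)) (ntop z).
      A (ntop z, t) (npop z))"
    using A by (rule set_comp_UN)
  then have "set_comp (\<lambda>z. \<Union>h<num_edges (net z). \<Union>t\<in>rivals (net z) (dst z) (g z) h. A (h, t) z)"
    by (rule set_comp_UN_edges)
  moreover have "(\<Union>j\<in>rival_points (net z) (dst z) (g z). A j z) =
      (\<Union>h<num_edges (net z). \<Union>t\<in>rivals (net z) (dst z) (g z) h. A (h, t) z)" for z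
    by (auto simp: rival_points_def)
  ultimately show ?thesis
    by simp
qed

lemma set_comp_rival_breaks:
  assumes "nat_comp g"
  shows "set_comp (\<lambda>z. rival_breaks (net z) (dst z) (g z))"
  unfolding rival_breaks_def value_roots_def
  by ((intro cell_intros set_comp_UN_rival_points nat_comp_view[OF assms]) | simp only: pop_simps)+

lemma set_comp_candidates:
  assumes "nat_comp g"
  shows "set_comp (\<lambda>z. candidates (net z) (dst z) (g z))"
  unfolding candidates_def envelope_points_def
  by ((intro cell_intros set_comp_rival_breaks set_comp_UN_rival_points nat_comp_view[OF assms]) |
      simp only: pop_simps)+

text \<open>\<open>worst_regret\<close> in the form the loops deliver. Each maximum needs a default,
  here the regret against the point 0 of \<open>g\<close>, which is itself a rival.\<close>

definition worst_value :: "network \<Rightarrow> (nat \<Rightarrow> nat \<Rightarrow> real) \<Rightarrow> nat \<Rightarrow> real \<Rightarrow> real" where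
  "worst_value N d g s = Max (insert (pair_regret N d g s g 0)
    ((\<lambda>h. Max (insert (pair_regret N d g s g 0) ((\<lambda>t. pair_regret N d g s h t) ` rivals N d g h))) ` {..<num_edges N}))"

text \<open>The negated minimum, since only maxima are computable by definition. The default is the
  point 0 of edge 0; some candidate on that edge is at least as good by
  \<open>candidate_le\<close>.\<close>

definition best_value :: "network \<Rightarrow> (nat \<Rightarrow> nat \<Rightarrow> real) \<Rightarrow> real" where
  "best_value N d = Max (insert (- worst_value N d 0 0) ((\<lambda>g. Max (insert (- worst_value N d 0 0)
    ((\<lambda>c. - worst_value N d g c) ` candidates N d g))) ` {..<num_edges N}))"

text \<open>The value \<open>-1\<close> signals that no candidate on \<open>g\<close> is optimal.\<close>

definition choice :: "network \<Rightarrow> (nat \<Rightarrow> nat \<Rightarrow> real) \<Rightarrow> nat \<Rightarrow> real" where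
  "choice N d g = Max (insert (- 1)
    ((\<lambda>c. if best_value N d \<le> - worst_value N d g c then c else - 1) ` candidates N d g))"

lemma real_comp_worst_value:
  assumes "nat_comp g" "real_comp s"
  shows "real_comp (\<lambda>z. worst_value (net z) (dst z) (g z) (s z))"
  unfolding worst_value_def
  by ((intro cell_intros real_comp_Max set_comp_Max set_comp_rivals nat_comp_view[OF assms(1)]
      real_comp_view[OF assms(2)]) | simp only: pop_simps)+

lemma real_comp_best_value: "real_comp (\<lambda>z. best_value (net z) (dst z))"
  unfolding best_value_def
  by ((intro cell_intros real_comp_Max set_comp_Max set_comp_candidates real_comp_worst_value) |
      simp only: pop_simps)+

lemma real_comp_choice:
  assumes "nat_comp g"
  shows "real_comp (\<lambda>z. choice (net z) (dst z) (g z))"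
  unfolding choice_def
  by ((intro cell_intros set_comp_Max set_comp_candidates real_comp_worst_value real_comp_best_value
      nat_comp_view[OF assms]) | simp only: pop_simps)+

lemma worst_value_eq:
  assumes "g < num_edges N"
  shows "worst_value N d g s = worst_regret N d g s"
proof -
  let ?F = "\<lambda>j. pair_regret N d g s (fst j) (snd j)"
  have fin: "finite (rivals N d g h)" for h
    unfolding rivals_def by (intro finite_best_responses finite_breaks) simp
  have "(g, 0) \<in> rival_points N d g"
    using assms breaks_unit(1)[of N d g] by (simp add: rival_points_def rivals_def best_responses_def)
  then have "?F (g, 0) \<in> ?F ` rival_points N d g"
    by (rule imageI)
  then have "worst_regret N d g s = Max (insert (pair_regret N d g s g 0) (?F ` rival_points N d g))"
    unfolding worst_regret_def by (simp add: insert_absorb)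
  also have "rival_points N d g = (\<Union>h<num_edges N. Pair h ` rivals N d g h)"
    by (auto simp: rival_points_def)
  also have "Max (insert (pair_regret N d g s g 0) (?F ` \<dots>)) = worst_value N d g s"
    unfolding worst_value_def using fin by (subst Max_insert_UN) (simp_all add: image_image)
  finally show ?thesis ..
qed

lemma finite_candidates: "finite (candidates N d g)"
  unfolding candidates_def
  by (intro finite_envelope_points finite_rival_breaks finite_rival_points)

section \<open>Optimality of the chosen candidate\<close>

context network_distances
begin

lemma best_value_ge:
  assumes "h < num_edges N" "c \<in> candidates N d h"
  shows "- worst_regret N d h c \<le> best_value N d"
proof -
  have "- worst_value N d h c \<le> Max (insert (- worst_value N d 0 0)
      ((\<lambda>c. - worst_value N d h c) ` candidates N d h))"
    using assms(2) finite_candidates by (intro Max_ge) auto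
  also have "\<dots> \<le> best_value N d"
    unfolding best_value_def using assms(1) by (intro Max_ge) auto
  finally show ?thesis
    by (simp add: worst_value_eq[OF assms(1)])
qed

lemma choice_cases:
  assumes g: "g < num_edges N"
  shows "choice N d g = - 1 \<or> choice N d g \<in> candidates N d g \<and>
    best_value N d \<le> - worst_regret N d g (choice N d g)"
proof -
  have "choice N d g \<in> insert (- 1)
      ((\<lambda>c. if best_value N d \<le> - worst_value N d g c then c else - 1) ` candidates N d g)"
    unfolding choice_def using finite_candidates by (intro Max_in) auto
  then show ?thesis
    by (auto simp: worst_value_eq[OF g] split: if_splits)
qed

lemma solution_if_choice:
  assumes g: "g < num_edges N" "0 \<le> choice N d g"
  shows "minmax_regret_solution N (On_Edge g (choice N d g))"
proof (rule solution_if_best_candidate[OF g(1)])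
  have choice: "choice N d g \<in> candidates N d g"
    "best_value N d \<le> - worst_regret N d g (choice N d g)"
    using choice_cases[OF g(1)] g(2) by auto
  show "choice N d g \<in> {0..1}"
    using choice(1) candidates_unit by blast
  fix h c
  assume "h < num_edges N" "c \<in> candidates N d h"
  then show "worst_regret N d g (choice N d g) \<le> worst_regret N d h c"
    using best_value_ge[of h c] choice(2) by linarith
qed

lemma ex_choice:
  assumes "0 < num_edges N"
  shows "\<exists>g<num_edges N. 0 \<le> choice N d g"
proof -
  have "\<exists>g<num_edges N. \<exists>c\<in>candidates N d g. best_value N d \<le> - worst_value N d g c"
  proof -
    have "best_value N d \<in> insert (- worst_value N d 0 0) ((\<lambda>g. Max (insert (- worst_value N d 0 0)
        ((\<lambda>c. - worst_value N d g c) ` candidates N d g))) ` {..<num_edges N})"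
      unfolding best_value_def by (intro Max_in) auto
    then consider "best_value N d = - worst_value N d 0 0" | g where "g < num_edges N"
      "best_value N d = Max (insert (- worst_value N d 0 0)
        ((\<lambda>c. - worst_value N d g c) ` candidates N d g))"
      by auto
    then consider "best_value N d = - worst_value N d 0 0" | g c where "g < num_edges N"
      "c \<in> candidates N d g" "best_value N d = - worst_value N d g c"
    proof cases
      case (2 g)
      have "best_value N d \<in> insert (- worst_value N d 0 0)
          ((\<lambda>c. - worst_value N d g c) ` candidates N d g)"
        unfolding 2(2) using finite_candidates by (intro Max_in) auto
      with that 2(1) show ?thesis
        by blast
    qed (rule that(1))
    then show ?thesis
    proof cases
      case 1
      \<comment> \<open>If only the default attains the best value, a candidate on edge 0 attains it
        as well.\<close>
      obtain c where "c \<in> candidates N d 0" "worst_regret N d 0 c \<le> worst_regret N d 0 0"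
        using candidate_le[OF assms, of 0] by auto
      with 1 assms show ?thesis
        by (intro exI[of _ 0]) (auto simp: worst_value_eq[OF assms] simp del: length_greater_0_conv)
    qed auto
  qed
  then obtain g c where c: "g < num_edges N" "c \<in> candidates N d g"
    "best_value N d \<le> - worst_value N d g c"
    by blast
  have "0 \<le> c"
    using c(2) candidates_unit[of g] by auto
  also have "c \<le> choice N d g"
    unfolding choice_def using c(2,3) finite_candidates by (intro Max_ge) (auto intro!: image_eqI)
  finally show ?thesis
    using c(1) by blast
qed

end


section \<open>The program\<close>

lemma holds_input_write:
  assumes "holds_input N s"
  shows "a \<notin> input_nat_arrays \<Longrightarrow> holds_input N (write_nat a js x s)"
    and "b \<notin> input_real_arrays \<Longrightarrow> holds_input N (write_real b js y s)"
  using assms by (auto simp: holds_input_def write_nat_def write_real_def)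

text \<open>The machine cannot convert a real into an edge number. The program therefore evaluates
  \<open>choice\<close> for every edge and records the counter whenever the result is nonnegative;
  the last such edge remains.\<close>

lemma choice_program:
  "\<exists>c (p :: nat poly). \<forall>N s. is_network N \<longrightarrow> layers_done N (Suc (num_nodes N)) s \<longrightarrow>
    0 < num_edges N \<longrightarrow> (\<exists>t s'. exec c s t s' \<and> t \<le> poly p (num_edges N) \<and>
      minmax_regret_solution N (output_point s'))"
proof -
  let ?f = "\<lambda>z. choice (net z) (dst z) (ntop z)"
  let ?l = "\<lambda>j::nat. 0::nat"
  have bounds: "\<forall>j. ?l j < 1"
    by simp
  have "real_comp ?f"
    by (intro real_comp_choice comp_intros)
  then obtain c p where c: "computes 1 1 ?l ?l c p ?f"
    using real_compD[OF _ bounds bounds] by blast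
  let ?set = "Seq (NAssign ''edge'' [] (NCell ''i'' [NConst 0]))
    (RAssign ''t'' [] (RCell ''r'' [NConst 1]))"
  let ?body = "Seq c (Cond (RLe (RConst 0) (RCell ''r'' [NConst 1])) ?set Skip)"
  let ?loop = "For 0 (NCell ''num_edges'' []) ?body"
  let ?c = "Seq (NAssign ''at_node'' [] (NConst 0)) ?loop"
  \<comment> \<open>After \<open>c\<close>, a round costs at most a test and two assignments, and
    then the loop test and increment.\<close>
  let ?p = "1 + (2 + [:0, 1:] * (p + 3 + 2))"
  show ?thesis
  proof (intro exI[of _ ?c] exI[of _ ?p] allI impI)
    fix N s
    assume N: "is_network N" and s: "layers_done N (Suc (num_nodes N)) s" and m: "0 < num_edges N"
    define d where "d u v = real_cells s ''dd'' [num_nodes N, u, v]" for u v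
    interpret valid_network N
      using N by unfold_locales
    interpret network_distances N d
    proof
      fix u v
      assume uv: "u \<in> {1..num_nodes N}" "v \<in> {1..num_nodes N}"
      then have "d u v = layer N (num_nodes N) u v"
        using s by (simp add: layers_done_def d_def)
      then show "d u v = node_dist N u v"
        using layer_eq_node_dist[OF uv] by simp
    qed
    define Inv where "Inv q s' \<longleftrightarrow> holds_input N s' \<and> real_cells s' ''dd'' = real_cells s ''dd'' \<and>
      nat_cells s' ''at_node'' [] = 0 \<and> ((\<exists>g<q. 0 \<le> choice N d g) \<longrightarrow>
        nat_cells s' ''edge'' [] < num_edges N \<and> 0 \<le> choice N d (nat_cells s' ''edge'' []) \<and>
        real_cells s' ''t'' [] = choice N d (nat_cells s' ''edge'' []))" for q s'
    have counter: "Inv q (write_nat ''i'' [0] v s')" if "Inv q s'" for q s' v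
    proof -
      have "holds_input N (write_nat ''i'' [0] v s')"
        using that by (intro holds_input_write(1)) (simp_all add: Inv_def input_nat_arrays_def)
      with that show ?thesis
        by (simp add: Inv_def, simp add: write_nat_def)
    qed
    let ?s0 = "write_nat ''at_node'' [] 0 s"
    have "holds_input N ?s0"
      using s by (intro holds_input_write(1)) (simp_all add: layers_done_def input_nat_arrays_def)
    then have start: "Inv 0 ?s0"
      by (simp add: Inv_def, simp add: write_nat_def)
    have "\<exists>t s'. exec ?loop ?s0 t s' \<and> t \<le> 2 + num_edges N * (poly p (num_edges N) + 3 + 2) \<and>
        Inv (num_edges N) s'"
    proof (rule exec_For[where Inv = Inv, OF _ counter _ start])
      show "nval (NCell ''num_edges'' []) s' = num_edges N" if "Inv q s'" for q s'
        using that by (intro holds_input_num_edges) (simp add: Inv_def)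
    next
      fix q s1
      assume q: "q < num_edges N" "Inv q s1" "nat_cells s1 ''i'' [0] = q"
      then have "holds_input N s1"
        by (simp add: Inv_def)
      with c obtain t s2 where 2: "exec c s1 t s2" "t \<le> poly p (num_edges N)"
        "real_cells s2 ''r'' [1] = ?f (env_of N ?l ?l s1)" "frame 1 1 s1 s2" "holds_input N s2"
        by (rule computesE)
      have "dst (env_of N ?l ?l s1) = d"
        using q(2) by (intro ext) (simp add: dst_def d_def env_of_def table_def net_def Inv_def)
      then have val: "real_cells s2 ''r'' [1] = choice N d q"
        using 2(3) q(3) by (simp add: env_of_def ntop_def nat_vars_def net_def)
      have i: "nat_cells s2 ''i'' [0] = q"
        using frame_nat[OF 2(4)] q(3) by simp
      have same: "nat_cells s2 ''at_node'' = nat_cells s1 ''at_node''"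
        "nat_cells s2 ''edge'' = nat_cells s1 ''edge''" "real_cells s2 ''t'' = real_cells s1 ''t''"
        "real_cells s2 ''dd'' = real_cells s1 ''dd''"
        using 2(4) by (auto simp: frame_def)
      show "\<exists>t s'. exec ?body s1 t s' \<and> t \<le> poly p (num_edges N) + 3 \<and> Inv (Suc q) s' \<and>
          nat_cells s' ''i'' [0] = q"
      proof (cases "0 \<le> choice N d q")
        case True
        let ?s = "write_real ''t'' [] (choice N d q) (write_nat ''edge'' [] q s2)"
        have "exec ?set s2 (1 + 1) ?s"
          using exec_Seq[OF exec_NAssign[of "''edge''" "[]" "NCell ''i'' [NConst 0]" s2]
              exec_RAssign[of "''t''" "[]" "RCell ''r'' [NConst 1]"]] i val
          by (simp add: write_nat_def)
        then have "exec ?body s1 (t + (1 + (1 + 1))) ?s"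
          using True val by (intro exec_Seq[OF 2(1)] exec_IfTrue) simp_all
        moreover have "holds_input N ?s"
          using 2(5)
          by (intro holds_input_write) (simp_all add: input_nat_arrays_def input_real_arrays_def)
        then have "Inv (Suc q) ?s"
          using q(1,2) same True
          by (simp add: Inv_def del: length_greater_0_conv) (simp add: write_nat_def write_real_def)
        moreover have "nat_cells ?s ''i'' [0] = q"
          using i by (simp add: write_nat_def write_real_def)
        ultimately show ?thesis
          using 2(2) by (intro exI[of _ "t + (1 + (1 + 1))"] exI[of _ ?s]) simp
      next
        case False
        have "exec ?body s1 (t + (1 + 1)) s2"
          using False val by (intro exec_Seq[OF 2(1)] exec_IfFalse exec_Skip) simp
        moreover have "Inv (Suc q) s2"
          using q(2) same False 2(5) by (auto simp: Inv_def less_Suc_eq)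
        ultimately show ?thesis
          using 2(2) i by (intro exI[of _ "t + (1 + 1)"] exI[of _ s2]) simp
      qed
    qed
    then obtain t s' where 1: "exec ?loop ?s0 t s'"
      "t \<le> 2 + num_edges N * (poly p (num_edges N) + 3 + 2)" "Inv (num_edges N) s'"
      by blast
    have "exec ?c s (1 + t) s'"
      using exec_Seq[OF exec_NAssign[of "''at_node''" "[]" "NConst 0" s]] 1(1) by simp
    moreover have "1 + t \<le> poly ?p (num_edges N)"
      using 1(2) by (simp add: algebra_simps)
    moreover have "minmax_regret_solution N (output_point s')"
      using 1(3) ex_choice[OF m] solution_if_choice by (simp add: Inv_def output_point_def)
    ultimately show "\<exists>t s'. exec ?c s t s' \<and> t \<le> poly ?p (num_edges N) \<and>
        minmax_regret_solution N (output_point s')"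
      by blast
  qed
qed

theorem theorem7:
  shows "\<exists>(prog :: com) (p :: nat poly).
    \<forall>N. is_network N \<longrightarrow>
      (\<exists>time s. exec prog (input_store N) time s \<and>
                time \<le> poly p (num_edges N) \<and>
                minmax_regret_solution N (output_point s))"
proof -
  obtain c0 and p0 :: "nat poly" where c0: "\<And>N s. is_network N \<Longrightarrow> holds_input N s \<Longrightarrow>
      \<exists>t s'. exec c0 s t s' \<and> t \<le> poly p0 (num_edges N) \<and> layers_done N (Suc (num_nodes N)) s'"
    using distance_table_program by blast
  obtain c1 and p1 :: "nat poly" where c1: "\<And>N s. is_network N \<Longrightarrow>
      layers_done N (Suc (num_nodes N)) s \<Longrightarrow> 0 < num_edges N \<Longrightarrow>
      \<exists>t s'. exec c1 s t s' \<and> t \<le> poly p1 (num_edges N) \<and> minmax_regret_solution N (output_point s')"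
    using choice_program by blast
  let ?b = "NLe (NCell ''num_edges'' []) (NConst 0)"
  let ?single = "NAssign ''at_node'' [] (NConst 1)"
  show ?thesis
  proof (intro exI[of _ "Cond ?b ?single (Seq c0 c1)"] exI[of _ "2 + p0 + p1"] allI impI)
    fix N
    assume N: "is_network N"
    interpret valid_network N
      using N by unfold_locales
    have input: "holds_input N (input_store N)"
      by (simp add: holds_input_def)
    then have b: "bval ?b (input_store N) \<longleftrightarrow> num_edges N = 0"
      using holds_input_num_edges by simp
    show "\<exists>time s. exec (Cond ?b ?single (Seq c0 c1)) (input_store N) time s \<and>
        time \<le> poly (2 + p0 + p1) (num_edges N) \<and> minmax_regret_solution N (output_point s)"
    proof (cases "num_edges N = 0")
      case True
      let ?s = "write_nat ''at_node'' [] 1 (input_store N)"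
      \<comment> \<open>Without edges connectedness leaves only node 1, which has no representation
        as a point on an edge.\<close>
      have "num_nodes N = 1"
        using num_nodes_le num_nodes_pos True by simp
      then have "points N = {At_Node 1}"
        using True by (auto simp: points_def)
      then have "minmax_regret_solution N (At_Node 1)"
        by (simp add: minmax_regret_solution_def is_arg_min_def)
      moreover have "output_point ?s = At_Node 1"
        by (simp add: output_point_def write_nat_def)
      moreover have "exec (Cond ?b ?single (Seq c0 c1)) (input_store N) (1 + 1) ?s"
        using exec_NAssign[of "''at_node''" "[]" "NConst 1" "input_store N"] b True
        by (intro exec_IfTrue) simp_all
      ultimately show ?thesis
        by (intro exI[of _ "1 + 1"] exI[of _ ?s]) simp
    next
      case False
      then have m: "0 < num_edges N"
        by (rule neq0_conv[THEN iffD1])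
      obtain t0 s0 where 0: "exec c0 (input_store N) t0 s0" "t0 \<le> poly p0 (num_edges N)"
        "layers_done N (Suc (num_nodes N)) s0"
        using c0[OF N input] by blast
      obtain t1 s1 where 1: "exec c1 s0 t1 s1" "t1 \<le> poly p1 (num_edges N)"
        "minmax_regret_solution N (output_point s1)"
        using c1[OF N 0(3) m] by blast
      have "exec (Cond ?b ?single (Seq c0 c1)) (input_store N) (1 + (t0 + t1)) s1"
        using b False 0(1) 1(1) by (intro exec_IfFalse exec_Seq) simp_all
      then show ?thesis
        using 0(2) 1(2,3) by (intro exI[of _ "1 + (t0 + t1)"] exI[of _ s1]) simp
    qed
  qed
qed

end
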